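(* For every oriented link $L$ in $S^3$, $$\chi(L)\ge -\mathrm{ind}_{\vec{F}}(L)+2,$$ where $\chi(L)$ is the maximal Euler characteristic among all Seifert surfaces of $L$. In particular, if $L$ is a knot, then $$g(L)\le \frac{\mathrm{ind}_{\vec{F}}(L)-1}{2},$$ where $g(L)$ is the Seifert genus of $L$.
   Context: A Seifert surface of $L$ is a compact connected oriented surface in $S^3$ with oriented boundary $L$. A standard dyadic (s.d.) interval is an interval $[\frac{k}{2^m},\frac{k+1}{2^m}]$ with integers $m\ge 0$, $0\le k\le 2^m-1$. An s.d. $n$-partition $\mathcal{I}$ is a partition $0=a_0<a_1<\dots<a_n=1$ (the $a_i$ are its breakpoints) all of whose subintervals $[a_i,a_{i+1}]$ are s.d. intervals. Thompson group $F$: the group of piecewise linear orientation-preserving homeomorphisms of $[0,1]$ whose slopes are powers of $2$ and whose breakpoints are dyadic rationals. If $\mathcal{I}$ ($a_0<\dots<a_n$) and $\mathcal{J}$ ($b_0<\dots<b_n$) are s.d. $n$-partitions, the map with $a_i\mapsto b_i$, linear on each $[a_i,a_{i+1}]$, is an element of $F$, said to be represented by $(\mathcal{I},\mathcal{J})$. The pair is reduced if there is no $i$ with $1\le i\le n-1$ such that both $[a_{i-1},a_{i+1}]$ and $[b_{i-1},b_{i+1}]$ are s.d. intervals; every $g\in F$ is represented by a unique reduced pair, and the leaf number of $g$ is the number $n$ of subintervals in that pair. Tree and signs: let $\mathcal{S}(\mathcal{I})$ be the set of s.d. intervals of the form $[a_i,a_j]$. The planar binary tree $F_{\mathcal{I}}$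 (root edge at the top) has one edge for each element of $\mathcal{S}(\mathcal{I})$; the root edge is $[0,1]$, and each $B\in\mathcal{S}(\mathcal{I})$ that is not a subinterval of $\mathcal{I}$ ends below at a trivalent vertex from which the left half and the right half of $B$ descend as left and right edges; the lowermost edges (leaves) are the subintervals of $\mathcal{I}$. Edges carry signs: $[0,1]$ has sign $+$, a left edge has the same sign as its parent edge, a right edge has the opposite sign to its parent edge. Let $\sigma_{\mathcal{I}}$ be the sequence of signs of the $n$ leaves from left to right. The oriented Thompson group $\vec{F}$ consists of the $g\in F$ for which some (equivalently every) representing pair $(\mathcal{I},\mathcal{J})$ has $\sigma_{\mathcal{I}}=\sigma_{\mathcal{J}}$; such a pair is called compatible. Link: from $F_{\mathcal{I}}$ form a tangle $T_{\mathcal{I}}$ by attaching at each trivalent vertex a vertical strand going straight down to the bottom, and turning the resulting 4-valent vertex into a crossing whose under-strand is the parent edge continued into the added vertical strand and whose over-strand is the left edge joined to the right edge. It has one top endpoint and $2n-1$ bottom endpoints. Orient the arc of each edge upward if the edge has sign $+$ and downward if it has sign $-$ (the added vertical strand continues the orientation of the parent edge). Add a vertical strand on the far left and join its top to the top endpoint of $T_{\mathcal{I}}$ by a cap; orientation extended along it (so it runs downward). This gives an oriented $(0,2n)$-tangle $\widehat{T_{\mathcal{I}}}$. For a compatible pair $(\mathcal{I},\mathcal{J})$, the oriented link $L_{(\mathcal{I},\mathcal{J})}$ is obtained by placing $\widehat{T_{\mathcal{I}}}$ on top of $-\overline{\widehat{T_{\mathcal{J}}}}$ (the reflection of the planar diagram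 of $\widehat{T_{\mathcal{J}}}$ in a horizontal line, keeping which strand is over at each crossing, with reversed orientation) and joining the $2n$ endpoints in order. For $g\in\vec{F}$, $L_g:=L_{(\mathcal{I},\mathcal{J})}$ with $(\mathcal{I},\mathcal{J})$ the reduced pair representing $g$. Oriented Thompson index: for an oriented link $L$, $\mathrm{ind}_{\vec{F}}(L)$ is the smallest leaf number of an element $g\in\vec{F}$ with $L_g=L$ (by a known theorem of Aiello every oriented link is $L_g$ for some $g\in\vec{F}$). *)

theory Defs
  imports "HOL-Analysis.Analysis"
begin

section \<open>Polygonal links and surfaces in the three-sphere\<close>

text \<open>
  Links and surfaces are tame, and the piecewise linear category is used. The sphere carries its
  standard piecewise linear structure: a linear simplex in four-space that avoids the origin is
  projected radially to the unit sphere by \<^const>\<open>sgn\<close>. Thus a compact polyhedron in the sphere is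
  given by a polyhedron in four-space which misses the origin and meets each ray from the origin
  at most once. In particular a polyhedron in ordinary three-space is placed in the sphere
  by putting it into the affine hyperplane where the last coordinate is 1.
\<close>

type_synonym R4 = "real \<times> real \<times> real \<times> real"

definition S3 :: "R4 set" where
  "S3 = sphere 0 1"

definition radial :: "R4 set \<Rightarrow> bool" where
  "radial X \<longleftrightarrow> 0 \<notin> X \<and> inj_on sgn X"

text \<open>An oriented polygon is the set of its directed edges (initial point, terminal point).\<close>

definition polygon_support :: "('a::real_vector \<times> 'a) set \<Rightarrow> 'a set" where
  "polygon_support E = (\<Union>(p, q)\<in>E. closed_segment p q)"

definition oriented_link :: "(R4 \<times> R4) set \<Rightarrow> bool" where
  "oriented_link E \<longleftrightarrow>
     finite E \<and> E \<noteq> {} \<and>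
     (\<forall>(p, q)\<in>E. p \<noteq> q) \<and>
     (\<forall>(p, q)\<in>E. \<forall>(r, s)\<in>E. (p, q) \<noteq> (r, s) \<longrightarrow>
        closed_segment p q \<inter> closed_segment r s \<subseteq> {p, q} \<inter> {r, s}) \<and>
     (\<forall>v \<in> fst ` E \<union> snd ` E. (\<exists>!e. e \<in> E \<and> fst e = v) \<and> (\<exists>!e. e \<in> E \<and> snd e = v)) \<and>
     radial (polygon_support E)"

definition knot :: "(R4 \<times> R4) set \<Rightarrow> bool" where
  "knot E \<longleftrightarrow> oriented_link E \<and> connected (polygon_support E)"

definition ambient_isotopy :: "(real \<Rightarrow> R4 \<Rightarrow> R4) \<Rightarrow> bool" where
  "ambient_isotopy H \<longleftrightarrow>
     continuous_on ({0..1} \<times> S3) (\<lambda>(t, x). H t x) \<and>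
     (\<forall>t\<in>{0..1}. \<exists>G. homeomorphism S3 S3 (H t) G) \<and>
     (\<forall>x\<in>S3. H 0 x = x)"

text \<open>
  A map \<^term>\<open>f\<close> carrying one link onto another respects the orientations if, whenever
  it sends a piece of a directed edge into a single directed edge of the target, it does so in an
  increasing way. Every edge contains such pieces, by compactness.
\<close>

definition carries :: "(R4 \<Rightarrow> R4) \<Rightarrow> (R4 \<times> R4) set \<Rightarrow> (R4 \<times> R4) set \<Rightarrow> bool" where
  "carries f E E' \<longleftrightarrow>
     f ` sgn ` polygon_support E = sgn ` polygon_support E' \<and>
     (\<forall>(p, q)\<in>E. \<forall>(r, s)\<in>E'. \<forall>a b c d.
        0 \<le> a \<and> a < b \<and> b \<le> 1 \<and> c \<in> {0..1} \<and> d \<in> {0..1} \<and>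
        f ` sgn ` linepath p q ` {a..b} \<subseteq> sgn ` closed_segment r s \<and>
        f (sgn (linepath p q a)) = sgn (linepath r s c) \<and>
        f (sgn (linepath p q b)) = sgn (linepath r s d) \<longrightarrow> c < d)"

definition isotopic :: "(R4 \<times> R4) set \<Rightarrow> (R4 \<times> R4) set \<Rightarrow> bool" where
  "isotopic E E' \<longleftrightarrow> (\<exists>H. ambient_isotopy H \<and> carries (H 1) E E')"


section \<open>Seifert surfaces\<close>

text \<open>
  A compact oriented surface is given by a triangulation with coherently oriented triangles. An
  oriented triangle is represented by the three cyclic rotations of an ordered triple of vertices.
  Coherence says that a directed edge lies in at most one oriented triangle; hence an undirected
  edge lies in at most two triangles, which then induce opposite directions on it. Together with
  connectedness of the vertex links (each of which is then a path or a cycle)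
  this is the usual combinatorial condition for a triangulated surface with boundary.
\<close>

definition surface_support :: "(R4 \<times> R4 \<times> R4) set \<Rightarrow> R4 set" where
  "surface_support S = (\<Union>(a, b, c)\<in>S. convex hull {a, b, c})"

definition oriented_surface :: "(R4 \<times> R4 \<times> R4) set \<Rightarrow> bool" where
  "oriented_surface S \<longleftrightarrow>
     S \<noteq> {} \<and>
     (\<forall>(a, b, c)\<in>S. a \<noteq> b \<and> b \<noteq> c \<and> a \<noteq> c \<and> \<not> affine_dependent {a, b, c}) \<and>
     triangulation ((\<lambda>(a, b, c). convex hull {a, b, c}) ` S) \<and>
     (\<forall>(a, b, c)\<in>S. (b, c, a) \<in> S \<and> (b, a, c) \<notin> S) \<and>
     (\<forall>a b c d. (a, b, c) \<in> S \<and> (a, b, d) \<in> S \<longrightarrow> c = d) \<and>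
     (\<forall>v b c b' c'. (v, b, c) \<in> S \<and> (v, b', c') \<in> S \<longrightarrow>
        (b, b') \<in> ({(x, y). (v, x, y) \<in> S} \<union> {(y, x). (v, x, y) \<in> S})\<^sup>*) \<and>
     radial (surface_support S)"

definition oriented_boundary :: "(R4 \<times> R4 \<times> R4) set \<Rightarrow> (R4 \<times> R4) set" where
  "oriented_boundary S = {(a, b). (\<exists>c. (a, b, c) \<in> S) \<and> \<not> (\<exists>c. (b, a, c) \<in> S)}"

definition euler_characteristic :: "(R4 \<times> R4 \<times> R4) set \<Rightarrow> int" where
  "euler_characteristic S =
     int (card {a. \<exists>b c. (a, b, c) \<in> S}) - int (card {{a, b} | a b. \<exists>c. (a, b, c) \<in> S})
       + int (card {{a, b, c} | a b c. (a, b, c) \<in> S})"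

text \<open>
  The number computed here is the integer \<open>g\<close> with \<open>\<chi> = 2 - 2 g - b\<close>, where \<open>b\<close> is the number
  of boundary components.
\<close>

definition surface_genus :: "(R4 \<times> R4 \<times> R4) set \<Rightarrow> real" where
  "surface_genus S =
     (2 - real (card (components (polygon_support (oriented_boundary S))))
        - real_of_int (euler_characteristic S)) / 2"

text \<open>
  As usual a link stands for its isotopy class, so the oriented boundary of a Seifert surface of
  \<^term>\<open>L\<close> is only required to be isotopic to \<^term>\<open>L\<close>. Carrying the surface along the
  isotopy turns it into a tame surface bounded by \<^term>\<open>L\<close> itself.
\<close>

definition seifert_surface :: "(R4 \<times> R4 \<times> R4) set \<Rightarrow> (R4 \<times> R4) set \<Rightarrow> bool" where
  "seifert_surface S L \<longleftrightarrow>
     oriented_surface S \<and> connected (surface_support S) \<and> isotopic (oriented_boundary S) L"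

definition max_euler_characteristic :: "(R4 \<times> R4) set \<Rightarrow> int" where
  "max_euler_characteristic L = (GREATEST x. \<exists>S. seifert_surface S L \<and> x = euler_characteristic S)"

definition seifert_genus :: "(R4 \<times> R4) set \<Rightarrow> real" where
  "seifert_genus L = (LEAST x. \<exists>S. seifert_surface S L \<and> x = surface_genus S)"


section \<open>Thompson's group and standard dyadic partitions\<close>

definition dyadic :: "real \<Rightarrow> bool" where
  "dyadic x \<longleftrightarrow> (\<exists>(k::int) (m::nat). x = of_int k / 2 ^ m)"

definition thompson_F :: "(real \<Rightarrow> real) set" where
  "thompson_F = {g \<in> extensional {0..1}.
     (\<exists>h. homeomorphism {0..1} {0..1} g h) \<and> strict_mono_on {0..1} g \<and>
     (\<exists>ds. ds \<noteq> [] \<and> hd ds = 0 \<and> last ds = 1 \<and> sorted_wrt (<) ds \<and> (\<forall>d\<in>set ds. dyadic d) \<and>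
        (\<forall>i. Suc i < length ds \<longrightarrow>
           (\<exists>k::int. \<forall>x\<in>{ds ! i..ds ! Suc i}. g x = g (ds ! i) + 2 powi k * (x - ds ! i))))}"

definition sd_interval :: "real \<Rightarrow> real \<Rightarrow> bool" where
  "sd_interval a b \<longleftrightarrow> (\<exists>k m :: nat. k < 2 ^ m \<and> a = real k / 2 ^ m \<and> b = real (k + 1) / 2 ^ m)"

text \<open>A partition is the list \<open>[a\<^sub>0, \<dots>, a\<^sub>n]\<close> of its breakpoints.\<close>

definition sd_partition :: "real list \<Rightarrow> bool" where
  "sd_partition I \<longleftrightarrow> I \<noteq> [] \<and> hd I = 0 \<and> last I = 1 \<and> sorted_wrt (<) I \<and>
     (\<forall>i. Suc i < length I \<longrightarrow> sd_interval (I ! i) (I ! Suc i))"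

definition leaves :: "real list \<Rightarrow> nat" where
  "leaves I = length I - 1"

definition represents :: "real list \<Rightarrow> real list \<Rightarrow> (real \<Rightarrow> real) \<Rightarrow> bool" where
  "represents I J g \<longleftrightarrow> sd_partition I \<and> sd_partition J \<and> leaves I = leaves J \<and>
     (\<forall>i < leaves I. \<forall>x\<in>{I ! i..I ! Suc i}.
        g x = J ! i + (x - I ! i) * (J ! Suc i - J ! i) / (I ! Suc i - I ! i))"

definition reduced :: "real list \<Rightarrow> real list \<Rightarrow> bool" where
  "reduced I J \<longleftrightarrow> \<not> (\<exists>i. 1 \<le> i \<and> i + 1 \<le> leaves I \<and>
     sd_interval (I ! (i - 1)) (I ! (i + 1)) \<and> sd_interval (J ! (i - 1)) (J ! (i + 1)))"

definition reduced_pair :: "(real \<Rightarrow> real) \<Rightarrow> real list \<times> real list" where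
  "reduced_pair g = (THE (I, J). represents I J g \<and> reduced I J)"

definition leaf_number :: "(real \<Rightarrow> real) \<Rightarrow> nat" where
  "leaf_number g = leaves (fst (reduced_pair g))"


section \<open>Signed trees and the oriented Thompson group\<close>

text \<open>The edge \<open>[a\<^sub>i, a\<^sub>j]\<close> of the tree is represented by the pair of indices \<open>(i, j)\<close>.\<close>

definition tree_edges :: "real list \<Rightarrow> (nat \<times> nat) set" where
  "tree_edges I = {(i, j). i < j \<and> j < length I \<and> sd_interval (I ! i) (I ! j)}"

definition splits :: "real list \<Rightarrow> nat \<Rightarrow> nat \<Rightarrow> nat \<Rightarrow> bool" where
  "splits I i k j \<longleftrightarrow> (i, j) \<in> tree_edges I \<and> i < k \<and> k < j \<and> I ! k = (I ! i + I ! j) / 2"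

text \<open>The sign \<open>+\<close> is \<^const>\<open>True\<close>.\<close>

inductive edge_sign :: "real list \<Rightarrow> nat \<Rightarrow> nat \<Rightarrow> bool \<Rightarrow> bool" for I where
  root: "edge_sign I 0 (leaves I) True"
| left: "edge_sign I i j s \<Longrightarrow> splits I i k j \<Longrightarrow> edge_sign I i k s"
| right: "edge_sign I i j s \<Longrightarrow> splits I i k j \<Longrightarrow> edge_sign I k j (\<not> s)"

definition compatible :: "real list \<Rightarrow> real list \<Rightarrow> bool" where
  "compatible I J \<longleftrightarrow> leaves I = leaves J \<and>
     (\<forall>i < leaves I. \<forall>s. edge_sign I i (Suc i) s \<longleftrightarrow> edge_sign J i (Suc i) s)"

definition oriented_thompson :: "(real \<Rightarrow> real) set" where
  "oriented_thompson = {g \<in> thompson_F. \<exists>I J. represents I J g \<and> compatible I J}"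


section \<open>The link of an element of the oriented Thompson group\<close>

text \<open>
  The tangles are drawn in the \<open>xy\<close>-plane and the \<open>z\<close>-axis points to the viewer. On the line
  \<open>y = 0\<close> the left strand ends at \<open>x = 0\<close>, the vertical strand below the vertex which splits its
  interval at \<open>a\<^sub>k\<close> ends at \<open>x = 2 k\<close>, and the leaf \<open>[a\<^sub>i, a\<^sub>i\<^sub>+\<^sub>1]\<close> ends at \<open>x = 2 i + 1\<close>.
  The vertex at the bottom of the edge \<open>[a\<^sub>i, a\<^sub>j]\<close> is drawn at height \<open>j - i\<close>; there the
  under-strand passes at \<open>z = 0\<close> and the over-strand, running from the left to the right edge,
  at \<open>z = 1\<close>. All edges are straight, and two of them cross in the projection only at vertices.
\<close>

type_synonym R3 = "real \<times> real \<times> real"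

definition lower_end :: "real list \<Rightarrow> nat \<Rightarrow> nat \<Rightarrow> R3" where
  "lower_end I i j =
     (if j = Suc i then (2 * real i + 1, 0, 0) else (2 * real (THE k. splits I i k j), real (j - i), 0))"

definition over_point :: "nat \<Rightarrow> nat \<Rightarrow> nat \<Rightarrow> R3" where
  "over_point i k j = (2 * real k, real (j - i), 1)"

text \<open>The first point is the lower end; arcs of sign \<open>+\<close> are directed upward.\<close>

definition arc_of_sign :: "bool \<Rightarrow> R3 \<Rightarrow> R3 \<Rightarrow> R3 \<times> R3" where
  "arc_of_sign s p q = (if s then (p, q) else (q, p))"

definition tangle :: "real list \<Rightarrow> (R3 \<times> R3) set" where
  "tangle I =
     {arc_of_sign s (lower_end I i k) (over_point i k j) | i k j s. splits I i k j \<and> edge_sign I i k s} \<union>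
     {arc_of_sign s (lower_end I k j) (over_point i k j) | i k j s. splits I i k j \<and> edge_sign I k j s} \<union>
     {arc_of_sign s (2 * real k, 0, 0) (lower_end I i j) | i k j s. splits I i k j \<and> edge_sign I i j s}"

definition closed_tangle :: "real list \<Rightarrow> (R3 \<times> R3) set" where
  "closed_tangle I =
     (let root = lower_end I 0 (leaves I);
          top = (fst root, real (leaves I) + 1, 0);
          corner = (0, real (leaves I) + 1, 0)
      in tangle I \<union> {(root, top), (top, corner), (corner, (0, 0, 0))})"

fun reflect :: "R3 \<Rightarrow> R3" where
  "reflect (x, y, z) = (x, - y, z)"

fun to_R4 :: "R3 \<Rightarrow> R4" where
  "to_R4 (x, y, z) = (x, y, z, 1)"

definition link_of_pair :: "real list \<Rightarrow> real list \<Rightarrow> (R4 \<times> R4) set" where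
  "link_of_pair I J = map_prod to_R4 to_R4 `
     (closed_tangle I \<union> {(reflect q, reflect p) | p q. (p, q) \<in> closed_tangle J})"

definition thompson_link :: "(real \<Rightarrow> real) \<Rightarrow> (R4 \<times> R4) set" where
  "thompson_link g = (case reduced_pair g of (I, J) \<Rightarrow> link_of_pair I J)"

text \<open>
  The infimum in \<^typ>\<open>enat\<close> is the minimum whenever the set is nonempty, which by Aiello's theorem
  is the case for every oriented link.
\<close>

definition oriented_thompson_index :: "(R4 \<times> R4) set \<Rightarrow> enat" where
  "oriented_thompson_index L =
     Inf {enat (leaf_number g) | g. g \<in> oriented_thompson \<and> isotopic (thompson_link g) L}"

end

theory Submission
  imports Defs
begin

text \<open>
  The checkerboard surface of the diagram of a compatible pair with \<open>n\<close> leaves is a union of \<open>n\<close> discs,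
  one for each vertical strand, meeting at the \<open>2 (n - 1)\<close> crossings. Each crossing is drawn as
  a segment in the direction of the \<open>z\<close>-axis which is shared by the two discs meeting there, so
  \<open>\<chi> = n - 2 (n - 1) = 2 - n\<close>. Orient each disc by the sign of its leaf: the leaf starting at the split
  point of an edge has the sign opposite to that edge, and discs glued along a segment thus get opposite
  signs, which makes the surface coherently oriented with the link as its boundary. Removing a caret
  from both trees does not change the signs of the remaining leaves, so the reduced pair of an
  element of the oriented Thompson group is again compatible. Maximal Euler characteristics exist since
  a connected surface has Euler characteristic at most 2.
\<close>

text \<open>Disc i lies between strand i and the chain of tree edges whose left end is breakpoint i,
  continued by the mirrored chain of the other tree. A left edge inherits the sign of its parent, so
  a whole chain has the sign of its leaf; hence one orientation per disc suffices, and compatibility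
  makes the two chains of a disc agree. All crossings are at integer heights, so cutting the discs
  there gives a triangulation with every vertex on the boundary. Exact cell counts are avoided: on a
  coherently oriented surface 2 \<chi> is at least the number of boundary edges minus the number of
  triangles, and almost every triangle here owns a boundary edge. Embeddedness is the geometric
  obstacle; it is reduced to comparing coordinates of vertices by linear forms that weakly separate
  two triangles. The upper bound on \<chi> matters because \<open>GREATEST\<close> and
  \<open>LEAST\<close> have their intended meaning only for attained extrema. It comes from a
  tree-cotree argument: a spanning tree of triangles and a complementary connected graph of
  edges.\<close>

section \<open>Euler characteristics of oriented triangulated surfaces\<close>

text \<open>Connectedness enters as the cut condition: an edge leaves every proper nonempty vertex
  set. A tree is grown greedily; each new edge has an endpoint outside the set reached so far, so it
  differs from all edges used before.\<close>

lemma card_le_Suc_edges_if_connected: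
  assumes fin: "finite V" "finite E" and ne: "V \<noteq> {}"
    and cut: "\<And>W. W \<subseteq> V \<Longrightarrow> W \<noteq> {} \<Longrightarrow> W \<noteq> V \<Longrightarrow> \<exists>x\<in>W. \<exists>y\<in>V - W. {x, y} \<in> E"
  shows "card V \<le> card E + 1"
proof -
  have "\<exists>W U. W \<subseteq> V \<and> U \<subseteq> E \<and> \<Union>U \<subseteq> W \<and> card W = m + 1 \<and> card U = m" if "m < card V" for m
    using that
  proof (induction m)
    case 0
    from ne obtain v where "v \<in> V" by auto
    then show ?case by (intro exI[of _ "{v}"] exI[of _ "{}"]) auto
  next
    case (Suc m)
    then obtain W U where WU: "W \<subseteq> V" "U \<subseteq> E" "\<Union>U \<subseteq> W" "card W = m + 1" "card U = m" by auto
    have "W \<noteq> {}" "W \<noteq> V" using WU Suc.prems by auto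
    then obtain x y where xy: "x \<in> W" "y \<in> V - W" "{x, y} \<in> E" using cut[OF WU(1)] by blast
    have "{x, y} \<notin> U" using xy WU by auto
    moreover have "finite W" "finite U" using finite_subset[OF WU(1) fin(1)] finite_subset[OF WU(2) fin(2)] by auto
    ultimately have "card (insert y W) = Suc m + 1" "card (insert {x, y} U) = Suc m"
      using WU xy by auto
    then show ?case using WU xy
      by (intro exI[of _ "insert y W"] exI[of _ "insert {x, y} U"]) auto
  qed
  from this[of "card V - 1"] obtain U where U: "U \<subseteq> E" "card U = card V - 1"
    using ne fin by (metis card_gt_0_iff diff_less zero_less_one)
  show ?thesis using card_mono[OF fin(2) U(1)] U(2) by linarith
qed

section \<open>Cell counts for coherently oriented triangulated surfaces, without reference to the
  sphere\<close>

locale oriented_triangulated_surface =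
  fixes S :: "('a::euclidean_space \<times> 'a \<times> 'a) set"
  assumes nonempty: "S \<noteq> {}"
    and vertices_distinct: "(a, b, c) \<in> S \<Longrightarrow> a \<noteq> b \<and> b \<noteq> c \<and> a \<noteq> c"
    and triangle_independent: "(a, b, c) \<in> S \<Longrightarrow> \<not> affine_dependent {a, b, c}"
    and triangulation: "triangulation ((\<lambda>(a, b, c). convex hull {a, b, c}) ` S)"
    and rotate: "(a, b, c) \<in> S \<Longrightarrow> (b, c, a) \<in> S"
    and not_swap: "(a, b, c) \<in> S \<Longrightarrow> (b, a, c) \<notin> S"
    and apex_unique: "(a, b, c) \<in> S \<Longrightarrow> (a, b, d) \<in> S \<Longrightarrow> c = d"
    and vertex_link_connected: "(v, b, c) \<in> S \<Longrightarrow> (v, b', c') \<in> S \<Longrightarrow>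
      (b, b') \<in> ({(x, y). (v, x, y) \<in> S} \<union> {(y, x). (v, x, y) \<in> S})\<^sup>*"
begin

definition vertices :: "'a set" where
  "vertices = {a. \<exists>b c. (a, b, c) \<in> S}"

definition edges :: "'a set set" where
  "edges = {{a, b} | a b. \<exists>c. (a, b, c) \<in> S}"

definition triangles :: "'a set set" where
  "triangles = {{a, b, c} | a b c. (a, b, c) \<in> S}"

definition boundary :: "('a \<times> 'a) set" where
  "boundary = {(a, b). (\<exists>c. (a, b, c) \<in> S) \<and> \<not> (\<exists>c. (b, a, c) \<in> S)}"

definition euler :: int where
  "euler = int (card vertices) - int (card edges) + int (card triangles)"

lemma hulls_eq: "(\<lambda>(a, b, c). convex hull {a, b, c}) ` S = (hull) convex ` triangles"
  unfolding triangles_def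
proof (intro subset_antisym subsetI)
  fix T assume "T \<in> (hull) convex ` {{a, b, c} |a b c. (a, b, c) \<in> S}"
  then obtain a b c where "(a, b, c) \<in> S" "T = convex hull {a, b, c}" by auto
  then show "T \<in> (\<lambda>(a, b, c). convex hull {a, b, c}) ` S" by (intro image_eqI[of _ _ "(a, b, c)"]) auto
qed auto

text \<open>\<open>triangulation\<close> bounds only the set of hulls. The ordered triples are
  recovered from it because the vertices of an independent triangle are the extreme points of its
  hull.\<close>

lemma finite_surface: "finite S"
proof -
  let ?h = "\<lambda>(a, b, c). convex hull {a, b, c :: 'a}"
  let ?x = "\<lambda>T. {x. x extreme_point_of T}"
  have fin: "finite (?h ` S)" using triangulation unfolding triangulation_def by blast
  have ext: "?x (?h (a, b, c)) = {a, b, c}" if "(a, b, c) \<in> S" for a b c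
    using extreme_point_of_convex_hull_affine_independent[OF triangle_independent[OF that]] by auto
  have "S \<subseteq> (\<Union>T\<in>?h ` S. ?x T \<times> ?x T \<times> ?x T)"
  proof
    fix p assume p: "p \<in> S"
    obtain a b c where abc: "p = (a, b, c)" by (metis prod_cases3)
    have "p \<in> ?x (?h p) \<times> ?x (?h p) \<times> ?x (?h p)"
      using ext[of a b c] p abc by simp
    then show "p \<in> (\<Union>T\<in>?h ` S. ?x T \<times> ?x T \<times> ?x T)" using p by blast
  qed
  moreover have "finite (?x T)" if "T \<in> ?h ` S" for T
  proof -
    from that obtain a b c where "(a, b, c) \<in> S" "T = ?h (a, b, c)" by auto
    then show ?thesis using ext by fastforce
  qed
  ultimately show ?thesis using fin by (meson finite_SigmaI finite_UN_I finite_subset)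
qed

lemma finite_parts: "finite vertices" "finite edges" "finite triangles"
proof -
  have "vertices = fst ` S" unfolding vertices_def by force
  then show "finite vertices" using finite_surface by simp
  have "edges = (\<lambda>(a, b, c). {a, b}) ` S" unfolding edges_def by force
  then show "finite edges" using finite_surface by simp
  have "triangles = (\<lambda>(a, b, c). {a, b, c}) ` S" unfolding triangles_def by force
  then show "finite triangles" using finite_surface by simp
qed

lemma triangles_independent: "t \<in> triangles \<Longrightarrow> \<not> affine_dependent t"
  by (auto simp: triangles_def dest: triangle_independent)

lemma triangle_vertexE:
  assumes "t \<in> triangles" "v \<in> t"
  obtains b c where "(v, b, c) \<in> S" "t = {v, b, c}"
proof -
  from assms obtain x y z where xyz: "(x, y, z) \<in> S" "t = {x, y, z}" unfolding triangles_def by auto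
  have "(y, z, x) \<in> S" "(z, x, y) \<in> S" using xyz rotate by blast+
  moreover from assms(2) xyz have "v = x \<or> v = y \<or> v = z" by simp
  moreover have "t = {y, z, x}" "t = {z, x, y}" using xyz by blast+
  ultimately show ?thesis using that xyz by metis
qed

lemma triangle_edgeE:
  assumes "t \<in> triangles" "a \<in> t" "b \<in> t" "a \<noteq> b"
  obtains c where "t = {a, b, c}" "(a, b, c) \<in> S \<or> (b, a, c) \<in> S"
proof -
  from assms obtain x y where xy: "(a, x, y) \<in> S" "t = {a, x, y}" using triangle_vertexE by metis
  with assms have "b = x \<or> b = y" by auto
  then show ?thesis
  proof
    assume "b = x" then show ?thesis using xy that by blast
  next
    assume "b = y"
    moreover from this have "(b, a, x) \<in> S" using xy rotate by blast
    moreover have "t = {a, b, x}" using xy \<open>b = y\<close> by blast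
    ultimately show ?thesis using that by blast
  qed
qed

text \<open>Pigeonhole: each of the three triangles induces one of the two directions on the edge,
  and each direction determines its apex.\<close>

lemma at_most_two_triangles:
  assumes "t0 \<in> triangles" "t1 \<in> triangles" "t2 \<in> triangles" "a \<noteq> b"
    "{a, b} \<subseteq> t0" "{a, b} \<subseteq> t1" "{a, b} \<subseteq> t2" "t0 \<noteq> t1"
  shows "t2 = t0 \<or> t2 = t1"
proof -
  obtain c0 where c0: "t0 = {a, b, c0}" "(a, b, c0) \<in> S \<or> (b, a, c0) \<in> S"
    using assms(5) triangle_edgeE[OF assms(1) _ _ assms(4)] by auto
  obtain c1 where c1: "t1 = {a, b, c1}" "(a, b, c1) \<in> S \<or> (b, a, c1) \<in> S"
    using assms(6) triangle_edgeE[OF assms(2) _ _ assms(4)] by auto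
  obtain c2 where c2: "t2 = {a, b, c2}" "(a, b, c2) \<in> S \<or> (b, a, c2) \<in> S"
    using assms(7) triangle_edgeE[OF assms(3) _ _ assms(4)] by auto
  have "c0 \<noteq> c1" using c0 c1 assms(8) by blast
  then have "c2 = c0 \<or> c2 = c1" using c0(2) c1(2) c2(2) by (meson apex_unique)
  then show ?thesis using c0 c1 c2 by auto
qed

text \<open>Two hulls meet in a common face, and a face of a simplex is spanned by some of its
  vertices. The extreme points of a nonempty intersection would therefore be vertices of both
  triangles.\<close>

lemma disjoint_triangles_disjoint_hulls:
  assumes "t \<in> triangles" "t' \<in> triangles" "t \<inter> t' = {}"
  shows "convex hull t \<inter> convex hull t' = {}"
proof (rule ccontr)
  let ?F = "convex hull t \<inter> convex hull t'"
  assume ne: "?F \<noteq> {}"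
  have tr: "triangulation ((hull) convex ` triangles)" using triangulation hulls_eq by simp
  have "?F face_of convex hull t" "?F face_of convex hull t'"
    using tr assms unfolding triangulation_def by (blast, metis (no_types, lifting) Int_commute imageI)
  then obtain c c' where c: "c \<subseteq> t" "?F = convex hull c" and c': "c' \<subseteq> t'" "?F = convex hull c'"
    using face_of_convex_hull_affine_independent triangles_independent assms by metis
  obtain x where x: "x \<in> c" using c ne by auto
  have "\<not> affine_dependent c" "\<not> affine_dependent c'"
    using c(1) c'(1) triangles_independent assms affine_independent_subset by metis+
  then have "x \<in> c'"
    using x c(2) c'(2) extreme_point_of_convex_hull_affine_independent by metis
  then show False using x c c' assms(3) by blast
qed

context
  assumes connected: "connected (\<Union>((hull) convex ` triangles))"
begin

text \<open>Combinatorial form of connectedness: the union of the hulls in \<open>X\<close> and the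
  union of the other hulls are closed and disjoint, so one of them is empty.\<close>

lemma no_vertex_disjoint_splitting:
  assumes X: "X \<subseteq> triangles" "X \<noteq> {}" and disj: "\<And>t t'. t \<in> X \<Longrightarrow> t' \<in> triangles - X \<Longrightarrow> t \<inter> t' = {}"
  shows "X = triangles"
proof -
  let ?A = "\<Union>((hull) convex ` X)" and ?B = "\<Union>((hull) convex ` (triangles - X))"
    and ?S = "\<Union>((hull) convex ` triangles)"
  have fint: "finite t" if "t \<in> triangles" for t using that unfolding triangles_def by auto
  have "closed ?A" "closed ?B"
    using X finite_parts(3) fint
    by (auto intro!: closed_UN intro: compact_imp_closed finite_imp_compact_convex_hull finite_subset
        simp del: Union_iff)
  moreover have "?S \<subseteq> ?A \<union> ?B" by auto
  moreover have "?A \<inter> ?B = {}"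
    using disjoint_triangles_disjoint_hulls disj X by fast
  ultimately have "?A \<inter> ?S = {} \<or> ?B \<inter> ?S = {}"
    using connected_closedD[OF connected, of ?A ?B] by blast
  moreover have "?A \<subseteq> ?S" "?B \<subseteq> ?S" using X by auto
  ultimately have "?A = {} \<or> ?B = {}" by blast
  moreover have "t \<noteq> {}" if "t \<in> triangles" for t using that unfolding triangles_def by auto
  ultimately show ?thesis using X by auto
qed

text \<open>Connected vertex links exclude pinch points: two triangles with a common vertex v are
  joined by a path in the link of v, and consecutive triangles along this path share an edge at
  v.\<close>

lemma dual_graph_connected:
  assumes X: "X \<subseteq> triangles" "X \<noteq> {}" "X \<noteq> triangles"
  shows "\<exists>t\<in>X. \<exists>t'\<in>triangles - X. \<exists>a b. a \<noteq> b \<and> {a, b} \<subseteq> t \<and> {a, b} \<subseteq> t'"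
proof (rule ccontr)
  assume contr: "\<not> ?thesis"
  have no: "t' \<in> X" if "t \<in> X" "t' \<in> triangles" "a \<noteq> b" "{a, b} \<subseteq> t" "{a, b} \<subseteq> t'" for t t' a b
    using that contr by blast
  have "t \<inter> t' = {}" if t: "t \<in> X" "t' \<in> triangles - X" for t t'
  proof (rule ccontr)
    assume "t \<inter> t' \<noteq> {}"
    then obtain v where v: "v \<in> t" "v \<in> t'" by auto
    obtain b c where bc: "(v, b, c) \<in> S" "t = {v, b, c}" using v t X triangle_vertexE by blast
    obtain b' c' where bc': "(v, b', c') \<in> S" "t' = {v, b', c'}" using v t X triangle_vertexE by blast
    \<comment> \<open>Invariant along the link path: every triangle containing the edge from v to
      the current link vertex belongs to \<open>X\<close>.\<close>
    have "\<forall>t\<in>triangles. {v, b'} \<subseteq> t \<and> v \<noteq> b' \<longrightarrow> t \<in> X"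
      using vertex_link_connected[OF bc(1) bc'(1)]
    proof (induction rule: rtrancl_induct)
      case base
      then show ?case using no[OF t(1)] bc by auto
    next
      case (step y z)
      then have yz: "(v, y, z) \<in> S \<or> (v, z, y) \<in> S" by auto
      then have "{v, y, z} \<in> triangles" "v \<noteq> y"
        using vertices_distinct unfolding triangles_def by (auto simp: insert_commute)
      then have "{v, y, z} \<in> X" using step.IH by auto
      then show ?case using no[of "{v, y, z}" _ v z] by auto
    qed
    then show False using bc' t vertices_distinct by auto
  qed
  then show False using no_vertex_disjoint_splitting X by metis
qed

text \<open>A vertex set that no edge leaves contains every triangle it meets, so the triangles
  inside it touch no other triangle.\<close>

lemma edge_graph_connected:
  assumes W: "W \<subseteq> vertices" "W \<noteq> {}" "W \<noteq> vertices"
  shows "\<exists>x\<in>W. \<exists>y\<in>vertices - W. {x, y} \<in> edges"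
proof (rule ccontr)
  assume contr: "\<not> ?thesis"
  have cl: "y \<in> W" if "x \<in> W" "t \<in> triangles" "{x, y} \<subseteq> t" for x y t
  proof (cases "x = y")
    case False
    then obtain c where c: "(x, y, c) \<in> S \<or> (y, x, c) \<in> S"
      using \<open>t \<in> triangles\<close> \<open>{x, y} \<subseteq> t\<close> False by (elim triangle_edgeE[of t x y]) auto
    then have "{x, y} \<in> edges" unfolding edges_def by (auto simp: insert_commute)
    moreover have "y \<in> vertices" using c rotate[of x y c] unfolding vertices_def by blast
    ultimately show ?thesis using contr \<open>x \<in> W\<close> by blast
  qed (use that in auto)
  let ?X = "{t \<in> triangles. t \<subseteq> W}"
  have tri: "\<exists>t\<in>triangles. v \<in> t" if "v \<in> vertices" for v
    using that unfolding vertices_def triangles_def by blast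
  have sub: "t \<subseteq> W" if "t \<in> triangles" "w \<in> t" "w \<in> W" for t w
    using cl[OF \<open>w \<in> W\<close> \<open>t \<in> triangles\<close>] that by auto
  obtain w t where "w \<in> W" "t \<in> triangles" "w \<in> t" using W(1,2) tri by (meson ex_in_conv subsetD)
  then have "?X \<noteq> {}" using sub by auto
  moreover have "t \<inter> t' = {}" if "t \<in> ?X" "t' \<in> triangles - ?X" for t t'
    using that sub[of t'] by auto
  ultimately have "?X = triangles" using no_vertex_disjoint_splitting[of ?X] by auto
  then have "vertices \<subseteq> W" using tri by blast
  then show False using W by auto
qed

text \<open>
  The edges dual to a spanning tree of the dual graph can be deleted from the edge graph
  one by one without disconnecting it, since each deleted edge is bypassed by the other two edges
  of the triangle just added.
\<close>

lemma euler_characteristic_le_2: "euler \<le> 2"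
proof -
  define cut where "cut E \<longleftrightarrow> (\<forall>W. W \<subseteq> vertices \<longrightarrow> W \<noteq> {} \<longrightarrow> W \<noteq> vertices \<longrightarrow>
    (\<exists>x\<in>W. \<exists>y\<in>vertices - W. {x, y} \<in> E))" for E
  \<comment> \<open>All triangles at a deleted edge have already been reached. Hence a new triangle
    still has its three edges, and two of them can serve as the detour.\<close>
  define closed where "closed X R \<longleftrightarrow> (\<forall>e\<in>R. \<forall>t\<in>triangles. e \<subseteq> t \<longrightarrow> t \<in> X)" for X R :: "'a set set"
  let ?Q = "\<lambda>X R. X \<subseteq> triangles \<and> X \<noteq> {} \<and> R \<subseteq> edges \<and> card X = card R + 1 \<and> cut (edges - R) \<and> closed X R"
  have grow: "\<exists>X R. ?Q X R \<and> card X = Suc m" if "m < card triangles" for m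
    using that
  proof (induction m)
    case 0
    from nonempty obtain t where "t \<in> triangles" unfolding triangles_def by auto
    then show ?case using edge_graph_connected
      by (intro exI[of _ "{t}"] exI[of _ "{}"]) (auto simp: cut_def closed_def)
  next
    case (Suc m)
    then have "\<exists>X R. ?Q X R \<and> card X = Suc m" by simp
    then obtain X R where Q: "?Q X R \<and> card X = Suc m" by (elim exE)
    then have X: "X \<subseteq> triangles" "X \<noteq> {}" "R \<subseteq> edges" "card X = card R + 1"
      and cut: "cut (edges - R)" and RX: "closed X R" and card: "card X = Suc m"
      by simp_all
    then have "X \<noteq> triangles" using Suc.prems by auto
    with dual_graph_connected[OF X(1,2)] obtain t t' a b
      where t: "t \<in> X" "t' \<in> triangles - X" "a \<noteq> b" "{a, b} \<subseteq> t" "{a, b} \<subseteq> t'"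
      by blast
    obtain c where c: "t' = {a, b, c}" "(a, b, c) \<in> S \<or> (b, a, c) \<in> S"
      using triangle_edgeE[of t' a b] t(2,3,5) by auto
    then obtain p q where pq: "(p, q, c) \<in> S" "{p, q} = {a, b}" by auto
    then have r: "(q, c, p) \<in> S" "(c, p, q) \<in> S" by (meson rotate)+
    have "{p, q} \<in> edges" "{q, c} \<in> edges" "{c, p} \<in> edges"
      using r pq unfolding edges_def by blast+
    then have E: "{a, b} \<in> edges" "{a, c} \<in> edges" "{b, c} \<in> edges"
      using pq by (auto simp: doubleton_eq_iff insert_commute)
    have ne: "c \<noteq> a" "c \<noteq> b"
      using vertices_distinct[OF pq(1)] pq(2) by (auto simp: doubleton_eq_iff)
    have "p \<in> vertices" "q \<in> vertices" "c \<in> vertices"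
      using r pq unfolding vertices_def by blast+
    then have cV: "a \<in> vertices" "b \<in> vertices" "c \<in> vertices" using pq by (auto simp: doubleton_eq_iff)
    have nR: "e \<notin> R" if "e \<subseteq> t'" for e
      using RX t(2) that unfolding closed_def by blast
    then have nR: "{a, b} \<notin> R" "{a, c} \<notin> R" "{b, c} \<notin> R" using c(1) by auto
    have cut': "cut (edges - insert {a, b} R)"
      unfolding cut_def
    proof (intro allI impI)
      fix W assume W: "W \<subseteq> vertices" "W \<noteq> {}" "W \<noteq> vertices"
      then obtain x y where xy: "x \<in> W" "y \<in> vertices - W" "{x, y} \<in> edges - R"
        using cut unfolding cut_def by meson
      show "\<exists>x\<in>W. \<exists>y\<in>vertices - W. {x, y} \<in> edges - insert {a, b} R"
      proof (cases "{x, y} = {a, b}")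
        case False
        then show ?thesis using xy by blast
      next
        case True
        have ac: "{a, c} \<in> edges - insert {a, b} R" "{b, c} \<in> edges - insert {a, b} R"
          using E nR ne t(3) by (auto simp: doubleton_eq_iff)
        then have ca: "{c, a} \<in> edges - insert {a, b} R" "{c, b} \<in> edges - insert {a, b} R"
          by (simp_all add: insert_commute)
        have "(a \<in> W \<and> b \<notin> W) \<or> (b \<in> W \<and> a \<notin> W)" using True xy by (auto simp: doubleton_eq_iff)
        then show ?thesis
        proof
          assume "a \<in> W \<and> b \<notin> W"
          then show ?thesis using ac(1) ca(2) cV by (cases "c \<in> W") blast+
        next
          assume "b \<in> W \<and> a \<notin> W"
          then show ?thesis using ac(2) ca(1) cV by (cases "c \<in> W") blast+
        qed
      qed
    qed
    have "s \<in> insert t' X" if "e \<in> insert {a, b} R" "s \<in> triangles" "e \<subseteq> s" for e s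
    proof (cases "e = {a, b}")
      case True
      \<comment> \<open>The deleted edge lies in no third triangle, so the invariant
        \<open>closed\<close> survives.\<close>
      then have "s = t \<or> s = t'"
        using at_most_two_triangles[of t t' s a b] t X(1) that by auto
      then show ?thesis using t by auto
    qed (use RX that in \<open>auto simp: closed_def\<close>)
    then have "closed (insert t' X) (insert {a, b} R)" unfolding closed_def by blast
    moreover have "finite X" "finite R"
      using finite_subset[OF X(1)] finite_subset[OF X(3)] finite_parts by auto
    then have "card (insert t' X) = Suc (Suc m)" "card (insert {a, b} R) = Suc m"
      using t nR X card by auto
    moreover have "insert t' X \<subseteq> triangles" "insert {a, b} R \<subseteq> edges" using X t E by auto
    ultimately show ?case using cut'
      by (intro exI[of _ "insert t' X"] exI[of _ "insert {a, b} R"]) auto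
  qed
  have pos: "0 < card triangles"
    using finite_parts(3) nonempty unfolding triangles_def card_gt_0_iff by fastforce
  then have "\<exists>X R. ?Q X R \<and> card X = Suc (card triangles - 1)" by (intro grow) simp
  then obtain X R where "?Q X R \<and> card X = Suc (card triangles - 1)" by (elim exE)
  then have Q: "R \<subseteq> edges" "card X = card R + 1" "cut (edges - R)" "card X = card triangles"
    using pos by auto
  have fR: "finite R" using finite_subset[OF Q(1)] finite_parts by auto
  have "vertices \<noteq> {}" using nonempty unfolding vertices_def by auto
  \<comment> \<open>The deleted edges number \<open>card triangles - 1\<close>, and the others still
    connect all vertices: V \<le> E - (F - 1) + 1.\<close>
  then have "card vertices \<le> card (edges - R) + 1"
    using Q(3) finite_parts unfolding cut_def by (intro card_le_Suc_edges_if_connected) auto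
  also have "card (edges - R) = card edges - card R" using Q(1) fR by (simp add: card_Diff_subset)
  finally have "card vertices \<le> card edges - card R + 1" .
  moreover have "card R \<le> card edges" using card_mono[OF _ Q(1)] finite_parts by auto
  ultimately show ?thesis using Q unfolding euler_def by linarith
qed

end

lemma finite_boundary: "finite boundary"
proof (rule finite_subset)
  show "boundary \<subseteq> (\<lambda>(a, b, c). (a, b)) ` S" unfolding boundary_def by force
qed (simp add: finite_surface)

text \<open>
  The link of a vertex is a connected graph with in- and outdegrees at most one, so it has at most
  one source.
\<close>

lemma boundary_start_unique:
  assumes "(v, x) \<in> boundary" "(v, x') \<in> boundary"
  shows "x = x'"
proof (rule ccontr)
  assume neq: "x \<noteq> x'"
  let ?N = "{(p, q). (v, p, q) \<in> S}"
  from assms obtain c c' where c: "(v, x, c) \<in> S" "(v, x', c') \<in> S"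
    and src: "\<And>p. (p, x) \<notin> ?N" "\<And>p. (p, x') \<notin> ?N"
    unfolding boundary_def using rotate by blast
  have sv: "z = w" if "(z, y) \<in> ?N" "(w, y) \<in> ?N" for z w y
  proof -
    have "(y, v, z) \<in> S" "(y, v, w) \<in> S" using that rotate by blast+
    then show ?thesis using apex_unique by blast
  qed
  have "(x, x') \<in> ?N\<^sup>*"
    using vertex_link_connected[OF c]
  proof (induction rule: rtrancl_induct)
    case (step y z)
    then have "(y, z) \<in> ?N \<or> (z, y) \<in> ?N" by auto
    then show ?case
    proof
      assume "(y, z) \<in> ?N" then show ?thesis using step.IH by (rule rtrancl_into_rtrancl[rotated])
    next
      \<comment> \<open>A backward step starts at some y other than the source x. The predecessor of
        y is unique, so the step merely retraces the directed path from x.\<close>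
      assume zy: "(z, y) \<in> ?N"
      then have "y \<noteq> x" using src by blast
      then obtain w where "(x, w) \<in> ?N\<^sup>*" "(w, y) \<in> ?N" using step.IH by (metis rtranclE)
      then show ?thesis using sv zy by metis
    qed
  qed auto
  then obtain w where "(w, x') \<in> ?N" using neq by (metis rtranclE)
  then show False using src by blast
qed

text \<open>Double counting of directed edges gives 2 E \<le> 3 F + B, and B \<le> V because
  boundary edges have distinct starting points. Then 2 (V - E + F) \<ge> 2 B - (3 F + B) + 2 F = B -
  F. The bound is sharp when all vertices lie on the boundary, as they do for the surfaces built
  below.\<close>

lemma euler_characteristic_ge:
  "int (card (boundary)) - int (card triangles) \<le> 2 * euler"
proof -
  let ?B = "boundary" and ?D = "(\<lambda>(a, b, c). (a, b)) ` S"
  have "card S \<le> card (\<Union>t\<in>triangles. {(x, y, z). (x, y, z) \<in> S \<and> {x, y, z} = t})"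
    by (rule card_mono)
       (auto intro: finite_subset[OF _ finite_surface] finite_parts simp: triangles_def)
  also have "\<dots> \<le> (\<Sum>t\<in>triangles. card {(x, y, z). (x, y, z) \<in> S \<and> {x, y, z} = t})"
    by (rule card_UN_le[OF finite_parts(3)])
  also have "\<dots> \<le> (\<Sum>t\<in>triangles. 3)"
  proof (rule sum_mono)
    fix t assume "t \<in> triangles"
    then obtain a b c where abc: "(a, b, c) \<in> S" "t = {a, b, c}" unfolding triangles_def by auto
    then have d: "a \<noteq> b" "b \<noteq> c" "a \<noteq> c" using vertices_distinct by blast+
    have "(b, c, a) \<in> S" "(c, a, b) \<in> S" using abc rotate by blast+
    then have n: "(b, a, c) \<notin> S" "(c, b, a) \<notin> S" "(a, c, b) \<notin> S" using abc not_swap by blast+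
    \<comment> \<open>At most three ordered triples per vertex set, since \<open>not_swap\<close>
      excludes the opposite cyclic order.\<close>
    have "{(x, y, z). (x, y, z) \<in> S \<and> {x, y, z} = t} \<subseteq> {(a, b, c), (b, c, a), (c, a, b)}"
    proof
      fix p assume "p \<in> {(x, y, z). (x, y, z) \<in> S \<and> {x, y, z} = t}"
      then obtain x y z where p: "p = (x, y, z)" and xyz: "(x, y, z) \<in> S" "{x, y, z} = t" by auto
      then have "x \<noteq> y" "y \<noteq> z" "x \<noteq> z" using vertices_distinct by blast+
      moreover have "x \<in> {a, b, c}" "y \<in> {a, b, c}" "z \<in> {a, b, c}" using xyz abc by blast+
      ultimately show "p \<in> {(a, b, c), (b, c, a), (c, a, b)}" using xyz(1) n p by auto
    qed
    then have "card {(x, y, z). (x, y, z) \<in> S \<and> {x, y, z} = t} \<le> card {(a, b, c), (b, c, a), (c, a, b)}"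
      by (rule card_mono[rotated]) simp
    also have "\<dots> \<le> 3" using card_length[of "[(a, b, c), (b, c, a), (c, a, b)]"] by simp
    finally show "card {(x, y, z). (x, y, z) \<in> S \<and> {x, y, z} = t} \<le> 3" .
  qed
  finally have i: "card S \<le> 3 * card triangles" by simp
  have ii: "card ?D \<le> card S" by (rule card_image_le[OF finite_surface])
  have two: "card {(x, y). {x, y} = e} = 2" if "e \<in> edges" for e
  proof -
      from that obtain a b where "e = {a, b}" "a \<noteq> b" unfolding edges_def using vertices_distinct by blast
      then have "{(x, y). {x, y} = e} = {(a, b), (b, a)}" by (auto simp: doubleton_eq_iff)
      then show ?thesis using \<open>a \<noteq> b\<close> by simp
  qed
  then have "2 * card edges = (\<Sum>e\<in>edges. card {(a, b). {a, b} = e})" by simp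
  also have "\<dots> = card (\<Union>e\<in>edges. {(a, b). {a, b} = e})"
  proof (rule card_UN_disjoint[symmetric])
    show "\<forall>e\<in>edges. finite {(a, b). {a, b} = e}"
    proof
      fix e assume "e \<in> edges"
      then show "finite {(a, b). {a, b} = e}" using two[of e] by (intro card_ge_0_finite) simp
    qed
  qed (auto simp: finite_parts)
  \<comment> \<open>Of the two directions of an edge, one occurs in a triangle; the other also
    occurs in a triangle or is a reversed boundary edge.\<close>
  also have "\<dots> \<le> card (?D \<union> ?B\<inverse>)"
  proof (rule card_mono)
    show "finite (?D \<union> ?B\<inverse>)" using finite_surface finite_boundary by simp
    show "(\<Union>e\<in>edges. {(a, b). {a, b} = e}) \<subseteq> ?D \<union> ?B\<inverse>"
    proof
      fix p assume "p \<in> (\<Union>e\<in>edges. {(a, b). {a, b} = e})"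
      then obtain a b c where abc: "p = (a, b) \<or> p = (b, a)" "(a, b, c) \<in> S"
        unfolding edges_def by (auto simp: doubleton_eq_iff)
      then have D: "(a, b) \<in> ?D" by force
      show "p \<in> ?D \<union> ?B\<inverse>"
      proof (cases "\<exists>d. (b, a, d) \<in> S")
        case True
        then have "(b, a) \<in> ?D" by force
        then show ?thesis using abc D by blast
      next
        case False
        then have "(a, b) \<in> ?B" using abc unfolding boundary_def by blast
        then show ?thesis using abc D by blast
      qed
    qed
  qed
  also have "\<dots> \<le> card ?D + card ?B"
    by (metis card_Un_le card_inverse)
  finally have iii: "2 * card edges \<le> card ?D + card ?B" .
  have iv: "card ?B \<le> card vertices"
  proof (rule card_inj_on_le[of fst])
    show "inj_on fst ?B" using boundary_start_unique by (auto simp: inj_on_def)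
    show "fst ` ?B \<subseteq> vertices" 
      unfolding boundary_def vertices_def by (force simp: image_iff)
  qed (rule finite_parts)
  have "2 * card edges \<le> 3 * card triangles + card ?B" using i ii iii by linarith
  then have "2 * int (card edges) \<le> 3 * int (card triangles) + int (card ?B)" by linarith
  moreover have "int (card ?B) \<le> int (card vertices)" using iv by simp
  ultimately show ?thesis unfolding euler_def by (simp add: algebra_simps)
qed

end

lemma oriented_surface_iff:
  "oriented_surface S \<longleftrightarrow> oriented_triangulated_surface S \<and> radial (surface_support S)"
proof
  assume o: "oriented_surface S"
  have *: "S \<noteq> {}" "\<forall>(a, b, c)\<in>S. a \<noteq> b \<and> b \<noteq> c \<and> a \<noteq> c \<and> \<not> affine_dependent {a, b, c}"
    "triangulation ((\<lambda>(a, b, c). convex hull {a, b, c}) ` S)"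
    "\<forall>(a, b, c)\<in>S. (b, c, a) \<in> S \<and> (b, a, c) \<notin> S"
    "\<forall>a b c d. (a, b, c) \<in> S \<and> (a, b, d) \<in> S \<longrightarrow> c = d"
    "\<forall>v b c b' c'. (v, b, c) \<in> S \<and> (v, b', c') \<in> S \<longrightarrow>
        (b, b') \<in> ({(x, y). (v, x, y) \<in> S} \<union> {(y, x). (v, x, y) \<in> S})\<^sup>*"
    "radial (surface_support S)"
    using o unfolding oriented_surface_def by - (elim conjE, assumption)+
  have "oriented_triangulated_surface S"
  proof
    show "a \<noteq> b \<and> b \<noteq> c \<and> a \<noteq> c" "\<not> affine_dependent {a, b, c}" if "(a, b, c) \<in> S" for a b c
      using *(2) that by blast+
    show "(b, c, a) \<in> S" "(b, a, c) \<notin> S" if "(a, b, c) \<in> S" for a b c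
      using *(4) that by blast+
    show "c = d" if "(a, b, c) \<in> S" "(a, b, d) \<in> S" for a b c d
      using *(5) that by blast
    show "(b, b') \<in> ({(x, y). (v, x, y) \<in> S} \<union> {(y, x). (v, x, y) \<in> S})\<^sup>*"
      if "(v, b, c) \<in> S" "(v, b', c') \<in> S" for v b c b' c'
      by (rule *(6)[rule_format]) (rule conjI[OF that])
  qed (simp_all only: *(1,3) not_False_eq_True)
  then show "oriented_triangulated_surface S \<and> radial (surface_support S)" using *(7) by simp
next
  assume a: "oriented_triangulated_surface S \<and> radial (surface_support S)"
  then interpret oriented_triangulated_surface S by simp
  show "oriented_surface S"
    unfolding oriented_surface_def
  proof (intro conjI)
    show "\<forall>(a, b, c)\<in>S. a \<noteq> b \<and> b \<noteq> c \<and> a \<noteq> c \<and> \<not> affine_dependent {a, b, c}"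
      using vertices_distinct triangle_independent by blast
    show "\<forall>(a, b, c)\<in>S. (b, c, a) \<in> S \<and> (b, a, c) \<notin> S" using rotate not_swap by blast
    show "\<forall>a b c d. (a, b, c) \<in> S \<and> (a, b, d) \<in> S \<longrightarrow> c = d"
      by (intro allI impI, elim conjE) (rule apex_unique)
    show "\<forall>v b c b' c'. (v, b, c) \<in> S \<and> (v, b', c') \<in> S \<longrightarrow>
        (b, b') \<in> ({(x, y). (v, x, y) \<in> S} \<union> {(y, x). (v, x, y) \<in> S})\<^sup>*"
      by (intro allI impI, elim conjE) (rule vertex_link_connected)
  qed (simp_all only: nonempty triangulation a not_False_eq_True)
qed

lemma (in oriented_triangulated_surface) hulls_Union_eq:
  "(\<Union>(a, b, c)\<in>S. convex hull {a, b, c}) = \<Union>((hull) convex ` triangles)"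
  using arg_cong[OF hulls_eq, of Union] by (simp add: case_prod_beta' image_image)

section \<open>Linear forms and faces as tools for intersecting simplices\<close>

section \<open>Intersections of convex hulls\<close>

text \<open>The open half-space \<open>f p < c\<close> together with the hull of the vertices on the
  hyperplane is convex and contains \<open>A\<close>, hence also the hull of
  \<open>A\<close>.\<close>

lemma convex_hull_Int_hyperplane:
  fixes f :: "'a::real_vector \<Rightarrow> real"
  assumes f: "linear f" and le: "\<And>p. p \<in> A \<Longrightarrow> f p \<le> c" and x: "x \<in> convex hull A" "f x \<ge> c"
  shows "x \<in> convex hull {p \<in> A. f p = c}"
proof -
  let ?H = "convex hull {p \<in> A. f p = c}"
  have add: "f (p + q) = f p + f q" and scale: "f (r *\<^sub>R p) = r * f p" for p q r
    using f by (simp_all add: linear_add linear_cmul)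
  have "convex {p. f p = c}"
    unfolding convex_def by (auto simp: add scale simp flip: distrib_right)
  then have H: "f p = c" if "p \<in> ?H" for p
    using that hull_minimal[of "{p \<in> A. f p = c}" "{p. f p = c}" convex] by auto
  have "convex ({p. f p < c} \<union> ?H)"
  proof (rule convexI)
    fix p q and u v :: real
    assume p: "p \<in> {p. f p < c} \<union> ?H" and q: "q \<in> {p. f p < c} \<union> ?H"
      and uv: "0 \<le> u" "0 \<le> v" "u + v = 1"
    have le: "f p \<le> c" "f q \<le> c" using p q H by force+
    have "f (u *\<^sub>R p + v *\<^sub>R q) < c" if "f p < c \<and> u > 0 \<or> f q < c \<and> v > 0"
    proof -
      have "u * f p + v * f q < u * c + v * c"
        using that le uv by (auto intro: add_less_le_mono add_le_less_mono mult_left_mono)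
      also have "\<dots> = c" using uv(3) by (simp flip: distrib_right)
      finally show ?thesis by (simp add: add scale)
    qed
    then consider (1) "f (u *\<^sub>R p + v *\<^sub>R q) < c" | (2) "p \<in> ?H" "q \<in> ?H" | (3) "u = 0" "v = 1" | (4) "v = 0" "u = 1"
      using p q uv by (cases "u = 0"; cases "v = 0") force+
    then show "u *\<^sub>R p + v *\<^sub>R q \<in> {p. f p < c} \<union> ?H"
    proof cases
      case 2
      then show ?thesis using uv convexD[OF convex_convex_hull] by blast
    qed (use p q in auto)
  qed
  moreover have "A \<subseteq> {p. f p < c} \<union> ?H" using le hull_inc[of _ "{p \<in> A. f p = c}"] by force
  ultimately have "convex hull A \<subseteq> {p. f p < c} \<union> ?H" by (rule hull_minimal[rotated])
  then show ?thesis using x by auto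
qed

text \<open>Main tool for embeddedness. The intersection is confined to the level c of f, where the
  supporting hyperplane argument applies to f for \<open>A\<close> and to -f for
  \<open>B\<close>.\<close>

lemma convex_hull_Int_separated:
  fixes f :: "'a::real_vector \<Rightarrow> real"
  assumes f: "linear f" and A: "\<And>p. p \<in> A \<Longrightarrow> f p \<le> c" and B: "\<And>p. p \<in> B \<Longrightarrow> c \<le> f p"
  shows "convex hull A \<inter> convex hull B \<subseteq> convex hull {p \<in> A. f p = c} \<inter> convex hull {p \<in> B. f p = c}"
proof
  fix x assume x: "x \<in> convex hull A \<inter> convex hull B"
  have lin: "linear (\<lambda>p. - f p)" using f by (rule linear_compose_neg)
  have cv: "convex {p. f p \<le> c}" "convex {p. f p \<ge> c}"
  proof -
    have add: "f (p + q) = f p + f q" and scale: "f (r *\<^sub>R p) = r * f p" for p q r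
      using f by (simp_all add: linear_add linear_cmul)
    show "convex {p. f p \<le> c}" "convex {p. f p \<ge> c}"
      unfolding convex_def by (auto simp: add scale intro: convex_bound_le)
        (metis (no_types, opaque_lifting) add_mono distrib_right mult_1 mult_left_mono)
  qed
  have "convex hull A \<subseteq> {p. f p \<le> c}" "convex hull B \<subseteq> {p. f p \<ge> c}"
    using A B cv by (intro hull_minimal; auto)+
  then have fx: "f x \<le> c" "f x \<ge> c" using x by auto
  have "x \<in> convex hull {p \<in> A. f p = c}"
    using convex_hull_Int_hyperplane[OF f, of A c x] x fx A by auto
  moreover have "x \<in> convex hull {p \<in> B. - f p = - c}"
    using convex_hull_Int_hyperplane[OF lin, of B "- c" x] x fx B by auto
  ultimately show "x \<in> convex hull {p \<in> A. f p = c} \<inter> convex hull {p \<in> B. f p = c}" by simp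
qed

text \<open>Both hulls are faces of the simplex on \<open>C\<close>, so their intersection is a face
  too, and each of its vertices lies in \<open>A\<close> and in \<open>B\<close>.\<close>

lemma convex_hull_Int_independent:
  fixes C :: "'a::euclidean_space set"
  assumes C: "\<not> affine_dependent C" and "A \<subseteq> C" "B \<subseteq> C"
  shows "convex hull A \<inter> convex hull B \<subseteq> convex hull (A \<inter> B)"
proof -
  have "convex hull A face_of convex hull C" "convex hull B face_of convex hull C"
    using assms face_of_convex_hull_affine_independent by blast+
  then have "convex hull A \<inter> convex hull B face_of convex hull C" by (rule face_of_Int)
  then obtain D where D: "D \<subseteq> C" "convex hull A \<inter> convex hull B = convex hull D"
    using face_of_convex_hull_affine_independent[OF C] by blast
  have ext: "x extreme_point_of (convex hull C) \<longleftrightarrow> x \<in> C" for x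
    by (rule extreme_point_of_convex_hull_affine_independent[OF C])
  have sub: "x \<in> E" if "x \<in> C" "x \<in> convex hull E" "E \<subseteq> C" for x E
  proof -
    have "x extreme_point_of (convex hull E)"
      using that ext hull_mono[OF that(3), of convex] unfolding extreme_point_of_def by blast
    then show ?thesis by (rule extreme_point_of_convex_hull)
  qed
  have "D \<subseteq> A \<inter> B"
  proof
    fix x assume x: "x \<in> D"
    then have "x \<in> convex hull A \<inter> convex hull B" using D(2) by (simp add: hull_inc)
    then show "x \<in> A \<inter> B" using sub x D(1) assms by blast
  qed
  then show ?thesis using D(2) hull_mono by metis
qed

text \<open>The affine hull of a and b stays in one level of f, and this level misses c.\<close>

lemma affine_independent_3_if_linear:
  fixes f :: "'a::euclidean_space \<Rightarrow> real"
  assumes "linear f" "a \<noteq> b" "f a = f b" "f c \<noteq> f a"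
  shows "\<not> affine_dependent {a, b, c}"
proof -
  have "affine {x. f x = f a}"
    using assms(1) unfolding affine_def by (auto simp: linear_add linear_cmul simp flip: distrib_right)
  then have "affine hull {a, b} \<subseteq> {x. f x = f a}" using assms by (intro hull_minimal) auto
  then have "c \<notin> affine hull {a, b}" using assms(4) by auto
  then have "\<not> affine_dependent (insert c {a, b})"
    by (intro affine_independent_insert) (use assms(2) in simp_all)
  then show ?thesis by (simp add: insert_commute)
qed

text \<open>The inclusion opposite to \<open>int\<close> always holds, so two hulls meet in the hull
  of their common vertices, which is a face of each.\<close>

lemma triangulation_triplesI:
  fixes S :: "('a::euclidean_space \<times> 'a \<times> 'a) set"
  assumes "finite S"
    and ind: "\<And>a b c. (a, b, c) \<in> S \<Longrightarrow> \<not> affine_dependent {a, b, c}"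
    and int: "\<And>a b c a' b' c'. (a, b, c) \<in> S \<Longrightarrow> (a', b', c') \<in> S \<Longrightarrow>
      convex hull {a, b, c} \<inter> convex hull {a', b', c'} \<subseteq> convex hull ({a, b, c} \<inter> {a', b', c'})"
  shows "triangulation ((\<lambda>(a, b, c). convex hull {a, b, c}) ` S)"
  unfolding triangulation_def
proof (intro conjI ballI allI impI)
  show "finite ((\<lambda>(a, b, c). convex hull {a, b, c}) ` S)" using assms by simp
next
  fix T assume "T \<in> (\<lambda>(a, b, c). convex hull {a, b, c}) ` S"
  then obtain a b c where abc: "(a, b, c) \<in> S" "T = convex hull {a, b, c}" by auto
  show "\<exists>n. n simplex T"
    unfolding simplex_def
    by (rule exI[of _ "int (card {a, b, c}) - 1"], rule exI[of _ "{a, b, c}"]) (use ind abc in auto)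
next
  fix T T' assume "T \<in> (\<lambda>(a, b, c). convex hull {a, b, c}) ` S \<and> T' \<in> (\<lambda>(a, b, c). convex hull {a, b, c}) ` S"
  then obtain a b c a' b' c' where *: "(a, b, c) \<in> S" "T = convex hull {a, b, c}"
    "(a', b', c') \<in> S" "T' = convex hull {a', b', c'}" by auto
  have "T \<inter> T' = convex hull ({a, b, c} \<inter> {a', b', c'})"
    using int[OF *(1,3)] unfolding * by (meson Int_lower1 Int_lower2 hull_mono inf.boundedI subset_antisym)
  then show "T \<inter> T' face_of T"
    unfolding *(2) face_of_convex_hull_affine_independent[OF ind[OF *(1)]] by (meson Int_lower1)
qed

section \<open>Embeddedness of the strips: separation by x, by height and by z\<close>

section \<open>Surfaces made of strips: geometry\<close>

definition coord_form :: "real \<Rightarrow> real \<Rightarrow> real \<Rightarrow> R4 \<Rightarrow> real" where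
  "coord_form \<alpha> \<beta> \<gamma> p = \<alpha> * fst p + \<beta> * fst (snd p) + \<gamma> * fst (snd (snd p))"

lemma linear_coord_form: "linear (coord_form \<alpha> \<beta> \<gamma>)"
  by (rule linearI) (simp_all add: coord_form_def algebra_simps)

text \<open>
  Disc \<open>i\<close> is cut into horizontal slabs of height 1. The slab between the heights \<open>y\<close> and \<open>y + 1\<close> is
  bounded on the left by the line over \<open>x = 2 i\<close> and on the right by the segment from \<open>a i y\<close> to
  \<open>b i y\<close>. Disc \<open>k\<close> is glued at its top and at its bottom, along a segment in the direction of
  the \<open>z\<close>-axis, to the right sides of the discs \<open>pu k\<close> and \<open>pd k\<close>. The lower and upper ends of
  these segments are the points \<open>l k y\<close> and \<open>m k y\<close> for \<open>y = hi k\<close> and \<open>y = lo k\<close>.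
\<close>

locale strips =
  fixes n :: nat and lo hi :: "nat \<Rightarrow> int" and pu pd :: "nat \<Rightarrow> nat"
    and ax az bx bz :: "nat \<Rightarrow> int \<Rightarrow> real" and sg :: "nat \<Rightarrow> bool"
  assumes n: "0 < n"
    and sg_0: "sg 0"
    and lohi: "i < n \<Longrightarrow> lo i < 0 \<and> 0 < hi i"
    and ax_left: "i < n \<Longrightarrow> lo i \<le> y \<Longrightarrow> y < hi i \<Longrightarrow>
      2 * real i < ax i y \<or> (0 < i \<and> y = lo i \<and> ax i y = 2 * real i \<and> az i y = 1)"
    and bx_left: "i < n \<Longrightarrow> lo i \<le> y \<Longrightarrow> y < hi i \<Longrightarrow>
      2 * real i < bx i y \<or> (0 < i \<and> y + 1 = hi i \<and> bx i y = 2 * real i \<and> bz i y = 1)"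
    and ax_right: "i < k \<Longrightarrow> k < n \<Longrightarrow> lo i \<le> y \<Longrightarrow> y < hi i \<Longrightarrow> lo k \<le> y \<Longrightarrow> y < hi k \<Longrightarrow>
      ax i y < 2 * real k \<or> (y = lo k \<and> pd k = i \<and> ax i y = 2 * real k \<and> az i y = 1)"
    and bx_right: "i < k \<Longrightarrow> k < n \<Longrightarrow> lo i \<le> y \<Longrightarrow> y < hi i \<Longrightarrow> lo k \<le> y \<Longrightarrow> y < hi k \<Longrightarrow>
      bx i y < 2 * real k \<or> (y + 1 = hi k \<and> pu k = i \<and> bx i y = 2 * real k \<and> bz i y = 1)"
    and no_gap: "i < n \<Longrightarrow> lo i < y \<Longrightarrow> y < hi i \<Longrightarrow>
      (ax i y = bx i (y - 1) \<and> az i y = bz i (y - 1)) \<or>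
      (\<exists>k. 0 < k \<and> k < n \<and> (pu k = i \<and> y = hi k \<or> pd k = i \<and> y = lo k))"
    and top: "0 < k \<Longrightarrow> k < n \<Longrightarrow> pu k < k \<and> hi k < hi (pu k) \<and> sg k \<noteq> sg (pu k) \<and>
      bx k (hi k - 1) = 2 * real k \<and> bz k (hi k - 1) = 1 \<and>
      ax (pu k) (hi k) = 2 * real k \<and> az (pu k) (hi k) = 0 \<and>
      bx (pu k) (hi k - 1) = 2 * real k \<and> bz (pu k) (hi k - 1) = 1"
    and bottom: "0 < k \<Longrightarrow> k < n \<Longrightarrow> pd k < k \<and> lo (pd k) < lo k \<and> sg k \<noteq> sg (pd k) \<and>
      ax k (lo k) = 2 * real k \<and> az k (lo k) = 1 \<and>
      ax (pd k) (lo k) = 2 * real k \<and> az (pd k) (lo k) = 1 \<and>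
      bx (pd k) (lo k - 1) = 2 * real k \<and> bz (pd k) (lo k - 1) = 0"
begin

definition a :: "nat \<Rightarrow> int \<Rightarrow> R4" where "a i y = (ax i y, real_of_int y, az i y, 1)"
definition b :: "nat \<Rightarrow> int \<Rightarrow> R4" where "b i y = (bx i y, real_of_int (y + 1), bz i y, 1)"
definition l :: "nat \<Rightarrow> int \<Rightarrow> R4" where "l i y = (2 * real i, real_of_int y, 0, 1)"
definition m :: "nat \<Rightarrow> int \<Rightarrow> R4" where "m i y = (2 * real i, real_of_int y, 1, 1)"

definition slab :: "nat \<Rightarrow> int \<Rightarrow> bool" where
  "slab i y \<longleftrightarrow> i < n \<and> lo i \<le> y \<and> y < hi i"

definition glued :: "nat \<Rightarrow> nat \<Rightarrow> int \<Rightarrow> bool" where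
  "glued k i y \<longleftrightarrow> 0 < k \<and> k < n \<and> (pu k = i \<and> y = hi k \<or> pd k = i \<and> y = lo k)"

definition gap :: "nat \<Rightarrow> int \<Rightarrow> bool" where
  "gap i y \<longleftrightarrow> (\<exists>k. glued k i y)"

text \<open>Three kinds of triangle, each with its rotations. A slab is a trapezoid cut along the
  diagonal from \<open>l i y\<close> to \<open>b i y\<close>. At a crossing the right side jumps
  from \<open>b i (y - 1)\<close> to \<open>a i y\<close>, and the triangle with apex
  \<open>l i y\<close> fills this gap; its side opposite to \<open>l i y\<close> is the segment to
  which the other disc is glued.\<close>

inductive tri :: "nat \<Rightarrow> R4 \<Rightarrow> R4 \<Rightarrow> R4 \<Rightarrow> bool" for i where
  lab: "slab i y \<Longrightarrow> tri i (l i y) (a i y) (b i y)"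
| abl: "slab i y \<Longrightarrow> tri i (a i y) (b i y) (l i y)"
| bla: "slab i y \<Longrightarrow> tri i (b i y) (l i y) (a i y)"
| lbl: "slab i y \<Longrightarrow> tri i (l i y) (b i y) (l i (y + 1))"
| bll: "slab i y \<Longrightarrow> tri i (b i y) (l i (y + 1)) (l i y)"
| llb: "slab i y \<Longrightarrow> tri i (l i (y + 1)) (l i y) (b i y)"
| lba: "gap i y \<Longrightarrow> tri i (l i y) (b i (y - 1)) (a i y)"
| bal: "gap i y \<Longrightarrow> tri i (b i (y - 1)) (a i y) (l i y)"
| alb: "gap i y \<Longrightarrow> tri i (a i y) (l i y) (b i (y - 1))"

definition S :: "(R4 \<times> R4 \<times> R4) set" where
  "S = {(u, v, w). \<exists>i<n. if sg i then tri i u v w else tri i v u w}"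

text \<open>Vertices of disc i at height y. At an end of the disc only one of the two adjacent slabs
  exists, hence the separate conditions.\<close>

definition level :: "nat \<Rightarrow> int \<Rightarrow> R4 set" where
  "level i y = {p. p = l i y \<and> i < n \<and> lo i \<le> y \<and> y \<le> hi i \<or> p = a i y \<and> slab i y \<or> p = b i (y - 1) \<and> slab i (y - 1)}"

lemma height [simp]: "fst (snd (a i y)) = y" "fst (snd (b i y)) = y + 1" "fst (snd (l i y)) = y"
    "fst (snd (m i y)) = y"
  by (simp_all add: a_def b_def l_def m_def)

text \<open>At an upper crossing the right side arrives at the over-point (z = 1) from below and
  continues from the under-point (z = 0). The mirror image exchanges above and below, and with them
  the roles of \<open>a\<close> and \<open>b\<close>.\<close>

lemma gluedE:
  assumes "glued k i y"
  obtains (up) "y = hi k" "pu k = i" "0 < y" "a i y = l k y" "b i (y - 1) = m k y" "b k (y - 1) = m k y"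
    | (down) "y = lo k" "pd k = i" "y < 0" "a i y = m k y" "b i (y - 1) = l k y" "a k y = m k y"
  using assms top[of k] bottom[of k] lohi[of k]
  by (auto simp: glued_def a_def b_def l_def m_def)

lemma glued_slab:
  assumes "glued k i y"
  shows "slab i y" "slab i (y - 1)" "lo i < y" "y < hi i" "i < n" "i < k" "k < n" "0 < k" "lo k \<le> y" "y \<le> hi k"
    "sg k \<noteq> sg i"
proof -
  have k: "0 < k" "k < n" using assms by (auto simp: glued_def)
  then have "i < k" "sg k \<noteq> sg i" using assms top[of k] bottom[of k] by (auto simp: glued_def)
  then have "i < n" using k by simp
  then have "lo i < y \<and> y < hi i" "lo k \<le> y" "y \<le> hi k"
    using assms top[OF k] bottom[OF k] lohi[OF k(2)] lohi[of i] by (auto simp: glued_def)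
  with k \<open>i < k\<close> \<open>i < n\<close> \<open>sg k \<noteq> sg i\<close>
  show "slab i y" "slab i (y - 1)" "lo i < y" "y < hi i" "i < n" "i < k" "k < n" "0 < k" "lo k \<le> y" "y \<le> hi k"
    "sg k \<noteq> sg i"
    by (auto simp: slab_def)
qed

lemma tri_rotate: "tri i u v w \<Longrightarrow> tri i v w u"
  by (induction rule: tri.induct) (auto intro: tri.intros)

lemma level_height: "p \<in> level i y \<Longrightarrow> fst (snd p) = y"
  by (auto simp: level_def)

lemma level_left: "p \<in> level i y \<Longrightarrow> 2 * real i \<le> fst p \<and> (fst p = 2 * real i \<longrightarrow> p \<in> {l i y, m i y})"
  unfolding level_def
  using ax_left[of i y] bx_left[of i "y - 1"]
  by (auto simp: l_def a_def b_def m_def slab_def)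

text \<open>The locale compares abscissas only in slabs common to both discs. At an end of disc k
  one of the two adjacent slabs is missing, and the other one supplies the comparison, because the
  right side of disc i jumps in the direction of z only.\<close>

lemma level_right:
  assumes ik: "i < k" and p: "p \<in> level i y" and q: "q \<in> level k y"
  shows "fst p < 2 * real k \<or> glued k i y \<and> p \<in> {l k y, m k y}"
proof -
  have k: "k < n" "lo k \<le> y" "y \<le> hi k" "0 < k" "i < n" and i: "lo i \<le> y" "y \<le> hi i"
    using p q ik by (auto simp: level_def slab_def)
  note lh = lohi[OF k(1)] lohi[OF k(5)]
  have A: "ax i y < 2 * real k \<or> glued k i y \<and> a i y \<in> {l k y, m k y}" if "slab i y" "slab k y"
    using ax_right[OF ik k(1)] that k by (auto simp: slab_def glued_def a_def m_def)
  have B: "bx i (y - 1) < 2 * real k \<or> glued k i y \<and> b i (y - 1) \<in> {l k y, m k y}"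
    if "slab i (y - 1)" "slab k (y - 1)"
    using bx_right[OF ik k(1), of "y - 1"] that k by (auto simp: slab_def glued_def b_def m_def)
  have AB: "a i y = b i (y - 1) \<or> (\<exists>k'. glued k' i y)" if "lo i < y" "y < hi i"
    using no_gap[OF k(5) that] by (auto simp: glued_def a_def b_def)
  have AB': "ax i y = bx i (y - 1)" if "lo i < y" "y < hi i"
    using AB[OF that] by (auto simp: a_def b_def l_def m_def elim!: gluedE)
  have gl: "k' = k" if "glued k' i y" "ax i y = 2 * real k" for k'
    using that by (auto simp: a_def b_def l_def m_def elim!: gluedE)
  from p consider (l) "p = l i y" | (a) "p = a i y" "slab i y" | (b) "p = b i (y - 1)" "slab i (y - 1)"
    by (auto simp: level_def)
  then show ?thesis
  proof cases
    case l
    then show ?thesis using ik by (simp add: l_def)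
  next
    case a
    show ?thesis
    proof (cases "y < hi k")
      case True
      then show ?thesis using A a k by (auto simp: slab_def a_def)
    next
      case False
      then have y: "y = hi k" "lo i < y" "y < hi i" using k a lh by (auto simp: slab_def)
      then have "slab k (y - 1)" "slab i (y - 1)" using lh k by (auto simp: slab_def)
      from B[OF this(2,1)] show ?thesis
      proof
        assume "bx i (y - 1) < 2 * real k"
        then show ?thesis using AB' y a by (simp add: a_def)
      next
        assume g: "glued k i y \<and> b i (y - 1) \<in> {l k y, m k y}"
        then have "a i y \<in> {l k y, m k y}" by (auto elim!: gluedE)
        then show ?thesis using g a by simp
      qed
    qed
  next
    case b
    show ?thesis
    proof (cases "lo k < y")
      case True
      then show ?thesis using B b k by (auto simp: slab_def b_def)
    next
      case False
      then have y: "y = lo k" "lo i < y" "y < hi i" using k b lh by (auto simp: slab_def)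
      then have "slab k y" "slab i y" using lh k by (auto simp: slab_def)
      from A[OF this(2,1)] show ?thesis
      proof
        assume "ax i y < 2 * real k"
        then show ?thesis using AB' y b by (simp add: b_def)
      next
        assume g: "glued k i y \<and> a i y \<in> {l k y, m k y}"
        then have "b i (y - 1) \<in> {l k y, m k y}" by (auto elim!: gluedE)
        then show ?thesis using g b by simp
      qed
    qed
  qed
qed

lemma independent_slab_lower: "slab i y \<Longrightarrow> \<not> affine_dependent {l i y, a i y, b i y}"
  using ax_left[of i y]
  by (intro affine_independent_3_if_linear[OF linear_coord_form[of 0 1 0]])
     (auto simp: coord_form_def slab_def a_def b_def l_def)

lemma independent_slab_upper: "slab i y \<Longrightarrow> \<not> affine_dependent {b i y, l i (y + 1), l i y}"
  using bx_left[of i y]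
  by (intro affine_independent_3_if_linear[OF linear_coord_form[of 0 1 0]])
     (auto simp: coord_form_def slab_def a_def b_def l_def)

lemma glued_coords:
  assumes "glued k i y"
  shows "fst (a i y) = 2 * real k" "fst (b i (y - 1)) = 2 * real k" "a i y \<noteq> b i (y - 1)"
    "{a i y, b i (y - 1)} = {l k y, m k y}"
  using assms by (auto simp: l_def m_def elim!: gluedE)

lemma independent_glued: "glued k i y \<Longrightarrow> \<not> affine_dependent {a i y, b i (y - 1), l i y}"
  using glued_coords[of k i y] glued_slab(6)[of k i y]
  by (intro affine_independent_3_if_linear[OF linear_coord_form[of 1 0 0]])
     (auto simp: coord_form_def l_def)

text \<open>At a crossing the level is contained in a gluing triangle; elsewhere the right side is
  continuous and at most two vertices remain.\<close>

lemma independent_level: "\<not> affine_dependent (level i y)"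
proof (cases "\<exists>k. glued k i y")
  case True
  then obtain k where "glued k i y" ..
  moreover have "level i y \<subseteq> {a i y, b i (y - 1), l i y}" by (auto simp: level_def)
  ultimately show ?thesis using independent_glued affine_independent_subset by blast
next
  case False
  have "level i y \<subseteq> {l i y, a i y} \<or> level i y \<subseteq> {l i y, b i (y - 1)}"
  proof (cases "slab i y \<and> slab i (y - 1)")
    case True
    then have "a i y = b i (y - 1)"
      using no_gap[of i y] \<open>\<nexists>k. glued k i y\<close> by (auto simp: slab_def glued_def a_def b_def)
    then show ?thesis by (auto simp: level_def)
  qed (auto simp: level_def)
  then show ?thesis using affine_independent_2 affine_independent_subset by metis
qed

lemma independent_lm: "\<not> affine_dependent {l k y, m k y}"
  by (rule affine_independent_2)

text \<open>Separation by x = 2 k: disc i lies to the left and disc k to the right, and in the plane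
  itself only ends of one segment remain.\<close>

lemma hulls_level_Int:
  assumes "i \<le> k" and A: "A \<subseteq> level i y" and B: "B \<subseteq> level k y"
  shows "convex hull A \<inter> convex hull B \<subseteq> convex hull (A \<inter> B)"
proof (cases "i = k")
  case True
  then show ?thesis using assms convex_hull_Int_independent[OF independent_level] by blast
next
  case False
  then have ik: "i < k" using assms by simp
  show ?thesis
  proof (cases "A = {} \<or> B = {}")
    case False
    let ?f = "coord_form 1 0 0" and ?c = "2 * real k"
    let ?A = "{p \<in> A. ?f p = ?c}" and ?B = "{p \<in> B. ?f p = ?c}"
    obtain q where "q \<in> B" using False by blast
    then have q: "q \<in> level k y" using B by blast
    have right: "fst p < 2 * real k \<or> p \<in> {l k y, m k y}" if "p \<in> A" for p
      using level_right[OF ik subsetD[OF A that] q] by blast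
    have left: "2 * real k \<le> fst p \<and> (fst p = 2 * real k \<longrightarrow> p \<in> {l k y, m k y})" if "p \<in> B" for p
      using level_left[OF subsetD[OF B that]] by blast
    have "convex hull A \<inter> convex hull B \<subseteq> convex hull ?A \<inter> convex hull ?B"
    proof (rule convex_hull_Int_separated[OF linear_coord_form])
      show "?f p \<le> ?c" if "p \<in> A" for p using right[OF that] by (auto simp: coord_form_def m_def l_def)
      show "?c \<le> ?f p" if "p \<in> B" for p using left[OF that] by (simp add: coord_form_def)
    qed
    also have "\<dots> \<subseteq> convex hull (?A \<inter> ?B)"
    proof (rule convex_hull_Int_independent[OF independent_lm[of k y]])
      show "?A \<subseteq> {l k y, m k y}"
      proof
        fix p assume "p \<in> ?A"
        then show "p \<in> {l k y, m k y}" using right[of p] by (simp add: coord_form_def)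
      qed
      show "?B \<subseteq> {l k y, m k y}"
      proof
        fix p assume "p \<in> ?B"
        then show "p \<in> {l k y, m k y}" using left[of p] by (simp add: coord_form_def)
      qed
    qed
    also have "\<dots> \<subseteq> convex hull (A \<inter> B)" by (rule hull_mono) auto
    finally show ?thesis .
  qed auto
qed

text \<open>Separation by height; the surviving vertices all lie at height t, where
  \<open>hulls_level_Int\<close> applies.\<close>

lemma hulls_stacked_Int:
  assumes ord: "s \<le> t" "t \<le> s'" "s' \<le> t'"
    and A: "A \<subseteq> level i s \<union> level i t" and B: "B \<subseteq> level k s' \<union> level k t'"
  shows "convex hull A \<inter> convex hull B \<subseteq> convex hull (A \<inter> B)"
proof -
  let ?f = "coord_form 0 1 0" and ?c = "real_of_int t"
  let ?A = "{p \<in> A. ?f p = ?c}" and ?B = "{p \<in> B. ?f p = ?c}"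
  have hA: "fst (snd p) = s \<and> p \<in> level i s \<or> fst (snd p) = t \<and> p \<in> level i t" if "p \<in> A" for p
    using that A level_height by blast
  have hB: "fst (snd p) = s' \<and> p \<in> level k s' \<or> fst (snd p) = t' \<and> p \<in> level k t'" if "p \<in> B" for p
    using that B level_height by blast
  have "convex hull A \<inter> convex hull B \<subseteq> convex hull ?A \<inter> convex hull ?B"
  proof (rule convex_hull_Int_separated[OF linear_coord_form])
    show "?f p \<le> ?c" if "p \<in> A" for p using hA[OF that] ord by (auto simp: coord_form_def)
    show "?c \<le> ?f p" if "p \<in> B" for p using hB[OF that] ord by (auto simp: coord_form_def)
  qed
  also have "\<dots> \<subseteq> convex hull (?A \<inter> ?B)"
  proof -
    have sub: "?A \<subseteq> level i t" "?B \<subseteq> level k t"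
    proof
      fix p assume "p \<in> ?A"
      then show "p \<in> level i t" using hA[of p] by (auto simp: coord_form_def)
    next
      show "?B \<subseteq> level k t"
      proof
        fix p assume "p \<in> ?B"
        then show "p \<in> level k t" using hB[of p] by (auto simp: coord_form_def)
      qed
    qed
    show ?thesis
    proof (cases "i \<le> k")
      case True
      then show ?thesis by (rule hulls_level_Int[OF _ sub])
    next
      case False
      then have "convex hull ?B \<inter> convex hull ?A \<subseteq> convex hull (?B \<inter> ?A)"
        by (intro hulls_level_Int[OF _ sub(2,1)]) simp
      then show ?thesis by (simp only: Int_commute)
    qed
  qed
  also have "\<dots> \<subseteq> convex hull (A \<inter> B)" by (rule hull_mono) auto
  finally show ?thesis .
qed

text \<open>The plane x = 2 k may contain several vertices of disc k, but at most one of disc i, and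
  that one has z = 1. A second separation, by z, discards the vertices with z = 0.\<close>

lemma hulls_same_slab_Int:
  assumes ik: "i < k" and sl: "slab i y" "slab k y"
    and A: "A \<subseteq> {l i y, a i y, b i y, l i (y + 1)}" and B: "B \<subseteq> {l k y, a k y, b k y, l k (y + 1)}"
  shows "convex hull A \<inter> convex hull B \<subseteq> convex hull (A \<inter> B)"
proof -
  let ?f = "coord_form 1 0 0" and ?c = "2 * real k" and ?g = "coord_form 0 0 1"
  let ?A = "{p \<in> A. ?f p = ?c}" and ?B = "{p \<in> B. ?f p = ?c}"
  let ?C = "{p \<in> ?A. - ?g p = - 1}" and ?D = "{p \<in> ?B. - ?g p = - 1}"
  have n: "k < n" using sl by (simp add: slab_def)
  have lh: "lo k < 0" "0 < hi k" using lohi n by auto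
  have a: "ax i y < 2 * real k \<or> (y = lo k \<and> ax i y = 2 * real k \<and> az i y = 1)"
    using ax_right[OF ik n] sl by (auto simp: slab_def)
  have b: "bx i y < 2 * real k \<or> (y + 1 = hi k \<and> bx i y = 2 * real k \<and> bz i y = 1)"
    using bx_right[OF ik n] sl by (auto simp: slab_def)
  have right: "fst p < 2 * real k \<or> p = m k y \<and> y = lo k \<or> p = m k (y + 1) \<and> y + 1 = hi k" if "p \<in> A" for p
    using that A ik a b by (auto simp: l_def a_def b_def m_def)
  have left: "2 * real k < fst p \<or> p = l k y \<or> p = l k (y + 1) \<or> p = m k y \<and> y = lo k \<or> p = m k (y + 1) \<and> y + 1 = hi k"
    if "p \<in> B" for p
  proof -
    have "p = l k y \<or> p = a k y \<or> p = b k y \<or> p = l k (y + 1)" using that B by blast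
    moreover have "2 * real k < ax k y \<or> a k y = m k y \<and> y = lo k"
      using ax_left[of k y] sl by (auto simp: a_def m_def slab_def)
    moreover have "2 * real k < bx k y \<or> b k y = m k (y + 1) \<and> y + 1 = hi k"
      using bx_left[of k y] sl by (auto simp: b_def m_def slab_def)
    moreover have "fst (a k y) = ax k y" "fst (b k y) = bx k y" by (simp_all add: a_def b_def)
    ultimately show ?thesis by metis
  qed
  have rightA: "p = m k y \<and> y = lo k \<or> p = m k (y + 1) \<and> y + 1 = hi k" if "p \<in> ?A" for p
    using right[of p] that by (auto simp: coord_form_def)
  have leftD: "p = m k y \<and> y = lo k \<or> p = m k (y + 1) \<and> y + 1 = hi k" if "p \<in> ?D" for p
    using left[of p] that by (auto simp: coord_form_def l_def)
  \<comment> \<open>As \<open>lo k < 0 < hi k\<close>, at most one end of disc k belongs to this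
    slab, so q is the only possible contact point.\<close>
  define q where "q = (if y = lo k then m k y else m k (y + 1))"
  have "p = q" if "p \<in> ?A" for p using rightA[OF that] lh unfolding q_def by auto
  moreover have "p = q" if "p \<in> ?D" for p using leftD[OF that] lh unfolding q_def by auto
  ultimately have q: "?A \<subseteq> {q}" "?D \<subseteq> {q}" by blast+
  have gq: "?g q = 1" by (simp add: q_def coord_form_def m_def)
  have "convex hull A \<inter> convex hull B \<subseteq> convex hull ?A \<inter> convex hull ?B"
  proof (rule convex_hull_Int_separated[OF linear_coord_form])
    show "?f p \<le> ?c" if "p \<in> A" for p using right[OF that] by (auto simp: coord_form_def m_def)
    show "?c \<le> ?f p" if "p \<in> B" for p using left[OF that] by (auto simp: coord_form_def m_def l_def)
  qed
  also have "\<dots> \<subseteq> convex hull ?C \<inter> convex hull ?D"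
  proof (rule convex_hull_Int_separated[OF linear_compose_neg[OF linear_coord_form]])
    show "- ?g p \<le> - 1" if "p \<in> ?A" for p using q(1) gq that by auto
    show "- 1 \<le> - ?g p" if "p \<in> ?B" for p
      using left[of p] that by (auto simp: coord_form_def m_def l_def)
  qed
  also have "\<dots> \<subseteq> convex hull (?C \<inter> ?D)"
    using q by (intro convex_hull_Int_independent[OF affine_independent_1[of q]]) auto
  also have "\<dots> \<subseteq> convex hull (A \<inter> B)" by (rule hull_mono) auto
  finally show ?thesis .
qed

lemma hulls_same_cell_Int:
  assumes sl: "slab i y"
  shows "convex hull {l i y, b i y, l i (y + 1)} \<inter> convex hull {l i y, a i y, b i y} \<subseteq> convex hull {l i y, b i y}"
proof -
  \<comment> \<open>This form is constant along the diagonal from \<open>l i y\<close> to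
    \<open>b i y\<close>. The other two corners lie weakly on opposite sides, and not both on the
    diagonal plane.\<close>
  let ?f = "coord_form 1 (2 * real i - bx i y) 0" and ?c = "2 * real i + y * (2 * real i - bx i y)"
  let ?A = "{l i y, b i y, l i (y + 1)}" and ?B = "{l i y, a i y, b i y}"
  have lh: "lo i < 0" "0 < hi i" using lohi sl by (auto simp: slab_def)
  have v: "?f (l i y) = ?c" "?f (b i y) = ?c" "?f (l i (y + 1)) = ?c + (2 * real i - bx i y)" "?f (a i y) = ?c + (ax i y - 2 * real i)"
    by (simp_all add: coord_form_def l_def b_def a_def algebra_simps)
  have x: "2 * real i \<le> bx i y" "2 * real i \<le> ax i y" "2 * real i < bx i y \<or> 2 * real i < ax i y"
    using ax_left[of i y] bx_left[of i y] sl lh by (auto simp: slab_def)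
  have "convex hull ?A \<inter> convex hull ?B \<subseteq> convex hull {p \<in> ?A. ?f p = ?c} \<inter> convex hull {p \<in> ?B. ?f p = ?c}"
    using v x by (intro convex_hull_Int_separated[OF linear_coord_form]) auto
  moreover have "{p \<in> ?A. ?f p = ?c} \<subseteq> {l i y, b i y} \<or> {p \<in> ?B. ?f p = ?c} \<subseteq> {l i y, b i y}"
    using v x by auto
  ultimately show ?thesis by (meson Int_lower1 Int_lower2 hull_mono order_trans)
qed

lemma tri_cell:
  assumes "tri i u v w"
  obtains (lower) y where "slab i y" "{u, v, w} = {l i y, a i y, b i y}"
    | (upper) y where "slab i y" "{u, v, w} = {l i y, b i y, l i (y + 1)}"
    | (glue) y k where "glued k i y" "{u, v, w} = {l i y, b i (y - 1), a i y}"
proof -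
  have perm: "{q, r, p} = {p, q, r}" "{r, p, q} = {p, q, r}" for p q r :: R4 by blast+
  show thesis using assms
    by (cases rule: tri.cases) (use lower upper glue perm in \<open>metis gap_def\<close>)+
qed

text \<open>The first alternative is a gluing triangle, which has a single height; the second is
  half of a slab.\<close>

lemma tri_levels:
  assumes "tri i u v w"
  obtains s t where "s \<le> t" "{u, v, w} \<subseteq> level i s \<union> level i t" "t = s"
    | s where "slab i s" "{u, v, w} \<subseteq> level i s \<union> level i (s + 1)"
      "{u, v, w} = {l i s, a i s, b i s} \<or> {u, v, w} = {l i s, b i s, l i (s + 1)}"
  using assms
proof (cases rule: tri_cell)
  case (lower y)
  then show ?thesis using that(2)[of y] by (force simp: level_def slab_def)
next
  case (upper y)
  then show ?thesis using that(2)[of y] by (force simp: level_def slab_def)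
next
  case (glue y k)
  then have "{u, v, w} \<subseteq> level i y" using glued_slab[OF glue(1)] by (auto simp: level_def)
  then show ?thesis using that(1)[of y y] by auto
qed

text \<open>Two triangles are separated by a height unless they lie in the same slab; there they
  belong to different discs or to one trapezoid.\<close>

lemma hulls_tri_Int:
  assumes A: "tri i u v w" and B: "tri k u' v' w'"
  shows "convex hull {u, v, w} \<inter> convex hull {u', v', w'} \<subseteq> convex hull ({u, v, w} \<inter> {u', v', w'})"
proof -
  let ?A = "{u, v, w}" and ?B = "{u', v', w'}"
  have swap: "convex hull ?A \<inter> convex hull ?B \<subseteq> convex hull (?A \<inter> ?B)"
    if "convex hull ?B \<inter> convex hull ?A \<subseteq> convex hull (?B \<inter> ?A)"
    using that by (simp only: Int_commute)
  have st: ?thesis if "?A \<subseteq> level i s \<union> level i t" "?B \<subseteq> level k s' \<union> level k t'"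
    "s \<le> t" "s' \<le> t'" "t \<le> s' \<or> t' \<le> s" for s t s' t'
    using hulls_stacked_Int[of s t s' t' ?A i ?B k] hulls_stacked_Int[of s' t' s t ?B k ?A i] swap that
    by blast
  consider (other) s t s' t' where "?A \<subseteq> level i s \<union> level i t" "?B \<subseteq> level k s' \<union> level k t'"
    "s \<le> t" "s' \<le> t'" "t \<le> s' \<or> t' \<le> s"
    | (same) s where "slab i s" "slab k s"
    "?A = {l i s, a i s, b i s} \<or> ?A = {l i s, b i s, l i (s + 1)}"
    "?B = {l k s, a k s, b k s} \<or> ?B = {l k s, b k s, l k (s + 1)}"
    using A
  proof (cases rule: tri_levels)
    case (1 s t)
    note A1 = 1
    show ?thesis using B
    proof (cases rule: tri_levels)
      case (1 s' t')
      show ?thesis by (rule that(1)[OF A1(2) 1(2)]) (use A1(1,3) 1(1,3) in presburger)+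
    next
      case (2 s')
      show ?thesis by (rule that(1)[OF A1(2) 2(2)]) (use A1(1,3) in presburger)+
    qed
  next
    case (2 s)
    note A2 = 2
    show ?thesis using B
    proof (cases rule: tri_levels)
      case (1 s' t')
      show ?thesis by (rule that(1)[OF A2(2) 1(2)]) (use 1(1,3) in presburger)+
    next
      case (2 s')
      show ?thesis
      proof (cases "s = s'")
        case True
        show ?thesis by (rule that(2)[of s]) (use True A2(1,3) 2(1,3) in simp_all)
      next
        case False
        show ?thesis by (rule that(1)[OF A2(2) 2(2)]) (use False in presburger)+
      qed
    qed
  qed
  then show ?thesis
  proof cases
    case other
    then show ?thesis by (rule st)
  next
    case same
    consider "i < k" | "k < i" | "i = k" by linarith
    then show ?thesis
    proof cases
      case 1
      show ?thesis using same(3,4) by (intro hulls_same_slab_Int[OF 1 same(1,2)]) auto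
    next
      case 2
      show ?thesis using same(3,4) by (intro swap hulls_same_slab_Int[OF 2 same(2,1)]) auto
    next
      case 3
      then have sl: "slab i s" using same by simp
      have cell: "convex hull {l i s, b i s, l i (s + 1)} \<inter> convex hull {l i s, a i s, b i s} \<subseteq>
        convex hull ({l i s, b i s, l i (s + 1)} \<inter> {l i s, a i s, b i s})"
        using hulls_same_cell_Int[OF sl]
          hull_mono[of "{l i s, b i s}" "{l i s, b i s, l i (s + 1)} \<inter> {l i s, a i s, b i s}" convex]
        by blast
      then have cell': "convex hull {l i s, a i s, b i s} \<inter> convex hull {l i s, b i s, l i (s + 1)} \<subseteq>
        convex hull ({l i s, a i s, b i s} \<inter> {l i s, b i s, l i (s + 1)})"
        by (simp only: Int_commute)
      have "convex hull A' \<inter> convex hull B' \<subseteq> convex hull (A' \<inter> B')"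
        if "A' = {l i s, a i s, b i s} \<or> A' = {l i s, b i s, l i (s + 1)}"
          "B' = {l i s, a i s, b i s} \<or> B' = {l i s, b i s, l i (s + 1)}" for A' B'
        by (insert that, elim disjE; hypsubst; (rule cell | rule cell' | simp only: Int_absorb subset_refl))
      from this[of ?A ?B] show ?thesis using same(3,4) 3 by (simp only:)
    qed
  qed
qed

end

section \<open>Combinatorial surface conditions, within one disc and across gluing segments\<close>

section \<open>Surfaces made of strips: coherence and vertex links\<close>

context strips
begin

lemma point_eqs [simp]:
  "l i y = l i y' \<longleftrightarrow> y = y'" "a i y = a i y' \<longleftrightarrow> y = y'" "b i y = b i y' \<longleftrightarrow> y = y'"
  using height by (metis of_int_eq_iff add_right_cancel)+

lemma slab_neq:
  assumes "slab i y"
  shows "a i y \<noteq> l i y'" "b i y \<noteq> l i y'"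
  using ax_left[of i y] bx_left[of i y] assms by (auto simp: a_def b_def l_def slab_def)

lemma gapD:
  assumes "gap i y"
  shows "slab i y" "slab i (y - 1)" "a i y \<noteq> b i (y - 1)"
  using assms glued_slab(1,2) glued_coords(3) unfolding gap_def by blast+

lemma gap_neq:
  assumes "gap i y"
  shows "a i y \<noteq> l i y'" "b i (y - 1) \<noteq> l i y'" "a i y \<noteq> b i (y - 1)"
  using assms gapD slab_neq by blast+

lemma gap_Suc_neq: "gap i (y + 1) \<Longrightarrow> a i (y + 1) \<noteq> b i y"
  using gap_neq(3)[of i "y + 1"] by simp

lemma a_eq_bD: "a i y = b i y' \<Longrightarrow> y = y' + 1 \<and> \<not> gap i (y' + 1)"
  using height(1)[of i y] height(2)[of i y'] gap_Suc_neq[of i y'] by (metis of_int_eq_iff)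

lemma slab_bounds: "slab i y \<Longrightarrow> lo i \<le> y \<and> y < hi i \<and> i < n"
  by (simp add: slab_def)

lemma gap_bounds: "gap i y \<Longrightarrow> lo i < y \<and> y < hi i \<and> i < n"
  using gapD[of i y] by (simp add: slab_def)

lemma no_gapD: "i < n \<Longrightarrow> lo i < y \<Longrightarrow> y < hi i \<Longrightarrow> a i y = b i (y - 1) \<or> gap i y"
  using no_gap[of i y] by (auto simp: gap_def glued_def a_def b_def)

lemmas tri_simps = slab_neq slab_neq[symmetric] gap_neq gap_neq[symmetric] gap_Suc_neq gap_Suc_neq[symmetric]

lemma tri_distinct: "tri i u v w \<Longrightarrow> u \<noteq> v \<and> v \<noteq> w \<and> u \<noteq> w"
  by (induction rule: tri.induct) (auto simp: tri_simps dest: a_eq_bD a_eq_bD[OF sym])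

lemma tri_less: "tri i u v w \<Longrightarrow> i < n"
  by (induction rule: tri.induct) (auto dest: slab_bounds gap_bounds)

text \<open>A finite check: a directed side determines the rule of \<open>tri\<close> and the height
  from which it comes.\<close>

lemma tri_apex_unique:
  assumes "tri i u v w" "tri i u v w'"
  shows "w = w'"
  using assms(1)
  by (cases rule: tri.cases; use assms(2) in \<open>cases rule: tri.cases\<close>;
      auto simp: tri_simps dest!: a_eq_bD a_eq_bD[OF sym])

lemma tri_not_swap:
  assumes "tri i u v w"
  shows "\<not> tri i v u w"
proof
  assume "tri i v u w"
  with assms show False
    by (cases rule: tri.cases; use \<open>tri i v u w\<close> in \<open>cases rule: tri.cases\<close>;
      auto simp: tri_simps dest!: a_eq_bD a_eq_bD[OF sym])
qed

text \<open>The reversed rim edges of disc i: its right side, its left side, the segments on its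
  right at which other discs are attached, and its own upper and lower end.\<close>

lemma no_reverse:
  "slab i y \<Longrightarrow> \<not> tri i (b i y) (a i y) w"
  "slab i y \<Longrightarrow> \<not> tri i (l i y) (l i (y + 1)) w"
  "gap i y \<Longrightarrow> \<not> tri i (a i y) (b i (y - 1)) w"
  "slab i y \<Longrightarrow> y + 1 = hi i \<Longrightarrow> \<not> tri i (l i (y + 1)) (b i y) w"
  "slab i y \<Longrightarrow> y = lo i \<Longrightarrow> \<not> tri i (a i y) (l i y) w"
  by (rule notI, erule tri.cases;
      auto simp: tri_simps dest!: a_eq_bD a_eq_bD[OF sym] dest: slab_bounds gap_bounds)+

lemma tri_level:
  assumes "tri i u v w"
  obtains s t where "u \<in> level i s" "v \<in> level i t" "\<bar>s - t\<bar> \<le> 1"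
  using assms
proof (cases rule: tri_levels)
  case (1 s t)
  then show ?thesis using that[of s s] by auto
next
  case (2 s)
  then have "u \<in> level i s \<or> u \<in> level i (s + 1)" "v \<in> level i s \<or> v \<in> level i (s + 1)" by auto
  then show ?thesis using that[of s s] that[of s "s + 1"] that[of "s + 1" s] that[of "s + 1" "s + 1"] by auto
qed

text \<open>A common vertex must have x = 2 k, since disc i stays on one side of that plane and disc
  k on the other.\<close>

lemma shared_point:
  assumes "i < k" "p \<in> level i y" "p \<in> level k y'"
  shows "y' = y" "glued k i y" "p \<in> {l k y, m k y}"
proof -
  show y: "y' = y" using level_height[OF assms(2)] level_height[OF assms(3)] by simp
  have "fst p < 2 * real k \<or> glued k i y \<and> p \<in> {l k y, m k y}"
    using level_right[OF assms(1,2)] assms(3) y by blast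
  moreover have "2 * real k \<le> fst p" using level_left[OF assms(3)] by blast
  ultimately show "glued k i y" "p \<in> {l k y, m k y}" by auto
qed

text \<open>\<open>hi k\<close> and \<open>lo k\<close> differ by at least 2, so neighbouring
  vertices cannot lie on different gluing segments of disc k.\<close>

lemma glued_heights: "glued k i y \<Longrightarrow> glued k i y' \<Longrightarrow> \<bar>y - y'\<bar> \<le> 1 \<Longrightarrow> y = y'"
  using lohi[of k] by (auto simp: glued_def)

lemma shared_edge:
  assumes ik: "i < k" and i: "tri i u v w \<or> tri i v u w" and k: "tri k u v w' \<or> tri k v u w'"
  obtains y where "glued k i y" "{u, v} = {l k y, m k y}"
proof -
  obtain s t where st: "u \<in> level i s" "v \<in> level i t" "\<bar>s - t\<bar> \<le> 1"
    using i by (metis tri_level abs_minus_commute)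
  obtain s' t' where st': "u \<in> level k s'" "v \<in> level k t'"
    using k by (metis tri_level)
  note u = shared_point[OF ik st(1) st'(1)] and v = shared_point[OF ik st(2) st'(2)]
  have "s = t" using glued_heights[OF u(2) v(2) st(3)] .
  moreover have "u \<noteq> v" using i tri_distinct by blast
  ultimately show ?thesis using u v that[of s] by auto
qed

text \<open>Before signs are applied, both discs run through a gluing segment in the same direction,
  as at a half twist. Their signs differ, so reversing the negative discs makes the directions
  opposite; this is coherence.\<close>

lemma glued_edge_direction:
  assumes g: "glued k i y" and t: "tri j u v w" and e: "{u, v} = {l k y, m k y}" and j: "j = i \<or> j = k"
  shows "if 0 < y then u = m k y \<and> v = l k y else u = l k y \<and> v = m k y"
proof -
  have uv: "u = m k y \<and> v = l k y \<or> u = l k y \<and> v = m k y" using e by (auto simp: doubleton_eq_iff)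
  have gap: "gap i y" using g by (auto simp: gap_def)
  note k = lohi[OF glued_slab(7)[OF g]]
  show ?thesis
    using g
  proof (cases rule: gluedE)
    case up
    have "slab k (y - 1)" using up k glued_slab(7)[OF g] by (auto simp: slab_def)
    then have "\<not> tri k (l k y) (b k (y - 1)) w"
      using no_reverse(4)[of k "y - 1" w] up by simp
    moreover have "\<not> tri i (a i y) (b i (y - 1)) w" using no_reverse(3)[OF gap] .
    ultimately show ?thesis using uv t j up by auto
  next
    case down
    have "slab k y" using down k glued_slab(7)[OF g] by (auto simp: slab_def)
    then have "\<not> tri k (a k y) (l k y) w" using no_reverse(5)[OF _ down(1)] by blast
    moreover have "\<not> tri i (a i y) (b i (y - 1)) w" using no_reverse(3)[OF gap] .
    ultimately show ?thesis using uv t j down by auto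
  qed
qed

definition otri :: "nat \<Rightarrow> R4 \<Rightarrow> R4 \<Rightarrow> R4 \<Rightarrow> bool" where
  "otri i u v w \<longleftrightarrow> (if sg i then tri i u v w else tri i v u w)"

lemma S_iff: "(u, v, w) \<in> S \<longleftrightarrow> (\<exists>i. otri i u v w)"
proof -
  have "i < n" if "otri i u v w" for i
    using that tri_less unfolding otri_def by (metis (full_types))
  then show ?thesis unfolding S_def otri_def[symmetric] by blast
qed

lemma otri_tri: "otri i u v w \<Longrightarrow> tri i u v w \<or> tri i v u w"
  by (auto simp: otri_def split: if_splits)

lemma otri_rotate: "otri i u v w \<Longrightarrow> otri i v w u"
  unfolding otri_def using tri_rotate by (metis (full_types))

lemma no_common_oriented_edge:
  assumes ik: "i < k" and "otri i u v w" "otri k u v w'"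
  shows False
proof -
  obtain y where y: "glued k i y" "{u, v} = {l k y, m k y}"
    using shared_edge[OF ik] assms otri_tri by metis
  have "sg i \<noteq> sg k" using glued_slab(11)[OF y(1)] by simp
  then have "tri i u v w \<and> tri k v u w' \<or> tri i v u w \<and> tri k u v w'"
    using assms by (auto simp: otri_def split: if_splits)
  moreover have "{v, u} = {l k y, m k y}" using y by (simp add: insert_commute)
  ultimately have "u = v"
    using glued_edge_direction[OF y(1) _ y(2)] glued_edge_direction[OF y(1), of _ v u] by (metis (full_types))
  then show False using assms(2) otri_tri tri_distinct by metis
qed

lemma otri_disc_unique: "otri i u v w \<Longrightarrow> otri k u v w' \<Longrightarrow> i = k"
  using no_common_oriented_edge by (metis linorder_neqE_nat)

lemma S_apex_unique: "(u, v, w) \<in> S \<Longrightarrow> (u, v, w') \<in> S \<Longrightarrow> w = w'"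
proof -
  assume "(u, v, w) \<in> S" "(u, v, w') \<in> S"
  then obtain i k where ik: "otri i u v w" "otri k u v w'" using S_iff by blast
  then have "i = k" by (rule otri_disc_unique)
  then show "w = w'"
    using ik tri_apex_unique[of i u v w w'] tri_apex_unique[of i v u w w']
    by (simp add: otri_def split: if_splits)
qed

text \<open>Such triangles would share two sides with a common vertex. Both sides would be gluing
  segments at the same height, hence equal.\<close>

lemma no_common_triangle:
  assumes ik: "i < k" and i: "otri i u v w" and k: "otri k v u w"
  shows False
proof -
  obtain y where y: "glued k i y" "{u, v} = {l k y, m k y}"
    using shared_edge[OF ik] i k otri_tri by metis
  have "otri i v w u" "otri k w v u" using i k otri_rotate by blast+
  then obtain y' where y': "glued k i y'" "{v, w} = {l k y', m k y'}"
    using shared_edge[OF ik, of v w] otri_tri by metis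
  have d: "u \<noteq> v" "v \<noteq> w" "u \<noteq> w" using i otri_tri tri_distinct by blast+
  have "v \<in> {l k y, m k y}" "v \<in> {l k y', m k y'}" using y y' by blast+
  then have "y = y'" by (auto simp: l_def m_def)
  then have "{u, v} = {v, w}" using y y' by simp
  then show False using d by (auto simp: doubleton_eq_iff)
qed

lemma S_not_swap:
  assumes "(u, v, w) \<in> S"
  shows "(v, u, w) \<notin> S"
proof
  assume "(v, u, w) \<in> S"
  then obtain i k where ik: "otri i u v w" "otri k v u w" using assms S_iff by blast
  have "i \<noteq> k" using ik tri_not_swap unfolding otri_def by (metis (full_types))
  then show False using ik no_common_triangle by (metis linorder_neqE_nat)
qed

lemma finite_S: "finite S"
proof -
  let ?V = "\<Union>i<n. \<Union>y\<in>{lo i..hi i}. {l i y, a i y, b i (y - 1)}"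
  have lev: "level i y \<subseteq> ?V" for i y
    unfolding level_def slab_def by force
  have "S \<subseteq> ?V \<times> ?V \<times> ?V"
  proof
    fix p assume p: "p \<in> S"
    obtain u v w where uvw: "p = (u, v, w)" by (metis prod_cases3)
    then obtain i where "otri i u v w" using p S_iff by blast
    then have "u \<in> ?V" "v \<in> ?V" "w \<in> ?V"
      using lev otri_rotate otri_tri by (meson tri_level subsetD)+
    then show "p \<in> ?V \<times> ?V \<times> ?V" using uvw by simp
  qed
  then show ?thesis by (rule finite_subset) simp
qed

definition link :: "R4 \<Rightarrow> (R4 \<times> R4) set" where
  "link v = {(x, y). (v, x, y) \<in> S} \<union> {(y, x). (v, x, y) \<in> S}"

lemma sym_link: "sym ((link v)\<^sup>*)"
  by (rule sym_rtrancl) (auto simp: link_def sym_def)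

lemma link_tri:
  assumes "tri i v x y"
  shows "(x, y) \<in> link v" "(y, x) \<in> link v"
proof -
  have "tri i y v x" using assms tri_rotate by blast
  then have "(v, x, y) \<in> S \<or> (v, y, x) \<in> S"
    using assms unfolding S_iff otri_def by (metis (full_types))
  then show "(x, y) \<in> link v" "(y, x) \<in> link v" unfolding link_def by blast+
qed

text \<open>Within disc i, the link of a vertex off the left side has a hub: the left vertex at the
  same height.\<close>

lemma link_right:
  assumes "tri i v x x'" "\<And>y. v \<noteq> l i y" "fst (snd v) = real_of_int y"
  shows "(x, l i y) \<in> (link v)\<^sup>*"
  using assms(1)
proof cases
  case (abl y')
  then show ?thesis using link_tri[OF assms(1)] assms(3) by auto
next
  case (bla y')
  then have "y = y' + 1" using assms(3) by simp
  then show ?thesis using link_tri[OF tri.bll[OF bla(4)]] bla by auto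
next
  case (bll y')
  then have "y = y' + 1" using assms(3) by simp
  then show ?thesis using bll by auto
next
  case (bal y')
  then show ?thesis using link_tri[OF assms(1)] assms(3) by auto
next
  case (alb y')
  then show ?thesis using assms(3) by auto
qed (use assms(2) in auto)

text \<open>Within disc i, the hub for a left vertex is the right vertex of its level, taken from
  the slab above if there is one.\<close>

lemma link_left:
  assumes "tri i (l i y) x x'"
  shows "(x, if y < hi i then a i y else b i (y - 1)) \<in> (link (l i y))\<^sup>*"
  using assms
proof cases
  case (lab y')
  then show ?thesis by (simp add: slab_def)
next
  case (lbl y')
  then show ?thesis using link_tri[OF tri.lab[OF lbl(4)]] by (auto simp: slab_def)
next
  case (llb y')
  then have y: "y = y' + 1" by simp
  have 1: "(x, b i (y - 1)) \<in> link (l i y)" using link_tri[OF assms] llb y by auto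
  show ?thesis
  proof (cases "y < hi i")
    case True
    then have "a i y = b i (y - 1) \<or> gap i y"
      using no_gapD[of i y] llb(4) y by (auto simp: slab_def)
    then show ?thesis
    proof
      assume "gap i y"
      then have "(b i (y - 1), a i y) \<in> link (l i y)" by (rule link_tri(1)[OF tri.lba])
      then have "(x, a i y) \<in> (link (l i y))\<^sup>*" using 1 by (meson rtrancl.intros)
      then show ?thesis using True by simp
    qed (use 1 in auto)
  qed (use 1 in auto)
next
  case (lba y')
  then show ?thesis using link_tri[OF assms] gap_bounds[of i y] by auto
qed (auto simp: tri_simps)

text \<open>The other end of the gluing segment, called \<open>o'\<close>, is a neighbour of v in
  both discs and connects the two parts of the link.\<close>

lemma link_cross:
  assumes ik: "i < k" and i: "tri i v x x'" and k: "tri k v z z'"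
  shows "(x, z) \<in> (link v)\<^sup>*"
proof -
  obtain y y' where "v \<in> level i y" "v \<in> level k y'" using i k by (meson tri_level)
  note sh = shared_point[OF ik this]
  have g: "glued k i y" and v: "v = l k y \<or> v = m k y" using sh by auto
  have "v \<noteq> l i y'" for y' using v ik by (auto simp: l_def m_def)
  then have 1: "(x, l i y) \<in> (link v)\<^sup>*" using link_right[OF i] v by auto
  define o' where "o' = (if v = l k y then m k y else l k y)"
  have lm: "l k y \<noteq> m k y" by (simp add: l_def m_def)
  have 2: "(z, o') \<in> (link v)\<^sup>*"
  proof (cases "v = l k y")
    case True
    then have "(z, if y < hi k then a k y else b k (y - 1)) \<in> (link v)\<^sup>*" using link_left k by simp
    moreover have "(if y < hi k then a k y else b k (y - 1)) = m k y"
      using g lohi[OF glued_slab(7)[OF g]] by (cases rule: gluedE) auto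
    ultimately show ?thesis using True by (simp add: o'_def)
  next
    case False
    then have "v = m k y" using v by simp
    moreover have "m k y \<noteq> l k y'" for y' by (simp add: l_def m_def)
    ultimately show ?thesis using link_right[OF k, of y] False by (simp add: o'_def)
  qed
  have gap: "gap i y" using g by (auto simp: gap_def)
  have "{a i y, b i (y - 1)} = {l k y, m k y}" using glued_coords[OF g] by simp
  then have "v = a i y \<and> o' = b i (y - 1) \<or> v = b i (y - 1) \<and> o' = a i y"
    using v lm by (auto simp: o'_def doubleton_eq_iff split: if_splits)
  then have "(l i y, o') \<in> link v" using link_tri[OF tri.alb[OF gap]] link_tri[OF tri.bal[OF gap]] by auto
  then have "(x, o') \<in> (link v)\<^sup>*" using 1 by (rule rtrancl_into_rtrancl[rotated])
  moreover have "(o', z) \<in> (link v)\<^sup>*" using 2 sym_link by (meson symD)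
  ultimately show ?thesis by (rule rtrancl_trans)
qed

lemma link_same:
  assumes i: "tri i v x x'" and k: "tri i v z z'"
  shows "(x, z) \<in> (link v)\<^sup>*"
proof (cases "\<exists>y. v = l i y")
  case True
  then obtain y where "v = l i y" by auto
  then have "\<exists>h. (x, h) \<in> (link v)\<^sup>* \<and> (z, h) \<in> (link v)\<^sup>*" using link_left i k by blast
  then show ?thesis using sym_link by (meson symD rtrancl_trans)
next
  case False
  obtain y where "v \<in> level i y" using i by (meson tri_level)
  then have "fst (snd v) = real_of_int y" by (rule level_height)
  then have "\<exists>h. (x, h) \<in> (link v)\<^sup>* \<and> (z, h) \<in> (link v)\<^sup>*" using link_right i k False by blast
  then show ?thesis using sym_link by (meson symD rtrancl_trans)
qed

lemma S_link:
  assumes "(v, x, x') \<in> S"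
  obtains i p p' where "tri i v p p'" "(x, p) \<in> (link v)\<^sup>*"
proof -
  obtain i where "otri i v x x'" using assms S_iff by blast
  then consider "tri i v x x'" | "tri i v x' x" using otri_tri tri_rotate by blast
  then show ?thesis
  proof cases
    case 1
    then show ?thesis using that by blast
  next
    case 2
    then show ?thesis using that[OF 2] link_tri(2)[OF 2] by blast
  qed
qed

lemma S_link_connected:
  assumes "(v, x, c) \<in> S" "(v, x', c') \<in> S"
  shows "(x, x') \<in> (link v)\<^sup>*"
proof -
  obtain i p q where i: "tri i v p q" "(x, p) \<in> (link v)\<^sup>*" using assms(1) by (rule S_link)
  obtain k r s where k: "tri k v r s" "(x', r) \<in> (link v)\<^sup>*" using assms(2) by (rule S_link)
  consider "i < k" | "k < i" | "i = k" by linarith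
  then have "(p, r) \<in> (link v)\<^sup>*"
  proof cases
    case 1 then show ?thesis using link_cross i k by blast
  next
    case 2 then show ?thesis using link_cross[OF 2 k(1) i(1)] sym_link by (meson symD)
  next
    case 3 then show ?thesis using link_same i k by blast
  qed
  then show ?thesis using i(2) k(2) sym_link by (meson symD rtrancl_trans)
qed

lemma S_triE:
  assumes "(u, v, w) \<in> S"
  obtains i u' v' w' where "tri i u' v' w'" "{u, v, w} = {u', v', w'}"
proof -
  obtain i where "otri i u v w" using assms S_iff by blast
  then consider "tri i u v w" | "tri i v u w" using otri_tri by blast
  then show ?thesis
  proof cases
    case 2
    then show ?thesis by (rule that) blast
  qed (rule that, auto)
qed

lemma S_independent:
  assumes "(u, v, w) \<in> S"
  shows "\<not> affine_dependent {u, v, w}"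
proof -
  obtain i u' v' w' where t: "tri i u' v' w'" and e: "{u, v, w} = {u', v', w'}"
    using assms by (rule S_triE)
  have perm: "{q, r, p} = {p, q, r}" and perm': "{r, q, p} = {p, q, r}" for p q r :: R4 by blast+
  from t show ?thesis unfolding e
  proof (cases rule: tri_cell)
    case (lower y) then show "\<not> affine_dependent {u', v', w'}" using independent_slab_lower by metis
  next
    case (upper y) then show "\<not> affine_dependent {u', v', w'}" using independent_slab_upper perm by metis
  next
    case (glue y k) then show "\<not> affine_dependent {u', v', w'}" using independent_glued perm' by metis
  qed
qed

lemma S_hulls_Int:
  assumes "(u, v, w) \<in> S" "(u', v', w') \<in> S"
  shows "convex hull {u, v, w} \<inter> convex hull {u', v', w'} \<subseteq> convex hull ({u, v, w} \<inter> {u', v', w'})"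
proof -
  obtain i x y z where 1: "tri i x y z" "{u, v, w} = {x, y, z}"
    using assms(1) by (rule S_triE)
  obtain k x' y' z' where 2: "tri k x' y' z'" "{u', v', w'} = {x', y', z'}"
    using assms(2) by (rule S_triE)
  show ?thesis unfolding 1(2) 2(2) by (rule hulls_tri_Int[OF 1(1) 2(1)])
qed

lemma slab_0: "slab 0 0"
  using lohi[of 0] n by (auto simp: slab_def)

sublocale surface: oriented_triangulated_surface S
proof
  show "S \<noteq> {}"
  proof -
    have "otri 0 (l 0 0) (a 0 0) (b 0 0) \<or> otri 0 (a 0 0) (l 0 0) (b 0 0)"
      using tri.lab[OF slab_0] unfolding otri_def by simp
    then show ?thesis using S_iff by (metis empty_iff)
  qed
  show "u \<noteq> v \<and> v \<noteq> w \<and> u \<noteq> w" if "(u, v, w) \<in> S" for u v w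
    using that S_iff otri_tri tri_distinct by metis
  show "triangulation ((\<lambda>(a, b, c). convex hull {a, b, c}) ` S)"
    by (rule triangulation_triplesI[OF finite_S S_independent S_hulls_Int])
  show "(v, w, u) \<in> S" if "(u, v, w) \<in> S" for u v w
    using that S_iff otri_rotate by blast
  show "(b, b') \<in> ({(x, y). (v, x, y) \<in> S} \<union> {(y, x). (v, x, y) \<in> S})\<^sup>*"
    if "(v, b, c) \<in> S" "(v, b', c') \<in> S" for v b c b' c'
    using S_link_connected[OF that] unfolding link_def .
qed (fact S_independent S_not_swap S_apex_unique)+

end

section \<open>Global properties of the strip surface: connectedness, boundary and cell
  count\<close>

section \<open>Surfaces made of strips: boundary and Euler characteristic\<close>

text \<open>The last coordinate is 1 on the chart, so the last coordinate of \<open>sgn p\<close>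
  determines the norm of p and thereby p.\<close>

lemma radial_if_affine_chart:
  assumes "X \<subseteq> {p. snd (snd (snd p)) = 1}"
  shows "radial X"
  unfolding radial_def
proof
  show "0 \<notin> X" using assms by auto
  show "inj_on sgn X"
  proof (rule inj_onI)
    fix p q assume pq: "p \<in> X" "q \<in> X" "sgn p = sgn q"
    then have "snd (snd (snd p)) = 1" "snd (snd (snd q)) = 1" using assms by auto
    moreover have "snd (snd (snd (sgn p))) = snd (snd (snd (sgn q)))" using pq by simp
    ultimately have "norm p = norm q" by (simp add: sgn_div_norm)
    then have "inverse (norm p) *\<^sub>R p = inverse (norm p) *\<^sub>R q" using pq(3) by (simp add: sgn_div_norm)
    moreover have "p \<noteq> 0" using \<open>snd (snd (snd p)) = 1\<close> by auto
    ultimately show "p = q" by simp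
  qed
qed

context strips
begin

lemma tri_hull_subset:
  assumes "tri i u v w"
  shows "convex hull {u, v, w} \<subseteq> surface_support S"
proof -
  have "(u, v, w) \<in> S \<or> (v, u, w) \<in> S" using assms S_iff unfolding otri_def by (metis (full_types))
  then show ?thesis unfolding surface_support_def
  proof
    assume "(v, u, w) \<in> S"
    moreover have "{u, v, w} = {v, u, w}" by blast
    ultimately show "convex hull {u, v, w} \<subseteq> (\<Union>(a, b, c)\<in>S. convex hull {a, b, c})" by auto
  qed auto
qed

lemma tri_connected:
  assumes "tri i u v w" "p \<in> convex hull {u, v, w}" "q \<in> convex hull {u, v, w}"
  shows "connected_component (surface_support S) p q"
  unfolding connected_component_def
  using tri_hull_subset[OF assms(1)] assms(2,3) convex_connected[OF convex_convex_hull] by blast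

lemma left_side_step: "slab i y \<Longrightarrow> connected_component (surface_support S) (l i y) (l i (y + 1))"
  by (rule tri_connected[OF tri.lbl]) (auto intro: hull_inc)

lemma left_side_connected:
  assumes "i < n" "lo i \<le> y" "y \<le> hi i"
  shows "connected_component (surface_support S) (l i 0) (l i y)"
proof -
  let ?c = "connected_component (surface_support S)"
  have "0 < hi i" "lo i < 0" using lohi assms by auto
  then have "slab i 0" using assms by (simp add: slab_def)
  then have refl: "?c (l i 0) (l i 0)"
    using left_side_step connected_component_sym connected_component_trans by blast
  show ?thesis
  proof (cases "0 \<le> y")
    case True
    then show ?thesis using assms(3)
    proof (induction y rule: int_ge_induct)
      case (step z)
      then have "slab i z" using \<open>lo i < 0\<close> assms by (simp add: slab_def)
      then show ?case using step left_side_step connected_component_trans by fastforce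
    qed (use refl in simp)
  next
    case False
    then have "y \<le> 0" by simp
    then show ?thesis using assms(2)
    proof (induction y rule: int_le_induct)
      case (step z)
      then have "slab i (z - 1)" using \<open>0 < hi i\<close> assms by (simp add: slab_def)
      then have "?c (l i z) (l i (z - 1))" using left_side_step[of i "z - 1"] connected_component_sym by fastforce
      then show ?case using step connected_component_trans by fastforce
    qed (use refl in simp)
  qed
qed

lemma glued_top: "0 < k \<Longrightarrow> k < n \<Longrightarrow> glued k (pu k) (hi k)"
  and glued_bottom: "0 < k \<Longrightarrow> k < n \<Longrightarrow> glued k (pd k) (lo k)"
  by (simp_all add: glued_def)

text \<open>Induction along the upper tree: the top of disc i is attached to disc
  \<open>pu i\<close>, which has a smaller index.\<close>

lemma discs_connected: "i < n \<Longrightarrow> connected_component (surface_support S) (l 0 0) (l i 0)"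
proof (induction i rule: less_induct)
  case (less i)
  let ?c = "connected_component (surface_support S)"
  show ?case
  proof (cases "i = 0")
    case True
    then show ?thesis using left_side_connected[of 0 0] lohi[OF less.prems] n by simp
  next
    case False
    then have g: "glued i (pu i) (hi i)" using less.prems glued_top by simp
    have "a (pu i) (hi i) = l i (hi i)"
      using g lohi[OF less.prems] by (cases rule: gluedE) auto
    then have "?c (l (pu i) (hi i)) (l i (hi i))"
      using g by (intro tri_connected[OF tri.lba[of "pu i" "hi i"]]) (auto simp: gap_def intro: hull_inc)
    moreover have "?c (l 0 0) (l (pu i) 0)" using less.IH glued_slab[OF g] by simp
    moreover have "?c (l (pu i) 0) (l (pu i) (hi i))"
      using glued_slab[OF g] by (intro left_side_connected) auto
    moreover have "?c (l i (hi i)) (l i 0)"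
      using left_side_connected[of i "hi i"] lohi[OF less.prems] less.prems connected_component_sym by force
    ultimately show ?thesis by (meson connected_component_trans)
  qed
qed

lemma connected_surface: "connected (surface_support S)"
proof -
  let ?c = "connected_component (surface_support S)"
  have "?c (l 0 0) p" if p: "p \<in> surface_support S" for p
  proof -
    obtain u v w where uvw: "(u, v, w) \<in> S" "p \<in> convex hull {u, v, w}"
      using p unfolding surface_support_def by auto
    obtain i u' v' w' where t: "tri i u' v' w'" and e: "{u, v, w} = {u', v', w'}"
      using uvw(1) by (rule S_triE)
    obtain y where y: "l i y \<in> {u, v, w}" "lo i \<le> y" "y \<le> hi i" "i < n"
      using t
    proof (cases rule: tri_cell)
      case (lower y)
      then show ?thesis using that[of y] e slab_bounds[of i y] by auto
    next
      case (upper y)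
      then show ?thesis using that[of y] e slab_bounds[of i y] by auto
    next
      case (glue y k)
      then show ?thesis using that[of y] e glued_slab[OF glue(1)] by auto
    qed
    have "?c (l i y) p"
      using y(1) uvw(2) unfolding e by (intro tri_connected[OF t]) (auto intro: hull_inc)
    then show ?thesis
      using discs_connected[OF y(4)] left_side_connected[OF y(4,2,3)] by (meson connected_component_trans)
  qed
  then show ?thesis
    unfolding connected_iff_connected_component by (meson connected_component_sym connected_component_trans)
qed

lemma oriented_surface_S: "oriented_surface S"
  unfolding oriented_surface_iff
proof
  show "oriented_triangulated_surface S" by (fact surface.oriented_triangulated_surface_axioms)
  let ?H = "{p :: R4. snd (snd (snd p)) = 1}"
  have H: "convex ?H" by (auto simp: convex_def)
  have lev: "level i y \<subseteq> ?H" for i y by (auto simp: level_def l_def a_def b_def)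
  have "convex hull {u, v, w} \<subseteq> ?H" if uvw: "(u, v, w) \<in> S" for u v w
  proof (rule hull_minimal)
    obtain i u' v' w' where t: "tri i u' v' w'" and e: "{u, v, w} = {u', v', w'}"
      using uvw by (rule S_triE)
    show "{u, v, w} \<subseteq> ?H" unfolding e using t
    proof (cases rule: tri_levels)
      case (1 s t)
      then show "{u', v', w'} \<subseteq> ?H" using lev by blast
    next
      case (2 s)
      then show "{u', v', w'} \<subseteq> ?H" using lev by blast
    qed
  qed (fact H)
  then have "surface_support S \<subseteq> ?H" unfolding surface_support_def by blast
  then show "radial (surface_support S)" by (rule radial_if_affine_chart)
qed

text \<open>Only disc 0 has a cap and a cup; the ends of every other disc are gluing
  segments.\<close>

inductive outer :: "nat \<Rightarrow> R4 \<Rightarrow> R4 \<Rightarrow> bool" for i where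
  right: "slab i y \<Longrightarrow> outer i (a i y) (b i y)"
| left: "slab i y \<Longrightarrow> outer i (l i (y + 1)) (l i y)"
| cap: "i = 0 \<Longrightarrow> outer i (b i (hi i - 1)) (l i (hi i))"
| cup: "i = 0 \<Longrightarrow> outer i (l i (lo i)) (a i (lo i))"

lemma slab_top: "i < n \<Longrightarrow> slab i (hi i - 1)" and slab_bottom: "i < n \<Longrightarrow> slab i (lo i)"
  using lohi[of i] by (auto simp: slab_def)

lemma outer_tri:
  assumes "outer i u v"
  shows "\<exists>w. tri i u v w"
  using assms
proof cases
  case (right y)
  then show ?thesis using tri.abl by blast
next
  case (left y)
  then show ?thesis using tri.llb by blast
next
  case cap
  then have "tri i (b i (hi i - 1)) (l i (hi i)) (l i (hi i - 1))"
    using tri.bll[OF slab_top[of i]] n by simp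
  then show ?thesis using cap by blast
next
  case cup
  then have "tri i (l i (lo i)) (a i (lo i)) (b i (lo i))"
    using tri.lab[OF slab_bottom[of i]] n by simp
  then show ?thesis using cup by blast
qed

lemma outer_no_reverse: "outer i u v \<Longrightarrow> \<not> tri i v u w"
  by (erule outer.cases)
    (use no_reverse(1,2)[of i] no_reverse(4)[OF slab_top, of i] no_reverse(5)[OF slab_bottom, of i] n in auto)

text \<open>The ends of a gluing segment have equal height and x = 2 c with c > 0. An outer edge
  changes height or has an end with x = 0.\<close>

lemma outer_not_shared:
  assumes o: "outer i u v" and k: "k \<noteq> i"
  shows "\<not> (tri k u v w \<or> tri k v u w)"
proof
  assume t: "tri k u v w \<or> tri k v u w"
  obtain w' where t': "tri i u v w'" using outer_tri[OF o] by auto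
  obtain c y where y: "0 < c" "{u, v} = {l c y, m c y}"
  proof (cases "i < k")
    case True
    then show ?thesis using shared_edge[OF True, of u v w' w] t t' glued_slab(8) that by metis
  next
    case False
    then have ki: "k < i" using k by simp
    then show ?thesis using shared_edge[OF ki, of u v w w'] t t' glued_slab(8) that by metis
  qed
  then have h: "fst (snd u) = fst (snd v)" "fst u = 2 * real c" "fst v = 2 * real c"
    by (auto simp: doubleton_eq_iff l_def m_def)
  from o show False using h y(1) by cases (auto simp: l_def)
qed

text \<open>A side of a triangle lies on the rim of the surface, inside its disc, or on a gluing
  segment. In the last case the disc beyond it has the other sign and the same direction before
  signs are applied.\<close>

lemma tri_outer_or_reverse:
  assumes "tri i u v w"
  shows "outer i u v \<or> (\<exists>k w'. (sg k = sg i \<and> tri k v u w') \<or> (sg k \<noteq> sg i \<and> tri k u v w'))"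
proof -
  have same: ?thesis if "tri i v u w'" for w' using that by blast
  have other: ?thesis if "tri k u v w'" "sg k \<noteq> sg i" for k w' using that by blast
  from assms show ?thesis
  proof cases
    case (lab y)
    note uv = lab(1,2) and sl = lab(4)
    show ?thesis
    proof (cases "y = lo i")
      case True
      show ?thesis
      proof (cases "i = 0")
        case True
        have "outer i u v" unfolding uv \<open>y = lo i\<close> by (rule outer.cup[OF True])
        then show ?thesis ..
      next
        case False
        then have g: "glued i (pd i) y" using True glued_bottom slab_bounds[OF sl] by simp
        have "b (pd i) (y - 1) = u" "a (pd i) y = v"
          using g lohi[of i] slab_bounds[OF sl] True unfolding uv by (cases rule: gluedE; simp)+
        moreover have "tri (pd i) (b (pd i) (y - 1)) (a (pd i) y) (l (pd i) y)"
          using g by (intro tri.bal) (auto simp: gap_def)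
        ultimately show ?thesis using glued_slab(11)[OF g] by (intro other) auto
      qed
    next
      case False
      then have sl': "slab i (y - 1)" "lo i < y" using sl by (auto simp: slab_def)
      then have "a i y = b i (y - 1) \<or> gap i y" using no_gapD slab_bounds[OF sl] by blast
      then show ?thesis
      proof
        assume "a i y = b i (y - 1)"
        then show ?thesis using tri.bll[OF sl'(1)] uv by (intro same) simp
      next
        assume "gap i y"
        then show ?thesis using tri.alb[of i y] uv by (intro same) simp
      qed
    qed
  next
    case (bll y)
    note uv = bll(1,2) and sl = bll(4)
    show ?thesis
    proof (cases "y + 1 = hi i")
      case True
      show ?thesis
      proof (cases "i = 0")
        case True
        have "y = hi i - 1" using \<open>y + 1 = hi i\<close> by simp
        then have "outer i u v" using outer.cap[OF True] uv by simp
        then show ?thesis ..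
      next
        case False
        then have g: "glued i (pu i) (y + 1)" using True glued_top slab_bounds[OF sl] by simp
        have pos: "0 < y + 1" using lohi[of i] slab_bounds[OF sl] True by simp
        from g have "b (pu i) y = u \<and> a (pu i) (y + 1) = v"
        proof (cases rule: gluedE)
          case up
          then show ?thesis unfolding uv by (metis add_diff_cancel_right')
        next
          case down
          then show ?thesis using pos by linarith
        qed
        moreover have "tri (pu i) (b (pu i) y) (a (pu i) (y + 1)) (l (pu i) (y + 1))"
          using g tri.bal[of "pu i" "y + 1"] by (auto simp: gap_def)
        ultimately show ?thesis using glued_slab(11)[OF g] by (intro other) auto
      qed
    next
      case False
      then have sl': "slab i (y + 1)" using sl by (auto simp: slab_def)
      then have "a i (y + 1) = b i y \<or> gap i (y + 1)"
        using no_gapD[of i "y + 1"] slab_bounds[OF sl] slab_bounds[OF sl'] by simp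
      then show ?thesis
      proof
        assume "a i (y + 1) = b i y"
        then show ?thesis using tri.lab[OF sl'] uv by (intro same) simp
      next
        assume "gap i (y + 1)"
        then show ?thesis using tri.lba[of i "y + 1"] uv by (intro same) simp
      qed
    qed
  next
    case (bal y)
    note uv = bal(1,2)
    from bal(4) obtain k where g: "glued k i y" by (auto simp: gap_def)
    note k = lohi[OF glued_slab(7)[OF g]] and sg = glued_slab(11)[OF g]
    from g show ?thesis
    proof (cases rule: gluedE)
      case up
      have "slab k (y - 1)" using up k glued_slab(7)[OF g] by (auto simp: slab_def)
      then show ?thesis using tri.bll[of k "y - 1"] up sg uv by (intro other) auto
    next
      case down
      have "slab k y" using down(1) k glued_slab(7)[OF g] by (auto simp: slab_def)
      from tri.lab[OF this] have "tri k u v (b k y)" using uv down(4-6) by simp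
      then show ?thesis using sg by (intro other)
    qed
  next
    case (abl y)
    then show ?thesis using outer.right by simp
  next
    case (bla y)
    then show ?thesis using tri.lbl by (intro same) simp
  next
    case (lbl y)
    then show ?thesis using tri.bla by (intro same) simp
  next
    case (llb y)
    then show ?thesis using outer.left by simp
  next
    case (lba y)
    then show ?thesis using tri.bll[OF gapD(2)] by (intro same) force
  next
    case (alb y)
    then show ?thesis using tri.lab[OF gapD(1)] by (intro same) simp
  qed
qed

lemma oriented_boundary_S:
  "(u, v) \<in> oriented_boundary S \<longleftrightarrow> (\<exists>i. if sg i then outer i u v else outer i v u)"
proof
  assume "(u, v) \<in> oriented_boundary S"
  then obtain i w where i: "otri i u v w" and no: "\<And>k w. \<not> otri k v u w"
    unfolding oriented_boundary_def S_iff by blast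
  have "\<not> (sg k \<and> tri k v u w \<or> \<not> sg k \<and> tri k u v w)" for k w 
    using no[of k w] unfolding otri_def by (cases "sg k") simp_all
  then show "\<exists>i. if sg i then outer i u v else outer i v u"
    using i tri_outer_or_reverse[of i u v w] tri_outer_or_reverse[of i v u w] unfolding otri_def
    by (metis (full_types))
next
  assume "\<exists>i. if sg i then outer i u v else outer i v u"
  then obtain i where i: "if sg i then outer i u v else outer i v u" by auto
  then obtain w where "otri i u v w" using outer_tri unfolding otri_def by (metis (full_types))
  moreover have "\<not> otri k v u w" for k w
  proof (cases "k = i")
    case True
    then show ?thesis using i outer_no_reverse unfolding otri_def by (metis (full_types))
  next
    case False
    then show ?thesis using i outer_not_shared otri_tri by (metis (full_types))
  qed
  ultimately show "(u, v) \<in> oriented_boundary S" unfolding oriented_boundary_def S_iff by blast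
qed

text \<open>Every slab triangle owns a non-horizontal boundary edge. Besides these triangles there
  are at most 2 (n - 1) gluing triangles, and two boundary edges are horizontal. Hence F \<le> (B -
  2) + 2 (n - 1), so 2 \<chi> \<ge> B - F \<ge> 4 - 2 n.\<close>

lemma euler_characteristic_S: "2 - int n \<le> euler_characteristic S"
proof -
  let ?B = "oriented_boundary S"
  \<comment> \<open>The cap and the cup of disc 0. Their triangles already own another boundary
    edge, so these two edges are discounted.\<close>
  let ?e1 = "(b 0 (hi 0 - 1), l 0 (hi 0))" and ?e2 = "(l 0 (lo 0), a 0 (lo 0))"
  let ?C = "{(u, v, w). (u, v, w) \<in> S \<and> (u, v) \<in> ?B - {?e1, ?e2}}"
  \<comment> \<open>Two gluing triangles for each k > 0; the Boolean selects the upper or the lower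
    one.\<close>
  let ?g = "\<lambda>(k, t). if t then {l (pu k) (hi k), b (pu k) (hi k - 1), a (pu k) (hi k)}
     else {l (pd k) (lo k), b (pd k) (lo k - 1), a (pd k) (lo k)}"
  have B: "surface.boundary = ?B" by (simp add: surface.boundary_def oriented_boundary_def)
  then have fB: "finite ?B" using surface.finite_boundary by simp
  have e: "?e1 \<in> ?B" "?e2 \<in> ?B"
    using outer.cap[of 0] outer.cup[of 0] sg_0 unfolding oriented_boundary_S by (metis (full_types))+
  have "fst (snd (l 0 (lo 0))) \<noteq> fst (snd (b 0 (hi 0 - 1)))" using lohi[OF n] by simp
  then have "?e1 \<noteq> ?e2" by (metis prod.inject)
  have cB: "card (?B - {?e1, ?e2}) + 2 = card ?B"
  proof -
    have "card {?e1, ?e2} = 2" using \<open>?e1 \<noteq> ?e2\<close> by simp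
    moreover have "{?e1, ?e2} \<subseteq> ?B" using e by simp
    ultimately show ?thesis using fB card_Diff_subset[of "{?e1, ?e2}" ?B] card_mono[of ?B "{?e1, ?e2}"] by simp
  qed
  have fC: "finite ?C" by (rule finite_subset[OF _ finite_S]) auto
  have "card ?C \<le> card (?B - {?e1, ?e2})"
  proof (rule card_inj_on_le[of "\<lambda>(u, v, w). (u, v)"])
    show "inj_on (\<lambda>(u, v, w). (u, v)) ?C"
    proof (rule inj_onI)
      fix p q assume pq: "p \<in> ?C" "q \<in> ?C" "(\<lambda>(u, v, w). (u, v)) p = (\<lambda>(u, v, w). (u, v)) q"
      obtain u v w u' v' w' where "p = (u, v, w)" "q = (u', v', w')" by (metis prod_cases3)
      then show "p = q" using pq S_apex_unique[of u v w w'] by simp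
    qed
  qed (use fB in auto)
  have flat: "(u, v) \<notin> {?e1, ?e2}" if "fst (snd u) \<noteq> fst (snd v)" for u v using that by auto
  have outC: "{u, v, w} \<in> (\<lambda>(u, v, w). {u, v, w}) ` ?C"
    if "outer i u v" "tri i u v w" "fst (snd u) \<noteq> fst (snd v)" for i u v w
  proof (cases "sg i")
    case True
    then have "(u, v) \<in> ?B" "(u, v, w) \<in> S"
      using that(1,2) oriented_boundary_S S_iff unfolding otri_def by (metis (full_types))+
    then have "(u, v, w) \<in> ?C" using flat[of u v] that(3) by simp
    then show ?thesis by (intro image_eqI[of _ _ "(u, v, w)"]) auto
  next
    case False
    then have "(v, u) \<in> ?B" "(v, u, w) \<in> S"
      using that(1,2) oriented_boundary_S S_iff unfolding otri_def by (metis (full_types))+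
    then have "(v, u, w) \<in> ?C" using flat[of v u] that(3) by simp
    then show ?thesis by (intro image_eqI[of _ _ "(v, u, w)"]) auto
  qed
  have "surface.triangles \<subseteq> (\<lambda>(u, v, w). {u, v, w}) ` ?C \<union> ?g ` ({1..<n} \<times> UNIV)"
  proof
    fix T assume "T \<in> surface.triangles"
    then obtain u v w where uvw: "(u, v, w) \<in> S" "T = {u, v, w}" unfolding surface.triangles_def by auto
    obtain i u' v' w' where t: "tri i u' v' w'" and e: "{u, v, w} = {u', v', w'}"
      using uvw(1) by (rule S_triE)
    show "T \<in> (\<lambda>(u, v, w). {u, v, w}) ` ?C \<union> ?g ` ({1..<n} \<times> UNIV)"
      using t
    proof (cases rule: tri_cell)
      case (lower y)
      have "T = {a i y, b i y, l i y}" unfolding uvw e lower by blast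
      then show ?thesis using outC[OF outer.right tri.abl] lower(1) by simp
    next
      case (upper y)
      have "T = {l i (y + 1), l i y, b i y}" unfolding uvw e upper by blast
      then show ?thesis using outC[OF outer.left tri.llb] upper(1) by simp
    next
      case (glue y k)
      have T: "T = {l i y, b i (y - 1), a i y}" unfolding uvw e glue ..
      have k: "k \<in> {1..<n}" using glued_slab[OF glue(1)] by auto
      have "T = ?g (k, True) \<or> T = ?g (k, False)"
        using glue(1) T by (auto simp: glued_def)
      then show ?thesis using k by blast
    qed
  qed
  then have "card surface.triangles \<le> card ((\<lambda>(u, v, w). {u, v, w}) ` ?C \<union> ?g ` ({1..<n} \<times> UNIV))"
    by (rule card_mono[rotated]) (use fC in auto)
  also have "\<dots> \<le> card ((\<lambda>(u, v, w). {u, v, w}) ` ?C) + card (?g ` ({1..<n} \<times> UNIV))"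
    by (rule card_Un_le)
  also have "\<dots> \<le> card ?C + card ({1..<n} \<times> (UNIV :: bool set))"
    by (intro add_mono card_image_le) (use fC in auto)
  also have "\<dots> \<le> card (?B - {?e1, ?e2}) + 2 * (n - 1)"
    using \<open>card ?C \<le> _\<close> by (simp add: card_cartesian_product)
  finally have "card surface.triangles + 4 \<le> card ?B + 2 * n" using cB n by linarith
  then have "4 - 2 * int n \<le> int (card surface.boundary) - int (card surface.triangles)" using B by simp
  also have "\<dots> \<le> 2 * surface.euler" by (rule surface.euler_characteristic_ge)
  also have "surface.euler = euler_characteristic S"
    by (simp add: surface.euler_def euler_characteristic_def surface.vertices_def surface.edges_def surface.triangles_def)
  finally show ?thesis by simp
qed

end

section \<open>Laminarity of dyadic intervals and its consequences for the tree and its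
  signs\<close>

section \<open>Standard dyadic intervals and signed trees\<close>

lemma sd_interval_bounds: "sd_interval a b \<Longrightarrow> 0 \<le> a \<and> a < b \<and> b \<le> 1"
proof -
  assume "sd_interval a b"
  then obtain k m :: nat where km: "k < 2 ^ m" "a = real k / 2 ^ m" "b = real (k + 1) / 2 ^ m"
    unfolding sd_interval_def by auto
  have "real (k + 1) \<le> 2 ^ m" using km(1) by (metis Suc_eq_plus1 Suc_leI of_nat_le_iff of_nat_numeral of_nat_power)
  then show ?thesis unfolding km(2,3) by (simp add: divide_simps)
qed

lemma sd_interval_unit: "sd_interval 0 1"
  unfolding sd_interval_def by (rule exI[of _ 0], rule exI[of _ 0]) simp

text \<open>Over the finer denominator \<open>2 ^ (m + e)\<close> all endpoints become integers, and
  the claim is linear arithmetic.\<close>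

lemma dyadic_nested_or_disjoint:
  fixes k k' m e :: nat
  shows "real (k' + 1) / 2 ^ (m + e) \<le> real k / 2 ^ m \<or> real (k + 1) / 2 ^ m \<le> real k' / 2 ^ (m + e) \<or>
    (k * 2 ^ e \<le> k' \<and> k' < (k + 1) * 2 ^ e \<and>
     real k / 2 ^ m \<le> real k' / 2 ^ (m + e) \<and> real (k' + 1) / 2 ^ (m + e) \<le> real (k + 1) / 2 ^ m)"
proof -
  have scale: "real j / 2 ^ m = real (j * 2 ^ e) / 2 ^ (m + e)" for j
    by (simp add: power_add)
  have le: "real i / 2 ^ (m + e) \<le> real j / 2 ^ (m + e) \<longleftrightarrow> i \<le> j" for i j
    by (simp add: divide_le_cancel)
  show ?thesis unfolding scale le by linarith
qed

lemma sd_interval_cases: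
  assumes "sd_interval a b" "sd_interval c d"
  shows "b \<le> c \<or> d \<le> a \<or> (a \<le> c \<and> d \<le> b) \<or> (c \<le> a \<and> b \<le> d)"
proof -
  obtain k m :: nat where 1: "a = real k / 2 ^ m" "b = real (k + 1) / 2 ^ m"
    using assms(1) unfolding sd_interval_def by blast
  obtain k' m' :: nat where 2: "c = real k' / 2 ^ m'" "d = real (k' + 1) / 2 ^ m'"
    using assms(2) unfolding sd_interval_def by blast
  consider e where "m' = m + e" | e where "m = m' + e" by (metis le_Suc_ex linear)
  then show ?thesis
  proof cases
    case 1
    then show ?thesis using dyadic_nested_or_disjoint[of k' m e k] \<open>a = _\<close> \<open>b = _\<close> 2 by auto
  next
    case (2 e)
    then show ?thesis using dyadic_nested_or_disjoint[of k m' e k'] 1 \<open>c = _\<close> \<open>d = _\<close> by auto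
  qed
qed

lemma sd_interval_halves:
  assumes "sd_interval a b"
  shows "sd_interval a ((a + b) / 2)" "sd_interval ((a + b) / 2) b"
proof -
  obtain k m :: nat where km: "k < 2 ^ m" "a = real k / 2 ^ m" "b = real (k + 1) / 2 ^ m"
    using assms unfolding sd_interval_def by blast
  have "2 * k < 2 ^ (m + 1)" "2 * k + 1 < 2 ^ (m + 1)" using km(1) by auto
  moreover have "a = real (2 * k) / 2 ^ (m + 1)" "(a + b) / 2 = real (2 * k + 1) / 2 ^ (m + 1)"
    "b = real (2 * k + 1 + 1) / 2 ^ (m + 1)"
    using km by (auto simp: field_simps)
  ultimately show "sd_interval a ((a + b) / 2)" "sd_interval ((a + b) / 2) b"
    unfolding sd_interval_def by blast+
qed

lemma sd_subinterval:
  assumes "sd_interval a b" "sd_interval c d" "a \<le> c" "d \<le> b"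
  obtains k m k' e :: nat where "k < 2 ^ m" "a = real k / 2 ^ m" "b = real (k + 1) / 2 ^ m"
    "c = real k' / 2 ^ (m + e)" "d = real (k' + 1) / 2 ^ (m + e)" "k * 2 ^ e \<le> k'" "k' < (k + 1) * 2 ^ e"
proof -
  obtain k m :: nat where 1: "k < 2 ^ m" "a = real k / 2 ^ m" "b = real (k + 1) / 2 ^ m"
    using assms(1) unfolding sd_interval_def by blast
  obtain k' m' :: nat where 2: "c = real k' / 2 ^ m'" "d = real (k' + 1) / 2 ^ m'"
    using assms(2) unfolding sd_interval_def by blast
  have "d - c = 1 / 2 ^ m'" "b - a = 1 / 2 ^ m"
    unfolding 1(2,3) 2 by (simp_all flip: diff_divide_distrib)
  then have "1 / (2::real) ^ m' \<le> 1 / 2 ^ m" using assms by linarith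
  then have "(2::real) ^ m \<le> 2 ^ m'" by (simp add: divide_simps)
  then have "m \<le> m'" by simp
  then obtain e where e: "m' = m + e" using le_Suc_ex by blast
  have "a < b" "c < d" using assms(1,2) sd_interval_bounds by auto
  then have "k * 2 ^ e \<le> k' \<and> k' < (k + 1) * 2 ^ e"
    using dyadic_nested_or_disjoint[of k' m e k] assms(3,4) 1 2 unfolding e by auto
  then show ?thesis using that[OF 1] 2 e by blast
qed

text \<open>A proper subinterval has e > 0, so the midpoint is a point of the finer mesh and cannot
  lie strictly inside one of its cells.\<close>

lemma sd_subinterval_in_half:
  assumes "sd_interval a b" "sd_interval c d" "a \<le> c" "d \<le> b" "\<not> (c = a \<and> d = b)"
  shows "d \<le> (a + b) / 2 \<or> (a + b) / 2 \<le> c"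
proof -
  obtain k m k' e :: nat where *: "k < 2 ^ m" "a = real k / 2 ^ m" "b = real (k + 1) / 2 ^ m"
    "c = real k' / 2 ^ (m + e)" "d = real (k' + 1) / 2 ^ (m + e)" "k * 2 ^ e \<le> k'" "k' < (k + 1) * 2 ^ e"
    using sd_subinterval[OF assms(1-4)] by blast
  have "e \<noteq> 0"
  proof
    assume "e = 0"
    then have "k' = k" using * by simp
    then show False using * \<open>e = 0\<close> assms(5) by simp
  qed
  then obtain e' where e: "e = Suc e'" by (cases e) auto
  have mid: "(a + b) / 2 = real ((2 * k + 1) * 2 ^ e') / 2 ^ (m + e)"
    unfolding *(2,3) e by (simp add: power_add field_simps)
  have le: "real i / 2 ^ (m + e) \<le> real j / 2 ^ (m + e) \<longleftrightarrow> i \<le> j" for i j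
    by (simp add: divide_le_cancel)
  show ?thesis unfolding *(4,5) mid le by linarith
qed

text \<open>The affine bijection between two s.d. intervals scales by a power of 2 and preserves the
  mesh of relative depth e.\<close>

lemma sd_interval_affine_image:
  assumes "sd_interval a b" "sd_interval c d" "a \<le> c" "d \<le> b" and "sd_interval a' b'"
  defines "f \<equiv> \<lambda>x. a' + (x - a) * (b' - a') / (b - a)"
  shows "sd_interval (f c) (f d)"
proof -
  obtain k m k' e :: nat where *: "k < 2 ^ m" "a = real k / 2 ^ m" "b = real (k + 1) / 2 ^ m"
    "c = real k' / 2 ^ (m + e)" "d = real (k' + 1) / 2 ^ (m + e)" "k * 2 ^ e \<le> k'" "k' < (k + 1) * 2 ^ e"
    using sd_subinterval[OF assms(1-4)] by blast
  obtain j p :: nat where jp: "j < 2 ^ p" "a' = real j / 2 ^ p" "b' = real (j + 1) / 2 ^ p"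
    using assms(5) unfolding sd_interval_def by blast
  \<comment> \<open>The cell number inside \<open>[a, b]\<close>, which is
    \<open>k' - k * 2 ^ e\<close>, is kept inside \<open>[a', b']\<close>.\<close>
  let ?K = "j * 2 ^ e + (k' - k * 2 ^ e)"
  have K: "real ?K = real j * 2 ^ e + real k' - real k * 2 ^ e" using *(6) by (simp add: of_nat_diff)
  then have K': "real (?K + 1) = real j * 2 ^ e + real k' - real k * 2 ^ e + 1" by simp
  have ba: "b - a = 1 / 2 ^ m" "b' - a' = 1 / 2 ^ p"
    unfolding *(2,3) jp by (simp_all flip: diff_divide_distrib)
  have f: "f x = a' + (x - a) * 2 ^ m / 2 ^ p" for x unfolding f_def ba by simp
  have "f c = real ?K / 2 ^ (p + e)"
    unfolding K f unfolding * jp by (simp add: power_add field_simps)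
  moreover have "f d = real (?K + 1) / 2 ^ (p + e)"
    unfolding K' f unfolding * jp by (simp add: power_add field_simps)
  moreover have "?K < 2 ^ (p + e)"
  proof -
    have "?K < j * 2 ^ e + 2 ^ e" using *(6,7) by (simp add: algebra_simps)
    also have "\<dots> = (j + 1) * 2 ^ e" by simp
    also have "\<dots> \<le> 2 ^ p * 2 ^ e" using jp(1) by (intro mult_right_mono) auto
    finally show ?thesis by (simp add: power_add)
  qed
  ultimately show ?thesis unfolding sd_interval_def by blast
qed

locale partition_tree =
  fixes I :: "real list"
  assumes partition: "sd_partition I"
begin

abbreviation "N \<equiv> leaves I"
abbreviation "T \<equiv> tree_edges I"

lemma N_pos: "0 < N" and length_I: "length I = Suc N"
proof -
  have I: "I \<noteq> []" "hd I = 0" "last I = 1" using partition unfolding sd_partition_def by auto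
  then show "length I = Suc N" by (cases I) (auto simp: leaves_def)
  show "0 < N"
  proof (rule ccontr)
    assume "\<not> 0 < N"
    then have "length I = 1" using I by (cases I) (auto simp: leaves_def)
    then show False using I by (cases I) auto
  qed
qed

lemma ends: "I ! 0 = 0" "I ! N = 1"
  using partition unfolding sd_partition_def leaves_def by (auto simp: hd_conv_nth last_conv_nth)

lemma nth_less: "i < j \<Longrightarrow> j \<le> N \<Longrightarrow> I ! i < I ! j"
  using partition length_I unfolding sd_partition_def by (auto simp: sorted_wrt_iff_nth_less)

lemma nth_less_iff: "i \<le> N \<Longrightarrow> j \<le> N \<Longrightarrow> I ! i < I ! j \<longleftrightarrow> i < j"
  using nth_less by (metis linorder_neqE_nat order_less_asym)

lemma nth_le_iff: "i \<le> N \<Longrightarrow> j \<le> N \<Longrightarrow> I ! i \<le> I ! j \<longleftrightarrow> i \<le> j"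
  using nth_less_iff by (metis linorder_not_le)

lemma nth_eq_iff: "i \<le> N \<Longrightarrow> j \<le> N \<Longrightarrow> I ! i = I ! j \<longleftrightarrow> i = j"
  using nth_less by (metis linorder_neqE_nat order_less_irrefl)

lemma edge_iff: "(i, j) \<in> T \<longleftrightarrow> i < j \<and> j \<le> N \<and> sd_interval (I ! i) (I ! j)"
  by (auto simp: tree_edges_def length_I)

lemma root_edge: "(0, N) \<in> T"
  using N_pos sd_interval_unit by (simp add: edge_iff ends)

lemma leaf_edge: "i < N \<Longrightarrow> (i, Suc i) \<in> T"
  using partition length_I unfolding sd_partition_def by (auto simp: edge_iff)

lemma splitsD:
  assumes "splits I i k j"
  shows "(i, j) \<in> T" "i < k" "k < j" "j \<le> N" "I ! k = (I ! i + I ! j) / 2" "(i, k) \<in> T" "(k, j) \<in> T"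
proof -
  show *: "(i, j) \<in> T" "i < k" "k < j" "I ! k = (I ! i + I ! j) / 2" using assms by (auto simp: splits_def)
  then show "j \<le> N" by (simp add: edge_iff)
  have sd: "sd_interval (I ! i) (I ! k)" "sd_interval (I ! k) (I ! j)"
    unfolding *(4) using sd_interval_halves *(1) edge_iff by blast+
  have "k \<le> N" using *(3) \<open>j \<le> N\<close> by simp
  then show "(i, k) \<in> T" "(k, j) \<in> T" using *(2,3) \<open>j \<le> N\<close> sd unfolding edge_iff by blast+
qed

text \<open>The leaf that contains the midpoint, closed on the left, is smaller than the edge and so
  lies in one half. Its left end is therefore the midpoint.\<close>

lemma edge_splits:
  assumes "(i, j) \<in> T" "Suc i < j"
  shows "\<exists>k. splits I i k j"
proof -
  have ij: "j \<le> N" "sd_interval (I ! i) (I ! j)" using assms by (auto simp: edge_iff)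
  define mid where "mid = (I ! i + I ! j) / 2"
  have mid: "I ! i < mid" "mid < I ! j" using nth_less[of i j] assms ij by (auto simp: mid_def)
  define t where "t = (LEAST t. mid < I ! t)"
  have t: "mid < I ! t" "t \<le> j" unfolding t_def using mid by (auto intro: LeastI Least_le)
  have "i < t"
  proof (rule ccontr)
    assume "\<not> i < t"
    then have "I ! t \<le> I ! i" using nth_le_iff[of t i] t ij assms by simp
    then show False using t mid by simp
  qed
  then obtain r where r: "t = Suc r" "i \<le> r" by (cases t) auto
  have "\<not> mid < I ! r" using not_less_Least[of r "\<lambda>t. mid < I ! t"] r unfolding t_def by simp
  then have le: "I ! r \<le> mid" by simp
  have "sd_interval (I ! r) (I ! t)" using leaf_edge[of r] r t ij by (simp add: edge_iff)
  moreover have "I ! i \<le> I ! r" "I ! t \<le> I ! j" using nth_le_iff r t ij by auto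
  moreover have "\<not> (I ! r = I ! i \<and> I ! t = I ! j)"
    using nth_eq_iff[of r i] nth_eq_iff[of t j] r t ij assms by auto
  ultimately have "I ! t \<le> mid \<or> mid \<le> I ! r"
    using sd_subinterval_in_half[OF ij(2)] unfolding mid_def by blast
  then have "I ! r = mid" using t le by simp
  moreover have "i < r" using \<open>I ! r = mid\<close> mid r by (metis le_neq_implies_less less_irrefl)
  ultimately have "splits I i r j" using assms r t by (simp add: splits_def mid_def)
  then show ?thesis ..
qed

lemma edges_laminar:
  assumes "(i, j) \<in> T" "(p, q) \<in> T"
  shows "j \<le> p \<or> q \<le> i \<or> (i \<le> p \<and> q \<le> j) \<or> (p \<le> i \<and> j \<le> q)"
  using sd_interval_cases[of "I ! i" "I ! j" "I ! p" "I ! q"] assms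
    nth_le_iff[of j p] nth_le_iff[of q i] nth_le_iff[of i p] nth_le_iff[of q j] nth_le_iff[of p i] nth_le_iff[of j q]
  by (simp add: edge_iff)

lemma edge_in_half:
  assumes s: "splits I i k j" and e: "(p, q) \<in> T" "i \<le> p" "q \<le> j" "(p, q) \<noteq> (i, j)"
  shows "q \<le> k \<or> k \<le> p"
proof -
  note s = splitsD[OF s]
  have "I ! q \<le> I ! k \<or> I ! k \<le> I ! p"
  proof (rule sd_subinterval_in_half[of "I ! i" "I ! j" "I ! p" "I ! q", folded s(5)])
    show "sd_interval (I ! i) (I ! j)" "sd_interval (I ! p) (I ! q)" using s e by (auto simp: edge_iff)
    show "I ! i \<le> I ! p" "I ! q \<le> I ! j" "\<not> (I ! p = I ! i \<and> I ! q = I ! j)"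
      using s(2-4) e nth_le_iff[of i p] nth_le_iff[of q j] nth_eq_iff[of p i] nth_eq_iff[of q j]
      by (auto simp: edge_iff)
  qed
  then show ?thesis using s(2-4) e nth_le_iff[of q k] nth_le_iff[of k p] by (auto simp: edge_iff)
qed

lemma split_unique: "splits I i k j \<Longrightarrow> splits I i k' j \<Longrightarrow> k = k'"
  using splitsD(3-5)[of i k j] splitsD(3,5)[of i k' j] nth_eq_iff[of k k'] by simp

text \<open>Descent from the root: each split happens at k or leaves k in the interior of one
  half.\<close>

lemma split_parent_ex:
  assumes "0 < k" "k < N"
  obtains i j where "splits I i k j"
proof -
  have "\<exists>p q. splits I p k q" if "(i, j) \<in> T" "i < k" "k < j" for i j
    using that
  proof (induction "j - i" arbitrary: i j rule: less_induct)
    case less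
    obtain m where m: "splits I i m j" using edge_splits[of i j] less.prems by auto
    note md = splitsD[OF m]
    consider "m = k" | "k < m" | "m < k" by linarith
    then show ?case
    proof cases
      case 1 then show ?thesis using m by blast
    next
      case 2 then show ?thesis using less.hyps[of m i] md less.prems by auto
    next
      case 3 then show ?thesis using less.hyps[of j m] md less.prems by auto
    qed
  qed
  then show ?thesis using assms root_edge that by blast
qed

text \<open>Laminarity makes one of the two edges contain the other. A proper subedge lies in one
  half and cannot have the midpoint in its interior.\<close>

lemma split_parent_unique:
  assumes "splits I i k j" "splits I p k q"
  shows "p = i \<and> q = j"
proof (rule ccontr)
  assume neq: "\<not> (p = i \<and> q = j)"
  note s = splitsD[OF assms(1)] and t = splitsD[OF assms(2)]
  have "(i \<le> p \<and> q \<le> j) \<or> (p \<le> i \<and> j \<le> q)" using edges_laminar[OF s(1) t(1)] s t by linarith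
  then show False
  proof
    assume "i \<le> p \<and> q \<le> j"
    then show False using edge_in_half[OF assms(1) t(1)] neq s t by auto
  next
    assume "p \<le> i \<and> j \<le> q"
    then show False using edge_in_half[OF assms(2) s(1)] neq s t by auto
  qed
qed

lemma not_left_and_right: "splits I i k j \<Longrightarrow> \<not> splits I p i k"
  using edges_laminar[OF splitsD(1) splitsD(1), of i k j p i k] splitsD(2,3)[of i k j] splitsD(2)[of p i k]
  by linarith

lemma left_parent_unique: "splits I i k j \<Longrightarrow> splits I i k q \<Longrightarrow> q = j"
  using split_parent_unique by blast

lemma right_parent_unique: "splits I i k j \<Longrightarrow> splits I p k j \<Longrightarrow> p = i"
  using split_parent_unique by blast

lemma edge_parent:
  assumes "(i, j) \<in> T" "(i, j) \<noteq> (0, N)"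
  obtains (left) q where "splits I i j q" | (right) p where "splits I p i j"
proof -
  have "(\<exists>q. splits I i j q) \<or> (\<exists>p. splits I p i j)"
    if "(p, q) \<in> T" "p \<le> i" "j \<le> q" "(i, j) \<noteq> (p, q)" for p q
    using that
  proof (induction "q - p" arbitrary: p q rule: less_induct)
    case less
    have "Suc p < q" using less.prems assms(1) by (auto simp: edge_iff)
    then obtain m where m: "splits I p m q" using edge_splits[of p q] less.prems by auto
    note md = splitsD[OF m]
    from edge_in_half[OF m assms(1)] less.prems have "j \<le> m \<or> m \<le> i" by auto
    then show ?case
    proof
      assume jm: "j \<le> m"
      show ?thesis
      proof (cases "(i, j) = (p, m)")
        case False
        then show ?thesis using less.hyps[of m p] md jm less.prems by auto
      qed (use m in auto)
    next
      assume mi: "m \<le> i"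
      show ?thesis
      proof (cases "(i, j) = (m, q)")
        case False
        then show ?thesis using less.hyps[of q m] md mi less.prems by auto
      qed (use m in auto)
    qed
  qed
  from this[of 0 N] show ?thesis
    using assms root_edge left right by (auto simp: edge_iff)
qed

lemma edge_sign_edge: "edge_sign I i j s \<Longrightarrow> (i, j) \<in> T"
  by (induction rule: edge_sign.induct) (auto intro: root_edge splitsD)

lemma edge_sign_ex: "(i, j) \<in> T \<Longrightarrow> \<exists>s. edge_sign I i j s"
proof (induction "N - (j - i)" arbitrary: i j rule: less_induct)
  case less
  show ?case
  proof (cases "(i, j) = (0, N)")
    case True
    then show ?thesis using edge_sign.root by auto
  next
    case False
    from less.prems False show ?thesis
    proof (cases rule: edge_parent)
      case (left q)
      then have "\<exists>s. edge_sign I i q s"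
        using splitsD[OF left] by (intro less.hyps) auto
      then show ?thesis using left edge_sign.left by blast
    next
      case (right p)
      then have "\<exists>s. edge_sign I p j s"
        using splitsD[OF right] by (intro less.hyps) auto
      then show ?thesis using right edge_sign.right by blast
    qed
  qed
qed

text \<open>An edge other than the root is a left or a right child, never both, and of one parent
  only, so the last rule of a derivation is forced.\<close>

lemma edge_sign_unique: "edge_sign I i j s \<Longrightarrow> edge_sign I i j s' \<Longrightarrow> s' = s"
proof (induction arbitrary: s' rule: edge_sign.induct)
  case root
  then show ?case
  proof (cases rule: edge_sign.cases)
    case (left j)
    then show ?thesis using splitsD[OF left(2)] by simp
  next
    case (right i j)
    then show ?thesis using splitsD[OF right(3)] by simp
  qed simp
next
  case (left i j s k)
  note s = left.hyps(2)
  from left.prems show ?case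
  proof (cases rule: edge_sign.cases)
    case root
    then show ?thesis using splitsD[OF s] by simp
  next
    case (left q)
    then show ?thesis using left.IH left_parent_unique[OF s] by blast
  next
    case (right p q)
    then show ?thesis using not_left_and_right[OF s] by blast
  qed
next
  case (right i j s k)
  note s = right.hyps(2)
  from right.prems show ?case
  proof (cases rule: edge_sign.cases)
    case root
    then show ?thesis using splitsD[OF s] by simp
  next
    case (left q)
    then show ?thesis using not_left_and_right s by blast
  next
    case (right p q)
    then show ?thesis using right.IH right_parent_unique[OF s] by blast
  qed
qed

definition \<sigma> :: "nat \<Rightarrow> bool" where
  "\<sigma> i = (THE s. edge_sign I i (Suc i) s)"

lemma leaf_sign: "i < N \<Longrightarrow> edge_sign I i (Suc i) s \<longleftrightarrow> s = \<sigma> i"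
proof -
  assume "i < N"
  then obtain s' where s': "edge_sign I i (Suc i) s'" using edge_sign_ex leaf_edge by blast
  then have "\<sigma> i = s'" unfolding \<sigma>_def using edge_sign_unique by (intro the_equality)
  then show ?thesis using s' edge_sign_unique by blast
qed

text \<open>Passing to the left child changes neither the left end nor the sign, so every edge has
  the sign of the leaf at its left end. One sign per leaf describes the whole tree.\<close>

lemma edge_sign_iff: "edge_sign I i j s \<longleftrightarrow> (i, j) \<in> T \<and> s = \<sigma> i"
proof -
  have *: "s = \<sigma> i" if "edge_sign I i j s" for s
    using edge_sign_edge[OF that] that
  proof (induction "j - i" arbitrary: j rule: less_induct)
    case less
    show ?case
    proof (cases "j = Suc i")
      case True
      then show ?thesis using less.prems leaf_sign by (auto simp: edge_iff)
    next
      case False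
      then obtain k where k: "splits I i k j" using less.prems edge_splits[of i j] by (auto simp: edge_iff)
      then have "edge_sign I i k s" using less.prems edge_sign.left by blast
      then show ?thesis using less.hyps[of k] splitsD[OF k] by auto
    qed
  qed
  show ?thesis
  proof
    assume "(i, j) \<in> T \<and> s = \<sigma> i"
    then show "edge_sign I i j s" using edge_sign_ex[of i j] * by blast
  qed (use * edge_sign_edge in blast)
qed

lemma \<sigma>_0: "\<sigma> 0"
  using edge_sign.root[of I] edge_sign_iff by simp

lemma \<sigma>_split: "splits I i k j \<Longrightarrow> \<sigma> k = (\<not> \<sigma> i)"
  using edge_sign.right[of I i j "\<sigma> i" k] splitsD(1)[of i k j] unfolding edge_sign_iff by simp

end

section \<open>Uniqueness of the reduced pair, and removal of carets from compatible pairs\<close>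

section \<open>Reduced pairs\<close>

context partition_tree
begin

lemma locate:
  assumes "0 \<le> x" "x < 1"
  obtains r where "r < N" "I ! r \<le> x" "x < I ! Suc r"
proof -
  define t where "t = (LEAST t. x < I ! t)"
  have t: "x < I ! t" "t \<le> N"
    unfolding t_def using assms ends LeastI[of "\<lambda>t. x < I ! t" N] Least_le[of "\<lambda>t. x < I ! t" N] by auto
  have "t \<noteq> 0" using t assms ends by (cases "t = 0") auto
  then obtain r where r: "t = Suc r" by (cases t) auto
  have "\<not> x < I ! r" using not_less_Least[of r "\<lambda>t. x < I ! t"] r unfolding t_def by simp
  then show ?thesis using that[of r] t r by auto
qed

lemma locate_left:
  assumes "0 < x" "x \<le> 1"
  obtains r where "r < N" "I ! r < x" "x \<le> I ! Suc r"
proof -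
  define t where "t = (LEAST t. x \<le> I ! t)"
  have t: "x \<le> I ! t" "t \<le> N"
    unfolding t_def using assms ends LeastI[of "\<lambda>t. x \<le> I ! t" N] Least_le[of "\<lambda>t. x \<le> I ! t" N] by auto
  have "t \<noteq> 0" using t assms ends by (cases "t = 0") auto
  then obtain r where r: "t = Suc r" by (cases t) auto
  have "\<not> x \<le> I ! r" using not_less_Least[of r "\<lambda>t. x \<le> I ! t"] r unfolding t_def by simp
  then show ?thesis using that[of r] t r by auto
qed

lemma leaf_sd: "r < N \<Longrightarrow> sd_interval (I ! r) (I ! Suc r)"
  using leaf_edge[of r] by (simp add: edge_iff)

text \<open>The leaf around c is nested with \<open>[c, d]\<close>. If it contained
  \<open>[c, d]\<close>, it would contain leaf r and hence be leaf r; in either case it starts at c.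
  The right end is treated symmetrically.\<close>

lemma sd_interval_over_leaf:
  assumes cd: "sd_interval c d" and r: "r < N" "c \<le> I ! r" "I ! Suc r \<le> d"
  obtains p q where "p \<le> r" "Suc r \<le> q" "q \<le> N" "I ! p = c" "I ! q = d"
proof -
  note b = sd_interval_bounds[OF cd]
  have lr: "I ! r < I ! Suc r" using nth_less r by simp
  obtain p where p: "p < N" "I ! p \<le> c" "c < I ! Suc p" using locate[of c] b by auto
  have "I ! p = c"
  proof -
    have "(I ! p \<le> c \<and> d \<le> I ! Suc p) \<or> (c \<le> I ! p \<and> I ! Suc p \<le> d)"
      using sd_interval_cases[OF leaf_sd[OF p(1)] cd] p b by linarith
    then show ?thesis
    proof
      assume *: "I ! p \<le> c \<and> d \<le> I ! Suc p"
      then have "I ! r < I ! Suc p" "I ! p < I ! Suc r" using p r lr by linarith+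
      then have "r = p" using nth_less_iff[of r "Suc p"] nth_less_iff[of p "Suc r"] p r by auto
      then show ?thesis using p r by simp
    qed (use p in auto)
  qed
  moreover obtain q where q: "q < N" "I ! q < d" "d \<le> I ! Suc q" using locate_left[of d] b by auto
  have "I ! Suc q = d"
  proof -
    have "(I ! q \<le> c \<and> d \<le> I ! Suc q) \<or> (c \<le> I ! q \<and> I ! Suc q \<le> d)"
      using sd_interval_cases[OF leaf_sd[OF q(1)] cd] q b by linarith
    then show ?thesis
    proof
      assume *: "I ! q \<le> c \<and> d \<le> I ! Suc q"
      then have "I ! r < I ! Suc q" "I ! q < I ! Suc r" using q r lr by linarith+
      then have "r = q" using nth_less_iff[of r "Suc q"] nth_less_iff[of q "Suc r"] q r by auto
      then show ?thesis using q r by simp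
    qed (use q in auto)
  qed
  moreover have "p \<le> r" using \<open>I ! p = c\<close> r p nth_le_iff[of p r] by simp
  moreover have "Suc r \<le> Suc q" using \<open>I ! Suc q = d\<close> r q nth_le_iff[of "Suc r" "Suc q"] by simp
  ultimately show ?thesis using that q(1) by (metis Suc_leI)
qed

text \<open>Descent into a half that is not a leaf, until both halves are leaves.\<close>

lemma caret_ex:
  assumes "(p, q) \<in> T" "Suc p < q"
  shows "\<exists>t. p \<le> t \<and> t + 2 \<le> q \<and> (t, t + 2) \<in> T"
  using assms
proof (induction "q - p" arbitrary: p q rule: less_induct)
  case less
  obtain k where k: "splits I p k q" using edge_splits less.prems by blast
  note kd = splitsD[OF k]
  have lt: "k - p < q - p" "q - k < q - p" using kd(2,3) by arith+
  consider "Suc p < k" | "Suc k < q" | "k = Suc p" "q = Suc k" using kd by linarith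
  then show ?case
  proof cases
    case 1
    then obtain t where "p \<le> t" "t + 2 \<le> k" "(t, t + 2) \<in> T" using less.hyps[OF lt(1) kd(6)] by blast
    then show ?thesis using kd by (intro exI[of _ t]) auto
  next
    case 2
    then obtain t where "k \<le> t" "t + 2 \<le> q" "(t, t + 2) \<in> T" using less.hyps[OF lt(2) kd(7)] by blast
    then show ?thesis using kd by (intro exI[of _ t]) auto
  next
    case 3
    then show ?thesis using less.prems by (intro exI[of _ p]) auto
  qed
qed

end

lemma represents_tree: "represents I J g \<Longrightarrow> partition_tree I \<and> partition_tree J"
  by (simp add: represents_def partition_tree_def)

lemma represents_nth:
  assumes "represents I J g" "i \<le> leaves I"
  shows "g (I ! i) = J ! i"
proof -
  interpret partition_tree I using represents_tree assms by blast
  have g: "g x = J ! r + (x - I ! r) * (J ! Suc r - J ! r) / (I ! Suc r - I ! r)"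
    if "r < N" "x \<in> {I ! r..I ! Suc r}" for r x
    using assms that unfolding represents_def by blast
  show ?thesis
  proof (cases "i < N")
    case True
    then show ?thesis using g[of i "I ! i"] nth_less[of i "Suc i"] by simp
  next
    case False
    then obtain r where "i = Suc r" "r < N" using N_pos assms(2) by (cases i) auto
    then show ?thesis using g[of r "I ! i"] nth_less[of r "Suc r"] by simp
  qed
qed

text \<open>If \<open>I\<close> subdivided a leaf of \<open>I'\<close>, it would have a caret there.
  As g is affine on that leaf, it maps the caret to an s.d. interval of \<open>J\<close>,
  contradicting reducedness.\<close>

lemma reduced_leaf_maximal:
  assumes rep: "represents I J g" and red: "reduced I J" and rep': "represents I' J' g"
    and s: "s < leaves I'" and pq: "p < q" "q \<le> leaves I" "I ! p = I' ! s" "I ! q = I' ! Suc s"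
  shows "q = Suc p"
proof (rule ccontr)
  assume neq: "q \<noteq> Suc p"
  interpret A: partition_tree I using represents_tree[OF rep] by blast
  interpret A': partition_tree I' using represents_tree[OF rep'] by blast
  interpret B': partition_tree J' using represents_tree[OF rep'] by blast
  have len: "leaves I' = leaves J'" "leaves I = leaves J" using rep rep' unfolding represents_def by auto
  have sd: "sd_interval (I' ! s) (I' ! Suc s)" using A'.leaf_sd[OF s] .
  have "(p, q) \<in> tree_edges I" using sd pq by (simp add: A.edge_iff)
  then obtain t where t: "p \<le> t" "t + 2 \<le> q" "(t, t + 2) \<in> tree_edges I" using A.caret_ex neq pq by force
  have sdt: "sd_interval (I ! t) (I ! (t + 2))" using t by (simp add: A.edge_iff)
  have le: "I' ! s \<le> I ! t" "I ! (t + 2) \<le> I' ! Suc s" "I ! t \<le> I ! (t + 2)"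
    using A.nth_le_iff[of p t] A.nth_le_iff[of "t + 2" q] A.nth_le_iff[of t "t + 2"] t pq by auto
  have g: "g x = J' ! s + (x - I' ! s) * (J' ! Suc s - J' ! s) / (I' ! Suc s - I' ! s)"
    if "I' ! s \<le> x" "x \<le> I' ! Suc s" for x
    using rep' s that unfolding represents_def by simp
  have "sd_interval (J' ! s) (J' ! Suc s)" using B'.leaf_sd s len by simp
  from sd_interval_affine_image[OF sd sdt le(1,2) this]
  have "sd_interval (g (I ! t)) (g (I ! (t + 2)))" using g le by simp
  then have "sd_interval (J ! t) (J ! (t + 2))" using represents_nth[OF rep] t pq by simp
  then show False using red sdt t pq unfolding reduced_def by (auto dest: spec[of _ "Suc t"])
qed

text \<open>Overlapping leaves of the two partitions are nested;
  \<open>reduced_leaf_maximal\<close>, applied to the finer side, makes them equal.\<close>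

lemma reduced_leaf_in_other:
  assumes rep: "represents I J g" and red: "reduced I J" and rep': "represents I' J' g" and red': "reduced I' J'"
    and r: "r < leaves I"
  shows "\<exists>s<leaves I'. I' ! s = I ! r \<and> I' ! Suc s = I ! Suc r"
proof -
  interpret A: partition_tree I using represents_tree[OF rep] by blast
  interpret A': partition_tree I' using represents_tree[OF rep'] by blast
  have sr: "sd_interval (I ! r) (I ! Suc r)" using A.leaf_sd[OF r] .
  note b = sd_interval_bounds[OF sr]
  obtain s where s: "s < leaves I'" "I' ! s \<le> I ! r" "I ! r < I' ! Suc s"
    using A'.locate[of "I ! r"] b by auto
  have ss: "sd_interval (I' ! s) (I' ! Suc s)" using A'.leaf_sd[OF s(1)] .
  from sd_interval_cases[OF sr ss] have "(I' ! s \<le> I ! r \<and> I ! Suc r \<le> I' ! Suc s) \<or> (I ! r \<le> I' ! s \<and> I' ! Suc s \<le> I ! Suc r)"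
    using s b sd_interval_bounds[OF ss] by linarith
  then show ?thesis
  proof
    assume *: "I' ! s \<le> I ! r \<and> I ! Suc r \<le> I' ! Suc s"
    obtain p q where pq: "p \<le> r" "Suc r \<le> q" "q \<le> leaves I" "I ! p = I' ! s" "I ! q = I' ! Suc s"
      using A.sd_interval_over_leaf[OF ss r] * by blast
    then have "q = Suc p" using reduced_leaf_maximal[OF rep red rep' s(1), of p q] by simp
    then have "r = p" using pq by simp
    then show ?thesis using pq s \<open>q = Suc p\<close> by auto
  next
    assume *: "I ! r \<le> I' ! s \<and> I' ! Suc s \<le> I ! Suc r"
    obtain p q where pq: "p \<le> s" "Suc s \<le> q" "q \<le> leaves I'" "I' ! p = I ! r" "I' ! q = I ! Suc r"
      using A'.sd_interval_over_leaf[OF sr s(1)] * by blast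
    then have "q = Suc p" using reduced_leaf_maximal[OF rep' red' rep r, of p q] by simp
    then show ?thesis using pq by (intro exI[of _ p]) auto
  qed
qed

lemma reduced_subset_other:
  assumes rep: "represents I J g" and red: "reduced I J" and rep': "represents I' J' g" and red': "reduced I' J'"
  shows "set I \<subseteq> set I'"
proof
  interpret A: partition_tree I using represents_tree[OF rep] by blast
  interpret A': partition_tree I' using represents_tree[OF rep'] by blast
  note leaf = reduced_leaf_in_other[OF assms]
  fix x assume "x \<in> set I"
  then obtain r where r: "x = I ! r" "r \<le> leaves I" using A.length_I by (auto simp: in_set_conv_nth)
  show "x \<in> set I'"
  proof (cases "r < leaves I")
    case True
    then obtain s where "s < leaves I'" "I' ! s = x" using leaf r by blast
    then show ?thesis using A'.length_I nth_mem[of s I'] by auto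
  next
    case False
    then obtain r' where "r = Suc r'" "r' < leaves I" using r A.N_pos by (cases r) auto
    then obtain s where "s < leaves I'" "I' ! Suc s = x" using leaf r by blast
    then show ?thesis using A'.length_I nth_mem[of "Suc s" I'] by auto
  qed
qed

lemma reduced_pair_unique:
  assumes rep: "represents I J g" and red: "reduced I J" and rep': "represents I' J' g" and red': "reduced I' J'"
  shows "I = I' \<and> J = J'"
proof
  have "set I = set I'" using reduced_subset_other[OF rep red rep' red'] reduced_subset_other[OF rep' red' rep red] by blast
  moreover have "sorted_wrt (<) I" "sorted_wrt (<) I'" using rep rep' unfolding represents_def sd_partition_def by auto
  ultimately show I: "I = I'" using sorted_distinct_set_unique by (auto simp: strict_sorted_iff)
  have trees: "partition_tree J" "partition_tree J'" using represents_tree rep rep' by blast+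
  have len: "leaves J = leaves I" "leaves J' = leaves I" using rep rep' I unfolding represents_def by auto
  show "J = J'"
  proof (rule nth_equalityI)
    show "length J = length J'" using partition_tree.length_I[OF trees(1)] partition_tree.length_I[OF trees(2)] len by simp
    fix i assume "i < length J"
    then have "i \<le> leaves I" using partition_tree.length_I[OF trees(1)] len by simp
    then show "J ! i = J' ! i" using represents_nth[OF rep, of i] represents_nth[OF rep', of i] I by simp
  qed
qed

text \<open>The original index of breakpoint p after breakpoint i has been deleted.\<close>

definition skip :: "nat \<Rightarrow> nat \<Rightarrow> nat" where
  "skip i p = (if p < i then p else Suc p)"

definition del_nth :: "nat \<Rightarrow> real list \<Rightarrow> real list" where
  "del_nth i xs = take i xs @ drop (Suc i) xs"

lemma length_del_nth: "i < length xs \<Longrightarrow> length (del_nth i xs) = length xs - 1"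
  by (simp add: del_nth_def)

lemma nth_del_nth: "i < length xs \<Longrightarrow> p < length xs - 1 \<Longrightarrow> del_nth i xs ! p = xs ! skip i p"
  by (auto simp: del_nth_def skip_def nth_append)

lemma skip_less_iff: "skip i p < skip i q \<longleftrightarrow> p < q"
  by (auto simp: skip_def)

context partition_tree
begin

context
  fixes i
  assumes i: "1 \<le> i" "i + 1 \<le> N" and caret: "sd_interval (I ! (i - 1)) (I ! (i + 1))"
begin

text \<open>Each of the two leaves fits into a half of the caret, so their common end is the
  midpoint.\<close>

lemma caret_middle: "I ! i = (I ! (i - 1) + I ! (i + 1)) / 2"
proof -
  have l: "sd_interval (I ! (i - 1)) (I ! i)" "sd_interval (I ! i) (I ! (i + 1))"
    using leaf_sd[of "i - 1"] leaf_sd[of i] i by auto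
  note b = sd_interval_bounds[OF l(1)] sd_interval_bounds[OF l(2)]
  show ?thesis
    using sd_subinterval_in_half[OF caret l(1)] sd_subinterval_in_half[OF caret l(2)] b by auto
qed

lemma length_del: "length (del_nth i I) = N" and leaves_del: "leaves (del_nth i I) = N - 1"
  using i by (simp_all add: length_del_nth length_I leaves_def[of "del_nth i I"])

lemma nth_del: "p < N \<Longrightarrow> del_nth i I ! p = I ! skip i p"
  using i by (simp add: nth_del_nth length_I)

lemma partition_del: "sd_partition (del_nth i I)"
proof -
  have ne: "del_nth i I \<noteq> []" using length_del N_pos by auto
  have "hd (del_nth i I) = 0"
    using hd_conv_nth[OF ne] nth_del[of 0] N_pos i ends by (simp add: skip_def)
  moreover have "last (del_nth i I) = 1"
    using last_conv_nth[OF ne] nth_del[of "N - 1"] N_pos i ends length_del by (simp add: skip_def)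
  moreover have "sorted_wrt (<) (del_nth i I)"
    unfolding sorted_wrt_iff_nth_less
  proof (intro allI impI)
    fix p q assume pq: "p < q" "q < length (del_nth i I)"
    then have "skip i p < skip i q" "skip i q \<le> N" using length_del by (auto simp: skip_def)
    then show "del_nth i I ! p < del_nth i I ! q" using pq length_del nth_less nth_del by simp
  qed
  moreover have "sd_interval (del_nth i I ! p) (del_nth i I ! Suc p)" if "Suc p < length (del_nth i I)" for p
  proof -
    have p: "Suc p < N" using that length_del by simp
    consider "Suc p < i" | "Suc p = i" | "i \<le> p" by linarith
    then show ?thesis
    proof cases
      case 1
      then show ?thesis using p nth_del[of p] nth_del[of "Suc p"] leaf_sd[of p] by (simp add: skip_def)
    next
      case 2
      then show ?thesis using p nth_del[of p] nth_del[of "Suc p"] caret by (auto simp: skip_def)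
    next
      case 3
      then show ?thesis using p nth_del[of p] nth_del[of "Suc p"] leaf_sd[of "Suc p"] by (simp add: skip_def)
    qed
  qed
  ultimately show ?thesis using ne unfolding sd_partition_def by blast
qed

lemma splits_del: "splits (del_nth i I) p k q \<Longrightarrow> splits I (skip i p) (skip i k) (skip i q)"
proof -
  assume "splits (del_nth i I) p k q"
  then have s: "p < k" "k < q" "q < N" "sd_interval (del_nth i I ! p) (del_nth i I ! q)"
    "del_nth i I ! k = (del_nth i I ! p + del_nth i I ! q) / 2"
    by (auto simp: splits_def tree_edges_def length_del)
  then have n: "del_nth i I ! p = I ! skip i p" "del_nth i I ! k = I ! skip i k" "del_nth i I ! q = I ! skip i q"
    by (simp_all add: nth_del)
  have "skip i q < Suc N" using s(3) by (simp add: skip_def)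
  then show ?thesis
    using s unfolding n splits_def tree_edges_def length_I by (simp add: skip_less_iff)
qed

text \<open>Deleting a caret only removes edges, so a derivation in the smaller tree becomes one in
  the larger tree after reindexing. Since signs are unique, this implication determines all signs of
  the smaller tree.\<close>

lemma edge_sign_del: "edge_sign (del_nth i I) p q s \<Longrightarrow> edge_sign I (skip i p) (skip i q) s"
proof (induction rule: edge_sign.induct)
  case root
  have "skip i 0 = 0" "skip i (leaves (del_nth i I)) = N" using i by (auto simp: skip_def leaves_del)
  then show ?case using edge_sign.root[of I] by simp
next
  case (left p q s k)
  then show ?case using splits_del edge_sign.left by blast
next
  case (right p q s k)
  then show ?case using splits_del edge_sign.right by blast
qed

lemma \<sigma>_del:
  assumes "p < N - 1"
  shows "partition_tree.\<sigma> (del_nth i I) p = \<sigma> (skip i p)"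
proof -
  interpret D: partition_tree "del_nth i I" by (simp add: partition_tree_def partition_del)
  have "edge_sign (del_nth i I) p (Suc p) (D.\<sigma> p)" using D.leaf_sign assms leaves_del by simp
  then show ?thesis using edge_sign_del edge_sign_iff by blast
qed

end

end

lemma compatible_iff:
  assumes "partition_tree I" "partition_tree J"
  shows "compatible I J \<longleftrightarrow> leaves I = leaves J \<and> (\<forall>i<leaves I. partition_tree.\<sigma> I i = partition_tree.\<sigma> J i)"
proof -
  have "(\<forall>s. edge_sign I i (Suc i) s \<longleftrightarrow> edge_sign J i (Suc i) s) \<longleftrightarrow> partition_tree.\<sigma> I i = partition_tree.\<sigma> J i"
    if "i < leaves I" "leaves I = leaves J" for i
    using partition_tree.leaf_sign[OF assms(1), of i] partition_tree.leaf_sign[OF assms(2), of i] that by simp blast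
  then show ?thesis unfolding compatible_def by blast
qed

lemma reduce_caret:
  assumes rep: "represents I J g" and comp: "compatible I J" and red: "\<not> reduced I J"
  obtains I' J' where "represents I' J' g" "compatible I' J'" "leaves I' < leaves I"
proof -
  obtain i where i: "1 \<le> i" "i + 1 \<le> leaves I"
    and sd: "sd_interval (I ! (i - 1)) (I ! (i + 1))" "sd_interval (J ! (i - 1)) (J ! (i + 1))"
    using red unfolding reduced_def by blast
  interpret A: partition_tree I using represents_tree[OF rep] by blast
  interpret B: partition_tree J using represents_tree[OF rep] by blast
  have len: "leaves J = leaves I" using rep by (simp add: represents_def)
  then have iJ: "i + 1 \<le> leaves J" using i by simp
  let ?I = "del_nth i I" and ?J = "del_nth i J"
  note pI = A.partition_del[OF i sd(1)] and pJ = B.partition_del[OF i(1) iJ sd(2)]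
  note lI = A.leaves_del[OF i sd(1)] and lJ = B.leaves_del[OF i(1) iJ sd(2)]
  note nI = A.nth_del[OF i sd(1)] and nJ = B.nth_del[OF i(1) iJ sd(2)]
  have g: "g x = J ! r + (x - I ! r) * (J ! Suc r - J ! r) / (I ! Suc r - I ! r)"
    if "r < leaves I" "x \<in> {I ! r..I ! Suc r}" for r x
    using rep that unfolding represents_def by blast
  have "g x = ?J ! p + (x - ?I ! p) * (?J ! Suc p - ?J ! p) / (?I ! Suc p - ?I ! p)"
    if p: "p < leaves ?I" and x: "x \<in> {?I ! p..?I ! Suc p}" for p x
  proof -
    have pN: "Suc p < leaves I" using p lI by simp
    consider "Suc p < i" | "Suc p = i" | "i \<le> p" by linarith
    then show ?thesis
    proof cases
      case 1
      then show ?thesis using x g[of p x] pN len nI[of p] nI[of "Suc p"] nJ[of p] nJ[of "Suc p"] by (simp add: skip_def)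
    next
      case 3
      then show ?thesis using x g[of "Suc p" x] pN len nI[of p] nI[of "Suc p"] nJ[of p] nJ[of "Suc p"] by (simp add: skip_def)
    next
      case 2
      \<comment> \<open>The ends of the removed caret and of its image. Both middle breakpoints are
        midpoints, so g has the slope (v' - u') / (v - u) on either half.\<close>
      define u v u' v' where "u = I ! p" and "v = I ! (i + 1)" and "u' = J ! p" and "v' = J ! (i + 1)"
      have m: "I ! i = (u + v) / 2" "J ! i = (u' + v') / 2"
        using A.caret_middle[OF i sd(1)] B.caret_middle[OF i(1) iJ sd(2)] 2
        unfolding u_def v_def u'_def v'_def by auto
      have uv: "u < v" using A.nth_less[of p "i + 1"] 2 i unfolding u_def v_def by simp
      have e: "?I ! p = u" "?I ! Suc p = v" "?J ! p = u'" "?J ! Suc p = v'"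
        using 2 pN len nI[of p] nI[of "Suc p"] nJ[of p] nJ[of "Suc p"]
        by (auto simp: skip_def u_def v_def u'_def v'_def)
      have x': "u \<le> x" "x \<le> v" using x e by auto
      show ?thesis
      proof (cases "x \<le> I ! i")
        case True
        then have "g x = u' + (x - u) * (J ! i - u') / (I ! i - u)"
          using g[of p x] 2 x' pN by (auto simp: u_def u'_def)
        also have "\<dots> = u' + (x - u) * (v' - u') / (v - u)"
          unfolding m using uv by (simp add: field_simps)
        finally show ?thesis unfolding e .
      next
        case False
        then have "g x = J ! i + (x - I ! i) * (v' - J ! i) / (v - I ! i)"
          using g[of i x] 2 x' i by (auto simp: v_def v'_def)
        also have "\<dots> = u' + (x - u) * (v' - u') / (v - u)"
          unfolding m using uv by (simp add: field_simps)
        finally show ?thesis unfolding e .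
      qed
    qed
  qed
  then have "represents ?I ?J g" unfolding represents_def using pI pJ lI lJ len by simp
  moreover have "compatible ?I ?J"
  proof -
    have "partition_tree.\<sigma> ?I p = partition_tree.\<sigma> ?J p" if p: "p < leaves ?I" for p
    proof -
      have "skip i p < leaves I" using p lI by (auto simp: skip_def)
      then have "A.\<sigma> (skip i p) = B.\<sigma> (skip i p)"
        using comp compatible_iff[OF A.partition_tree_axioms B.partition_tree_axioms] by blast
      then show ?thesis
        using A.\<sigma>_del[OF i sd(1), of p] B.\<sigma>_del[OF i(1) iJ sd(2), of p] p lI len by simp
    qed
    then show ?thesis
      using compatible_iff[of ?I ?J] pI pJ lI lJ len by (simp add: partition_tree_def)
  qed
  moreover have "leaves ?I < leaves I" using lI A.N_pos by simp
  ultimately show ?thesis using that by blast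
qed

text \<open>A compatible pair with the fewest leaves admits no caret removal, so it is reduced, and
  uniqueness identifies it with \<open>reduced_pair g\<close>.\<close>

lemma compatible_reduced_pair:
  assumes "g \<in> oriented_thompson"
  obtains I J where "reduced_pair g = (I, J)" "represents I J g" "compatible I J"
proof -
  let ?P = "\<lambda>m. \<exists>I J. represents I J g \<and> compatible I J \<and> leaves I = m"
  have "\<exists>m. ?P m" using assms unfolding oriented_thompson_def by blast
  then have "?P (LEAST m. ?P m)" by (rule LeastI_ex)
  then obtain I J where IJ: "represents I J g" "compatible I J" "leaves I = (LEAST m. ?P m)" by blast
  have "reduced I J"
  proof (rule ccontr)
    assume "\<not> reduced I J"
    then obtain I' J' where "represents I' J' g" "compatible I' J'" "leaves I' < leaves I"
      using reduce_caret IJ by blast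
    then show False using not_less_Least[of "leaves I'" ?P] IJ(3) by auto
  qed
  then have "reduced_pair g = (I, J)"
    unfolding reduced_pair_def
    by (intro the_equality) (use IJ(1) reduced_pair_unique in \<open>auto\<close>)
  then show ?thesis using that IJ by blast
qed

section \<open>The right side of each disc as a function of the height\<close>

section \<open>The profile of a tangle\<close>

context partition_tree
begin

text \<open>For 0 < k < N, \<open>(par k, rt k)\<close> is the unique edge with midpoint at
  breakpoint k. Disc k is later glued to disc \<open>par k\<close> at the vertex below this
  edge.\<close>

definition par :: "nat \<Rightarrow> nat" where "par k = (THE i. \<exists>j. splits I i k j)"
definition rt :: "nat \<Rightarrow> nat" where "rt k = (THE j. \<exists>i. splits I i k j)"

lemma par_rt: "splits I i k j \<Longrightarrow> par k = i \<and> rt k = j"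
proof -
  assume s: "splits I i k j"
  have "par k = i" unfolding par_def
  proof (rule the_equality)
    show "\<exists>j. splits I i k j" using s ..
    fix i' assume "\<exists>j. splits I i' k j"
    then show "i' = i" using split_parent_unique[OF s] by blast
  qed
  moreover have "rt k = j" unfolding rt_def
  proof (rule the_equality)
    show "\<exists>i. splits I i k j" using s ..
    fix j' assume "\<exists>i. splits I i k j'"
    then show "j' = j" using split_parent_unique[OF s] by blast
  qed
  ultimately show ?thesis ..
qed

lemma splits_par_rt: "0 < k \<Longrightarrow> k < N \<Longrightarrow> splits I (par k) k (rt k)"
proof -
  assume "0 < k" "k < N"
  then obtain i j where s: "splits I i k j" by (rule split_parent_ex)
  then show ?thesis using par_rt[OF s] by simp
qed

text \<open>The height of the crossing at which strand \<open>k\<close> ends, or of the cap if \<open>k = 0\<close>.\<close>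

definition h :: "nat \<Rightarrow> nat" where
  "h k = (if k = 0 then Suc N else rt k - par k)"

definition bot :: "nat \<Rightarrow> nat \<Rightarrow> nat" where
  "bot i j = (if j = Suc i then 0 else j - i)"

text \<open>A left edge ends at the crossing of strand j, where its parent splits; a right edge or
  the root ends at the height of the top of strand i.\<close>

definition top :: "nat \<Rightarrow> nat \<Rightarrow> nat" where
  "top i j = (if splits I i j (rt j) then h j else h i)"

definition upper_end :: "nat \<Rightarrow> nat \<Rightarrow> R3" where
  "upper_end i j =
    (if splits I i j (rt j) then (2 * real j, real (h j), 1)
     else if i = 0 then (fst (lower_end I 0 N), real (Suc N), 0)
     else (2 * real i, real (h i), 1))"

lemma lower_end_leaf: "lower_end I i (Suc i) = (2 * real i + 1, 0, 0)"
  by (simp add: lower_end_def)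

lemma lower_end_split: "splits I i k j \<Longrightarrow> lower_end I i j = (2 * real k, real (j - i), 0)"
proof -
  assume s: "splits I i k j"
  have "(THE k. splits I i k j) = k" 
  proof (rule the_equality)
    fix k' assume "splits I i k' j"
    then show "k' = k" using s by (rule split_unique)
  qed (rule s)
  moreover have "j \<noteq> Suc i" using splitsD(2,3)[OF s] by simp
  ultimately show ?thesis by (simp add: lower_end_def)
qed

lemma h_split: "splits I i k j \<Longrightarrow> h k = j - i"
  using par_rt[of i k j] splitsD(2)[of i k j] by (simp add: h_def)

lemma edge_kind:
  assumes "(i, j) \<in> T"
  obtains (left) "splits I i j (rt j)" "top i j = h j" "upper_end i j = (2 * real j, real (h j), 1)"
      "par j = i" "h j = rt j - i" "0 < j" "j < N"
    | (root) "i = 0" "j = N" "\<not> splits I i j (rt j)" "top i j = Suc N" "upper_end i j = (fst (lower_end I 0 N), real (Suc N), 0)"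
    | (right) "0 < i" "i < N" "splits I (par i) i j" "rt i = j" "\<not> splits I i j (rt j)" "top i j = h i"
      "h i = j - par i" "upper_end i j = (2 * real i, real (h i), 1)"
proof (cases "\<exists>q. splits I i j q")
  case True
  then obtain q where q: "splits I i j q" by auto
  then have "splits I i j (rt j)" "par j = i" using par_rt[OF q] by auto
  then show ?thesis using left h_split[of i j "rt j"] splitsD(2-4)[OF q] by (simp add: top_def upper_end_def)
next
  case False
  then have n: "\<not> splits I i j (rt j)" by blast
  show ?thesis
  proof (cases "(i, j) = (0, N)")
    case True
    then show ?thesis using root n by (simp add: top_def upper_end_def h_def)
  next
    case False
    from assms False show ?thesis
    proof (cases rule: edge_parent)
      case (left q)
      then show ?thesis using \<open>\<nexists>q. splits I i j q\<close> by blast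
    next
      case (right p)
      then have "splits I (par i) i j" "rt i = j" "h i = j - par i" "0 < i" "i < N"
        using par_rt[OF right] h_split[OF right] splitsD(2-4)[OF right] by auto
      then show ?thesis using that(3) n by (simp add: top_def upper_end_def)
    qed
  qed
qed

lemma lower_end_coords:
  assumes "(i, j) \<in> T"
  shows "fst (snd (lower_end I i j)) = bot i j" "snd (snd (lower_end I i j)) = 0"
    "2 * real i < fst (lower_end I i j)" "fst (lower_end I i j) < 2 * real j"
proof -
  have "fst (snd (lower_end I i j)) = bot i j \<and> snd (snd (lower_end I i j)) = 0 \<and>
    2 * real i < fst (lower_end I i j) \<and> fst (lower_end I i j) < 2 * real j"
  proof (cases "j = Suc i")
    case True
    then show ?thesis by (simp add: lower_end_leaf bot_def)
  next
    case False
    then obtain k where k: "splits I i k j" using edge_splits[OF assms] assms by (auto simp: edge_iff)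
    then show ?thesis using splitsD(2,3)[OF k] False by (simp add: lower_end_split[OF k] bot_def)
  qed
  then show "fst (snd (lower_end I i j)) = bot i j" "snd (snd (lower_end I i j)) = 0"
    "2 * real i < fst (lower_end I i j)" "fst (lower_end I i j) < 2 * real j" by auto
qed

lemma upper_end_coords:
  assumes "(i, j) \<in> T"
  shows "fst (snd (upper_end i j)) = top i j" "2 * real i \<le> fst (upper_end i j)" "fst (upper_end i j) \<le> 2 * real j"
proof -
  have ij: "i < j" using assms by (simp add: edge_iff)
  have "fst (snd (upper_end i j)) = top i j \<and> 2 * real i \<le> fst (upper_end i j) \<and> fst (upper_end i j) \<le> 2 * real j"
    using assms
  proof (cases rule: edge_kind)
    case root
    then show ?thesis using lower_end_coords(3,4)[OF root_edge] by simp
  qed (use ij in simp_all)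
  then show "fst (snd (upper_end i j)) = top i j" "2 * real i \<le> fst (upper_end i j)" "fst (upper_end i j) \<le> 2 * real j" by auto
qed

lemma bot_less_top:
  assumes "(i, j) \<in> T"
  shows "bot i j < top i j"
proof -
  have ij: "i < j" "j \<le> N" using assms by (auto simp: edge_iff)
  have le: "bot i j \<le> j - i" by (simp add: bot_def)
  from assms show ?thesis
  proof (cases rule: edge_kind)
    case left
    then show ?thesis using le splitsD(3)[OF left(1)] ij by simp
  next
    case root
    then show ?thesis using le by simp
  next
    case right
    then show ?thesis using le splitsD(2)[OF right(3)] ij by simp
  qed
qed

text \<open>The edge split at k is contained in the edge split at \<open>par k\<close> and starts
  further right, and a crossing is drawn at the index length of its edge. So disc k ends strictly
  below the top of the disc that carries it.\<close>

lemma height_less_parent: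
  assumes "0 < k" "k < N"
  shows "par k < k" "h k < h (par k)" "2 \<le> h k"
proof -
  note s = splits_par_rt[OF assms]
  note d = splitsD[OF s]
  show "par k < k" by (rule d(2))
  have hk: "h k = rt k - par k" by (rule h_split[OF s])
  then show "2 \<le> h k" using d by simp
  show "h k < h (par k)"
  proof (cases "par k = 0")
    case True
    then show ?thesis using hk d by (simp add: h_def)
  next
    case False
    then have i: "0 < par k" "par k < N" using d by auto
    note s' = splits_par_rt[OF i] and d' = splitsD[OF splits_par_rt[OF i]]
    have "rt k \<le> rt (par k)"
      using edges_laminar[OF d(1) d'(1)] d(2-4) d'(2-4) by linarith
    then show ?thesis using hk h_split[OF s'] d(2,3) d'(2) by simp
  qed
qed

lemma top_le_h: "(i, j) \<in> T \<Longrightarrow> top i j \<le> h i"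
proof (erule edge_kind)
  assume "top i j = h j" "par j = i" "0 < j" "j < N"
  then show "top i j \<le> h i" using height_less_parent(2)[of j] by simp
qed (simp_all add: h_def)

definition edge_at :: "nat \<Rightarrow> nat \<Rightarrow> nat \<Rightarrow> bool" where
  "edge_at i y j \<longleftrightarrow> (i, j) \<in> T \<and> bot i j \<le> y \<and> y < top i j"

text \<open>The edges with left end i form a chain of successive left children. Their height ranges,
  closed below and open above, tile the range from 0 to \<open>h i\<close>; the induction descends
  this chain from its top edge.\<close>

lemma edge_at_ex:
  assumes "i < N" "y < h i"
  shows "\<exists>j. edge_at i y j"
proof -
  have *: "\<exists>j'. edge_at i y j'" if "(i, j) \<in> T" "y < top i j" for j
    using that
  proof (induction j rule: less_induct)
    case (less j)
    show ?case
    proof (cases "bot i j \<le> y")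
      case True
      then show ?thesis using less.prems by (auto simp: edge_at_def)
    next
      case False
      then have "j \<noteq> Suc i" "y < j - i" by (auto simp: bot_def split: if_splits)
      then obtain k where k: "splits I i k j" using edge_splits[OF less.prems(1)] less.prems by (auto simp: edge_iff)
      then have "splits I i k (rt k)" using par_rt[OF k] by simp
      then have "top i k = j - i" using h_split[OF k] by (simp add: top_def)
      then show ?thesis using less.IH[of k] splitsD[OF k] \<open>y < j - i\<close> by simp
    qed
  qed
  show ?thesis
  proof (cases "i = 0")
    case True
    have "\<not> splits I 0 N (rt N)" using splitsD(3,4)[of 0 N "rt N"] by auto
    then have "top 0 N = h 0" by (simp add: top_def)
    then show ?thesis using *[of N] root_edge True assms by simp
  next
    case False
    then have s: "splits I (par i) i (rt i)" using assms splits_par_rt by simp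
    have "\<not> splits I i (rt i) (rt (rt i))" using not_left_and_right s by blast
    then have "top i (rt i) = h i" by (simp add: top_def)
    then show ?thesis using *[of "rt i"] splitsD(7)[OF s] assms by simp
  qed
qed

text \<open>The shorter edge ends where its parent splits, and this parent is contained in the
  longer edge.\<close>

lemma top_le_bot:
  assumes e: "(i, j) \<in> T" "(i, j') \<in> T" and j: "j < j'"
  shows "top i j \<le> bot i j'"
proof -
  have ij: "i < j" "j' \<le> N" using e by (auto simp: edge_iff)
  then have b: "bot i j' = j' - i" using j by (simp add: bot_def)
  from e(1) show ?thesis
  proof (cases rule: edge_kind)
    case left
    have "rt j \<le> j'"
    proof (rule ccontr)
      assume "\<not> rt j \<le> j'"
      then show False using edge_in_half[OF left(1) e(2)] ij j by auto
    qed
    then show ?thesis using b left by simp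
  next
    case root
    then show ?thesis using ij j by simp
  next
    case right
    have d: "(par i, j) \<in> T" "par i < i" using splitsD[OF right(3)] by auto
    show ?thesis using edges_laminar[OF d(1) e(2)] d ij j by linarith
  qed
qed

lemma edge_at_unique:
  assumes "edge_at i y j" "edge_at i y j'"
  shows "j = j'"
proof -
  have "\<not> j < j'" if "edge_at i y j" "edge_at i y j'" for j j'
    using top_le_bot[of i j j'] that by (auto simp: edge_at_def)
  then show ?thesis using assms by (metis linorder_neqE_nat)
qed

definition ej :: "nat \<Rightarrow> nat \<Rightarrow> nat" where "ej i y = (THE j. edge_at i y j)"

lemma ej_eq: "edge_at i y j \<Longrightarrow> ej i y = j"
  unfolding ej_def by (rule the_equality) (auto intro: edge_at_unique)

lemma edge_at_ej: "i < N \<Longrightarrow> y < h i \<Longrightarrow> edge_at i y (ej i y)"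
proof -
  assume "i < N" "y < h i"
  then obtain j where j: "edge_at i y j" using edge_at_ex by blast
  then show ?thesis using ej_eq[OF j] by simp
qed

text \<open>Interpolation by height along the straight edge; integer heights give the points at
  which the edge is subdivided.\<close>

definition edge_point :: "nat \<Rightarrow> nat \<Rightarrow> nat \<Rightarrow> R3" where
  "edge_point i j y = linepath (lower_end I i j) (upper_end i j) ((real y - real (bot i j)) / (real (top i j) - real (bot i j)))"

lemma edge_point_bot: "edge_point i j (bot i j) = lower_end I i j"
  by (simp add: edge_point_def linepath_def)

lemma edge_point_top: "(i, j) \<in> T \<Longrightarrow> edge_point i j (top i j) = upper_end i j"
  using bot_less_top[of i j] by (simp add: edge_point_def linepath_def)

lemma fst_linepath: "fst (linepath p q t) = linepath (fst p) (fst q) t"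
  and snd_linepath: "snd (linepath p q t) = linepath (snd p) (snd q) t"
  by (simp_all add: linepath_def)

lemma edge_point_height:
  assumes "(i, j) \<in> T"
  shows "fst (snd (edge_point i j y)) = y"
proof -
  define t where "t = (real y - real (bot i j)) / (real (top i j) - real (bot i j))"
  have t: "t * (real (top i j) - real (bot i j)) = real y - real (bot i j)"
    using bot_less_top[OF assms] by (simp add: t_def)
  have "fst (snd (edge_point i j y)) = (1 - t) * bot i j + t * top i j"
    unfolding edge_point_def t_def[symmetric] fst_linepath snd_linepath
      lower_end_coords(1)[OF assms] upper_end_coords(1)[OF assms]
    by (simp add: linepath_def)
  then show ?thesis using t by (simp add: algebra_simps)
qed

lemma edge_point_between:
  assumes "(i, j) \<in> T" "bot i j \<le> y" "y < top i j"
  shows "2 * real i < fst (edge_point i j y)" "fst (edge_point i j y) < 2 * real j"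
proof -
  define t where "t = (real y - real (bot i j)) / (real (top i j) - real (bot i j))"
  have t: "0 \<le> t" "t < 1" using assms by (auto simp: t_def divide_simps)
  have e: "fst (edge_point i j y) = (1 - t) * fst (lower_end I i j) + t * fst (upper_end i j)"
    unfolding edge_point_def t_def[symmetric] fst_linepath by (simp add: linepath_def)
  note l = lower_end_coords(3,4)[OF assms(1)] and u = upper_end_coords(2,3)[OF assms(1)]
  have "(1 - t) * (2 * real i) + t * (2 * real i) < fst (edge_point i j y)"
    unfolding e using t l u by (intro add_less_le_mono mult_strict_left_mono mult_left_mono) auto
  then show "2 * real i < fst (edge_point i j y)" by (simp add: algebra_simps)
  have "fst (edge_point i j y) < (1 - t) * (2 * real j) + t * (2 * real j)"
    unfolding e using t l u by (intro add_less_le_mono mult_strict_left_mono mult_left_mono) auto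
  then show "fst (edge_point i j y) < 2 * real j" by (simp add: algebra_simps)
qed

text \<open>\<open>A i y\<close> and \<open>B i y\<close> are the lower and upper end of the right
  side of disc i between the heights y and y + 1. At a crossing on this side
  \<open>B i (y - 1)\<close> is the over-point and \<open>A i y\<close> the under-point.\<close>

definition A :: "nat \<Rightarrow> nat \<Rightarrow> R3" where "A i y = edge_point i (ej i y) y"
definition B :: "nat \<Rightarrow> nat \<Rightarrow> R3" where "B i y = edge_point i (ej i y) (Suc y)"

lemma edge_at_ejD:
  assumes "i < N" "y < h i"
  shows "(i, ej i y) \<in> T" "bot i (ej i y) \<le> y" "y < top i (ej i y)"
  using edge_at_ej[OF assms] by (simp_all add: edge_at_def)

lemma A_left: "i < N \<Longrightarrow> y < h i \<Longrightarrow> 2 * real i < fst (A i y)"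
  unfolding A_def by (rule edge_point_between(1)) (rule edge_at_ejD; assumption)+

lemma AB_height: "i < N \<Longrightarrow> y < h i \<Longrightarrow> fst (snd (A i y)) = y \<and> fst (snd (B i y)) = Suc y"
  unfolding A_def B_def by (intro conjI edge_point_height) (rule edge_at_ejD(1); assumption)+

lemma B_left:
  assumes "i < N" "y < h i"
  shows "2 * real i < fst (B i y) \<or> (0 < i \<and> Suc y = h i \<and> fst (B i y) = 2 * real i \<and> snd (snd (B i y)) = 1)"
proof -
  let ?j = "ej i y"
  have e: "(i, ?j) \<in> T" "bot i ?j \<le> y" "y < top i ?j" by (intro edge_at_ejD assms)+
  have ij: "i < ?j" using e by (simp add: edge_iff)
  show ?thesis
  proof (cases "Suc y < top i ?j")
    case True
    then show ?thesis using edge_point_between(1)[OF e(1), of "Suc y"] e by (simp add: B_def)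
  next
    case False
    then have y: "Suc y = top i ?j" using e by simp
    then have B: "B i y = upper_end i ?j" using edge_point_top[OF e(1)] by (simp add: B_def)
    from e(1) show ?thesis
    proof (cases rule: edge_kind)
      case left
      then show ?thesis using B ij by simp
    next
      case root
      then show ?thesis using B lower_end_coords(3)[OF root_edge] by simp
    next
      case right
      then show ?thesis using B y by simp
    qed
  qed
qed

text \<open>An edge from i reaching beyond k would contain the edge split at k, and then start no
  lower than \<open>h k\<close>, or be a proper part of it and lie in one half. Both are
  impossible.\<close>

lemma ej_le:
  assumes "i < k" "k < N" "y < h i" "y < h k"
  shows "ej i y \<le> k"
proof (rule ccontr)
  let ?j = "ej i y"
  assume "\<not> ?j \<le> k"
  then have kj: "k < ?j" by simp
  have iN: "i < N" using assms by simp
  have e: "(i, ?j) \<in> T" "bot i ?j \<le> y" by (rule edge_at_ejD[OF iN assms(3)])+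
  have s: "splits I (par k) k (rt k)" using splits_par_rt assms by simp
  note d = splitsD[OF s]
  have "?j \<noteq> Suc i" using kj assms(1) by linarith
  then have b: "?j - i \<le> y" using e(2) by (simp add: bot_def)
  have hk: "y < rt k - par k" using h_split[OF s] assms by simp
  have "(i \<le> par k \<and> rt k \<le> ?j) \<or> (par k \<le> i \<and> ?j \<le> rt k)"
    using edges_laminar[OF d(1) e(1)] d(2,3) kj assms by linarith
  then show False
  proof
    assume "i \<le> par k \<and> rt k \<le> ?j"
    then show False using b hk by linarith
  next
    assume *: "par k \<le> i \<and> ?j \<le> rt k"
    have "(i, ?j) \<noteq> (par k, rt k)"
    proof
      assume "(i, ?j) = (par k, rt k)"
      then have "?j - i = rt k - par k" by (metis prod.inject)
      then show False using b hk by linarith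
    qed
    then have "?j \<le> k \<or> k \<le> i" using edge_in_half[OF s e(1)] * by blast
    then show False using kj assms(1) by linarith
  qed
qed

lemma A_right: "i < k \<Longrightarrow> k < N \<Longrightarrow> y < h i \<Longrightarrow> y < h k \<Longrightarrow> fst (A i y) < 2 * real k"
proof -
  assume a: "i < k" "k < N" "y < h i" "y < h k"
  then have "i < N" by simp
  from edge_point_between(2)[OF edge_at_ejD[OF this a(3)]] have "fst (A i y) < 2 * real (ej i y)"
    by (simp only: A_def)
  also have "\<dots> \<le> 2 * real k" using ej_le[OF a] by simp
  finally show ?thesis .
qed

lemma B_right:
  assumes "i < k" "k < N" "y < h i" "y < h k"
  shows "fst (B i y) < 2 * real k \<or> (Suc y = h k \<and> par k = i \<and> fst (B i y) = 2 * real k \<and> snd (snd (B i y)) = 1)"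
proof -
  let ?j = "ej i y"
  have e: "(i, ?j) \<in> T" "bot i ?j \<le> y" "y < top i ?j" by (rule edge_at_ejD, use assms in linarith, use assms in linarith)+
  have jk: "?j \<le> k" using ej_le[OF assms] .
  show ?thesis
  proof (cases "Suc y < top i ?j")
    case True
    then show ?thesis using edge_point_between(2)[OF e(1), of "Suc y"] e jk by (simp add: B_def)
  next
    case False
    then have y: "Suc y = top i ?j" using e by simp
    then have B: "B i y = upper_end i ?j" using edge_point_top[OF e(1)] by (simp add: B_def)
    from e(1) show ?thesis
    proof (cases rule: edge_kind)
      case left
      then show ?thesis using B jk y by (cases "?j = k") auto
    next
      case root
      then show ?thesis using jk assms by simp
    next
      case right
      then show ?thesis using B assms by simp
    qed
  qed
qed

text \<open>Pieces of the same tree edge fit together. The tree edge changes only at the lower end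
  of an edge that is not a leaf, which is a crossing.\<close>

lemma A_eq_B_or_height:
  assumes "i < N" "0 < y" "y < h i"
  shows "A i y = B i (y - 1) \<or> (\<exists>k. 0 < k \<and> k < N \<and> par k = i \<and> y = h k)"
proof (cases "ej i (y - 1) = ej i y")
  case True
  then show ?thesis using assms by (simp add: A_def B_def)
next
  case False
  let ?j = "ej i y"
  have e: "edge_at i y ?j" using edge_at_ej assms by simp
  have "\<not> edge_at i (y - 1) ?j" using ej_eq False by blast
  then have y: "y = bot i ?j" using e assms by (auto simp: edge_at_def)
  then have "?j \<noteq> Suc i" "y = ?j - i" using assms by (auto simp: bot_def split: if_splits)
  then obtain k where k: "splits I i k ?j" using e edge_splits[of i ?j] by (auto simp: edge_at_def edge_iff)
  then show ?thesis
    using par_rt[OF k] h_split[OF k] splitsD(2-4)[OF k] \<open>y = ?j - i\<close> by (intro disjI2 exI[of _ k]) auto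
qed

lemma crossing_points:
  assumes "0 < k" "k < N"
  shows "A (par k) (h k) = (2 * real k, real (h k), 0)" "B (par k) (h k - 1) = (2 * real k, real (h k), 1)"
    "B k (h k - 1) = (2 * real k, real (h k), 1)"
proof -
  note s = splits_par_rt[OF assms]
  note d = splitsD[OF s] and hl = height_less_parent[OF assms] and hk = h_split[OF s]
  let ?i = "par k" and ?j = "rt k"
  have "bot ?i ?j = h k" using hk d(2,3) by (simp add: bot_def)
  then have "edge_at ?i (h k) ?j" using d(1) bot_less_top[OF d(1)] by (simp add: edge_at_def)
  then have "A ?i (h k) = lower_end I ?i ?j" using edge_point_bot[of ?i ?j] ej_eq \<open>bot ?i ?j = h k\<close> by (simp add: A_def)
  then show "A (par k) (h k) = (2 * real k, real (h k), 0)" using lower_end_split[OF s] hk by simp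
  have t: "top ?i k = h k" using s by (simp add: top_def)
  have u: "upper_end ?i k = (2 * real k, real (h k), 1)" using s by (simp add: upper_end_def)
  have "edge_at ?i (h k - 1) k"
    using d(6) t bot_less_top[OF d(6)] hl(3) by (simp add: edge_at_def)
  then have "B ?i (h k - 1) = upper_end ?i k" using edge_point_top[OF d(6)] ej_eq t hl(3) by (simp add: B_def)
  then show "B (par k) (h k - 1) = (2 * real k, real (h k), 1)" using u by simp
  have ns: "\<not> splits I k ?j (rt ?j)" using not_left_and_right s by blast
  then have t: "top k ?j = h k" by (simp add: top_def)
  have u: "upper_end k ?j = (2 * real k, real (h k), 1)" using ns assms by (simp add: upper_end_def)
  have "edge_at k (h k - 1) ?j"
    using d(7) t bot_less_top[OF d(7)] hl(3) by (simp add: edge_at_def)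
  then have "B k (h k - 1) = upper_end k ?j" using edge_point_top[OF d(7)] ej_eq t hl(3) by (simp add: B_def)
  then show "B k (h k - 1) = (2 * real k, real (h k), 1)" using u by simp
qed

lemma h_pos: "i < N \<Longrightarrow> 0 < h i"
  using height_less_parent(3)[of i] by (cases "i = 0") (auto simp: h_def)

lemma A_base: "i < N \<Longrightarrow> A i 0 = (2 * real i + 1, 0, 0)"
proof -
  assume i: "i < N"
  have "edge_at i 0 (Suc i)" using leaf_edge[OF i] bot_less_top[OF leaf_edge[OF i]] by (simp add: edge_at_def bot_def)
  then have "A i 0 = edge_point i (Suc i) (bot i (Suc i))" using ej_eq by (simp add: A_def bot_def)
  then show ?thesis by (simp only: edge_point_bot lower_end_leaf)
qed

lemma B_root: "B 0 N = (fst (lower_end I 0 N), real (Suc N), 0)"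
proof -
  have ns: "\<not> splits I 0 N (rt N)" using splitsD(3,4)[of 0 N "rt N"] by auto
  then have t: "top 0 N = Suc N" by (simp add: top_def h_def)
  have "edge_at 0 N N" using root_edge bot_less_top[OF root_edge] t by (simp add: edge_at_def)
  then have "B 0 N = edge_point 0 N (top 0 N)" using ej_eq t by (simp add: B_def)
  then show ?thesis using edge_point_top[OF root_edge] ns by (simp add: upper_end_def)
qed

lemma \<sigma>_par: "0 < k \<Longrightarrow> k < N \<Longrightarrow> \<sigma> k \<noteq> \<sigma> (par k)"
  using \<sigma>_split[OF splits_par_rt] by blast

end

section \<open>Subdivided polygons represent the same oriented link\<close>

section \<open>Subdivision of links\<close>

definition subarc :: "'a::real_normed_vector \<Rightarrow> 'a \<Rightarrow> 'a \<Rightarrow> 'a \<Rightarrow> bool" where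
  "subarc p q u v \<longleftrightarrow> (\<exists>s t. 0 \<le> s \<and> s < t \<and> t \<le> 1 \<and> u = linepath p q s \<and> v = linepath p q t)"

text \<open>The boundary of the surface is the link diagram cut at integer heights; this relation
  records that the point set and the directions are unchanged.\<close>

definition refines :: "('a::real_normed_vector \<times> 'a) set \<Rightarrow> ('a \<times> 'a) set \<Rightarrow> bool" where
  "refines E' E \<longleftrightarrow> (\<forall>u v. (u, v) \<in> E' \<longrightarrow> (\<exists>p q. (p, q) \<in> E \<and> subarc p q u v)) \<and>
    polygon_support E \<subseteq> polygon_support E'"

lemma refinesI:
  assumes "\<And>u v. (u, v) \<in> E' \<Longrightarrow> \<exists>p q. (p, q) \<in> E \<and> subarc p q u v"
    and "polygon_support E \<subseteq> polygon_support E'"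
  shows "refines E' E"
  using assms unfolding refines_def by blast

lemma refinesD:
  assumes "refines E' E"
  shows "(u, v) \<in> E' \<Longrightarrow> \<exists>p q. (p, q) \<in> E \<and> subarc p q u v"
    and "polygon_support E \<subseteq> polygon_support E'"
  using assms unfolding refines_def by blast+

lemma linepath_linepath:
  "linepath (linepath p q s) (linepath p q t) x = linepath p q (s + (t - s) * x)"
  by (simp add: linepath_def algebra_simps)

lemma closed_segment_eq_linepath: "closed_segment p q = linepath p q ` {0..1}"
  by (simp add: linepath_image_01)

lemma subarc_segment_subset: "subarc p q u v \<Longrightarrow> closed_segment u v \<subseteq> closed_segment p q"
  unfolding subarc_def closed_segment_eq_linepath
proof safe
  fix s t x :: real
  assume "0 \<le> s" "s < t" "t \<le> 1" "x \<in> {0..1}"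
  then have "0 \<le> (t - s) * x" "(t - s) * x \<le> t - s" by (auto intro: mult_left_le)
  then have "s + (t - s) * x \<in> {0..1}"
    using \<open>0 \<le> s\<close> \<open>t \<le> 1\<close> unfolding atLeastAtMost_iff by linarith
  then show "linepath (linepath p q s) (linepath p q t) x \<in> linepath p q ` {0..1}"
    unfolding linepath_linepath by (rule imageI)
qed

lemma refines_support: "refines E' E \<Longrightarrow> polygon_support E' = polygon_support E"
proof
  assume r: "refines E' E"
  show "polygon_support E \<subseteq> polygon_support E'" by (rule refinesD(2)[OF r])
  show "polygon_support E' \<subseteq> polygon_support E"
  proof
    fix x assume "x \<in> polygon_support E'"
    then obtain u v where uv: "(u, v) \<in> E'" "x \<in> closed_segment u v" unfolding polygon_support_def by blast
    then obtain p q where "(p, q) \<in> E" "subarc p q u v" using refinesD(1)[OF r] by blast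
    then show "x \<in> polygon_support E" using subarc_segment_subset uv(2) unfolding polygon_support_def by blast
  qed
qed

lemma carriesD:
  assumes "carries f E E'"
  shows "f ` sgn ` polygon_support E = sgn ` polygon_support E'"
    and "(p, q) \<in> E \<Longrightarrow> (r, s) \<in> E' \<Longrightarrow> 0 \<le> a \<and> a < b \<and> b \<le> 1 \<and> c \<in> {0..1} \<and> d \<in> {0..1} \<and>
        f ` sgn ` linepath p q ` {a..b} \<subseteq> sgn ` closed_segment r s \<and>
        f (sgn (linepath p q a)) = sgn (linepath r s c) \<and>
        f (sgn (linepath p q b)) = sgn (linepath r s d) \<Longrightarrow> c < d"
proof -
  show "f ` sgn ` polygon_support E = sgn ` polygon_support E'"
    using assms unfolding carries_def by (rule conjunct1)
  assume "(p, q) \<in> E" "(r, s) \<in> E'"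
  from bspec[OF case_prodD[OF bspec[OF conjunct2[OF assms[unfolded carries_def]] this(1)]] this(2), THEN case_prodD]
  show "0 \<le> a \<and> a < b \<and> b \<le> 1 \<and> c \<in> {0..1} \<and> d \<in> {0..1} \<and>
        f ` sgn ` linepath p q ` {a..b} \<subseteq> sgn ` closed_segment r s \<and>
        f (sgn (linepath p q a)) = sgn (linepath r s c) \<and>
        f (sgn (linepath p q b)) = sgn (linepath r s d) \<Longrightarrow> c < d"
    by (elim allE impE)
qed

text \<open>The same isotopy works. A piece of an edge of \<open>E'\<close> is a piece of an edge of
  \<open>E\<close> under an increasing affine change of parameter, so the orientation test for
  \<open>E'\<close> is an instance of the test for \<open>E\<close>.\<close>

lemma isotopic_if_refines:
  assumes "refines E' E" "isotopic E L"
  shows "isotopic E' L"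
proof -
  obtain H where H: "ambient_isotopy H" "carries (H 1) E L" using assms(2) unfolding isotopic_def by auto
  have "carries (H 1) E' L"
    unfolding carries_def
  proof (intro conjI)
    show "H 1 ` sgn ` polygon_support E' = sgn ` polygon_support L"
      using carriesD(1)[OF H(2)] refines_support[OF assms(1)] by simp
    have key: "c < d" if uv: "(u, v) \<in> E'" and xy: "(x, y) \<in> L"
      and ab: "0 \<le> a" "a < b" "b \<le> 1" and cd: "c \<in> {0..1}" "d \<in> {0..1}"
      and sub: "H 1 ` sgn ` linepath u v ` {a..b} \<subseteq> sgn ` closed_segment x y"
      and ends: "H 1 (sgn (linepath u v a)) = sgn (linepath x y c)" "H 1 (sgn (linepath u v b)) = sgn (linepath x y d)"
    for u v x y a b c d
    proof -
      obtain p q where pq: "(p, q) \<in> E" "subarc p q u v"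
        using refinesD(1)[OF assms(1) uv] by blast
      then obtain s t where st: "0 \<le> s" "s < t" "t \<le> 1" "u = linepath p q s" "v = linepath p q t"
        unfolding subarc_def by auto
      let ?r = "\<lambda>x. s + (t - s) * x"
      have r: "linepath u v x = linepath p q (?r x)" for x unfolding st(4,5) linepath_linepath ..
      have "linepath p q ` {?r a..?r b} \<subseteq> linepath u v ` {a..b}"
      proof
        fix w assume "w \<in> linepath p q ` {?r a..?r b}"
        then obtain z where z: "w = linepath p q z" "?r a \<le> z" "z \<le> ?r b" by auto
        have "?r ((z - s) / (t - s)) = z" using st by simp
        moreover have "a \<le> (z - s) / (t - s)" "(z - s) / (t - s) \<le> b"
          using z st(2) by (simp_all add: pos_le_divide_eq pos_divide_le_eq algebra_simps)
        ultimately show "w \<in> linepath u v ` {a..b}"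
          using z(1) r[of "(z - s) / (t - s)"] by (intro image_eqI[of _ _ "(z - s) / (t - s)"]) auto
      qed
      then have "H 1 ` sgn ` linepath p q ` {?r a..?r b} \<subseteq> sgn ` closed_segment x y" using sub by blast
      moreover have "0 \<le> ?r a" using st ab by simp
      moreover have "?r a < ?r b" using st ab by simp
      moreover have "?r b \<le> 1"
      proof -
        have "(t - s) * b \<le> t - s" using st ab by (intro mult_left_le) auto
        then show ?thesis using st(3) by linarith
      qed
      moreover have "H 1 (sgn (linepath p q (?r a))) = sgn (linepath x y c)"
        "H 1 (sgn (linepath p q (?r b))) = sgn (linepath x y d)" using ends r by simp_all
      ultimately have "0 \<le> ?r a \<and> ?r a < ?r b \<and> ?r b \<le> 1 \<and> c \<in> {0..1} \<and> d \<in> {0..1} \<and>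
        H 1 ` sgn ` linepath p q ` {?r a..?r b} \<subseteq> sgn ` closed_segment x y \<and>
        H 1 (sgn (linepath p q (?r a))) = sgn (linepath x y c) \<and>
        H 1 (sgn (linepath p q (?r b))) = sgn (linepath x y d)"
        using cd by (intro conjI)
      then show ?thesis by (rule carriesD(2)[OF H(2) pq(1) xy])
    qed
    show "\<forall>(p, q)\<in>E'. \<forall>(r, s)\<in>L. \<forall>a b c d.
        0 \<le> a \<and> a < b \<and> b \<le> 1 \<and> c \<in> {0..1} \<and> d \<in> {0..1} \<and>
        H 1 ` sgn ` linepath p q ` {a..b} \<subseteq> sgn ` closed_segment r s \<and>
        H 1 (sgn (linepath p q a)) = sgn (linepath r s c) \<and>
        H 1 (sgn (linepath p q b)) = sgn (linepath r s d) \<longrightarrow> c < d"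
    proof (intro ballI case_prodI2 allI impI)
      fix e p q f r s a b c d
      assume *: "e \<in> E'" "e = (p, q)" "f \<in> L" "f = (r, s)"
        "0 \<le> a \<and> a < b \<and> b \<le> 1 \<and> c \<in> {0..1} \<and> d \<in> {0..1} \<and>
        H 1 ` sgn ` linepath p q ` {a..b} \<subseteq> sgn ` closed_segment r s \<and>
        H 1 (sgn (linepath p q a)) = sgn (linepath r s c) \<and>
        H 1 (sgn (linepath p q b)) = sgn (linepath r s d)"
      have 1: "(p, q) \<in> E'" "(r, s) \<in> L" by (rule subst[OF *(2)], rule *(1), rule subst[OF *(4)], rule *(3))
      show "c < d" by (rule key[OF 1]) (insert *(5), elim conjE, assumption)+
    qed
  qed
  then show ?thesis using H(1) unfolding isotopic_def by blast
qed

lemma polygon_support_Un: "polygon_support (E \<union> F) = polygon_support E \<union> polygon_support F"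
  and polygon_support_UN: "polygon_support (\<Union>x\<in>X. G x) = (\<Union>x\<in>X. polygon_support (G x))"
  unfolding polygon_support_def by (rule UN_Un, rule UN_UN_flatten)

lemma refines_refl: "refines E E"
proof (rule refinesI)
  fix u v assume "(u, v) \<in> E"
  moreover have "subarc u v u v" unfolding subarc_def
    by (rule exI[of _ 0], rule exI[of _ 1]) (simp add: linepath_def)
  ultimately show "\<exists>p q. (p, q) \<in> E \<and> subarc p q u v" by blast
qed simp

lemma refines_UN:
  assumes "\<And>x. x \<in> X \<Longrightarrow> refines (E' x) (E x)"
  shows "refines (\<Union>x\<in>X. E' x) (\<Union>x\<in>X. E x)"
proof (rule refinesI)
  fix u v assume "(u, v) \<in> (\<Union>x\<in>X. E' x)"
  then obtain x where x: "x \<in> X" "(u, v) \<in> E' x" by blast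
  obtain p q where "(p, q) \<in> E x" "subarc p q u v" using refinesD(1)[OF assms[OF x(1)] x(2)] by blast
  then show "\<exists>p q. (p, q) \<in> (\<Union>x\<in>X. E x) \<and> subarc p q u v" using x(1) by blast
next
  show "polygon_support (\<Union>x\<in>X. E x) \<subseteq> polygon_support (\<Union>x\<in>X. E' x)"
    unfolding polygon_support_UN by (rule UN_mono[OF subset_refl]) (rule refinesD(2)[OF assms])
qed

lemma refines_Un:
  assumes "refines E' E" "refines F' F"
  shows "refines (E' \<union> F') (E \<union> F)"
proof (rule refinesI)
  fix u v assume "(u, v) \<in> E' \<union> F'"
  then show "\<exists>p q. (p, q) \<in> E \<union> F \<and> subarc p q u v" using refinesD(1)[OF assms(1)] refinesD(1)[OF assms(2)] by blast
next
  show "polygon_support (E \<union> F) \<subseteq> polygon_support (E' \<union> F')"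
    unfolding polygon_support_Un using refinesD(2)[OF assms(1)] refinesD(2)[OF assms(2)] by blast
qed

lemma polygon_support_converse:
  fixes E :: "('a::real_normed_vector \<times> 'a) set"
  shows "polygon_support (E\<inverse>) = polygon_support E"
proof -
  have "polygon_support (E\<inverse>) \<subseteq> polygon_support E" for E :: "('a \<times> 'a) set"
    unfolding polygon_support_def using closed_segment_commute by fastforce
  from this[of E] this[of "E\<inverse>"] show ?thesis by simp
qed

lemma subarc_reverse: "subarc p q u v \<Longrightarrow> subarc q p v u"
  unfolding subarc_def
proof safe
  fix s t :: real assume "0 \<le> s" "s < t" "t \<le> 1"
  then show "\<exists>s' t'. 0 \<le> s' \<and> s' < t' \<and> t' \<le> 1 \<and> linepath p q t = linepath q p s' \<and> linepath p q s = linepath q p t'"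
    by (intro exI[of _ "1 - t"] exI[of _ "1 - s"]) (simp add: linepath_def algebra_simps)
qed

lemma refines_converse:
  assumes "refines E' E"
  shows "refines (E'\<inverse>) (E\<inverse>)"
proof -
  show ?thesis
  proof (rule refinesI)
    fix u v assume "(u, v) \<in> E'\<inverse>"
    then have "(v, u) \<in> E'" by simp
    then obtain p q where "(p, q) \<in> E" "subarc p q v u" using refinesD(1)[OF assms] by blast
    then show "\<exists>p q. (p, q) \<in> E\<inverse> \<and> subarc p q u v" using subarc_reverse[of p q v u] by blast
  qed (use refinesD(2)[OF assms] in \<open>simp only: polygon_support_converse\<close>)
qed

lemma refines_image:
  assumes f: "\<And>p q t. f (linepath p q t) = linepath (f p) (f q) t" and "refines E' E"
  shows "refines (map_prod f f ` E') (map_prod f f ` E)"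
proof -
  have seg: "closed_segment (f p) (f q) = f ` closed_segment p q" for p q
    unfolding closed_segment_eq_linepath image_image f ..
  have supp: "polygon_support (map_prod f f ` F) = f ` polygon_support F" for F
    unfolding polygon_support_def by (simp add: image_UN seg case_prod_beta')
  show ?thesis
  proof (rule refinesI)
    fix u' v' assume "(u', v') \<in> map_prod f f ` E'"
    then obtain u v where uv: "u' = f u" "v' = f v" "(u, v) \<in> E'" by auto
    obtain p q where pq: "(p, q) \<in> E" "subarc p q u v" using refinesD(1)[OF assms(2) uv(3)] by blast
    then obtain s t where "0 \<le> s" "s < t" "t \<le> 1" "u = linepath p q s" "v = linepath p q t"
      unfolding subarc_def by blast
    then have "subarc (f p) (f q) u' v'" unfolding subarc_def uv by (metis f)
    moreover have "(f p, f q) \<in> map_prod f f ` E" using pq(1) by force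
    ultimately show "\<exists>p q. (p, q) \<in> map_prod f f ` E \<and> subarc p q u' v'" by (intro exI conjI)
  next
    show "polygon_support (map_prod f f ` E) \<subseteq> polygon_support (map_prod f f ` E')"
      unfolding supp using refinesD(2)[OF assms(2)] by blast
  qed
qed

lemma linepath_between:
  assumes "s < t" "s \<le> x" "x \<le> t"
  shows "linepath p q x \<in> closed_segment (linepath p q s) (linepath p q t)"
proof -
  have "(x - s) / (t - s) \<in> {0..1}" using assms by (simp add: divide_simps)
  moreover have "linepath (linepath p q s) (linepath p q t) ((x - s) / (t - s)) = linepath p q x"
    unfolding linepath_linepath using assms by simp
  ultimately show ?thesis unfolding closed_segment_eq_linepath by force
qed

lemma refines_chain:
  fixes m n :: nat and p q :: "'a::real_normed_vector"
  assumes "m < n"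
  defines "c \<equiv> \<lambda>y::nat. linepath p q ((real y - real m) / (real n - real m))"
  shows "refines (\<Union>y\<in>{m..<n}. {(c y, c (Suc y))}) {(p, q)}"
proof -
  let ?r = "\<lambda>y::nat. (real y - real m) / (real n - real m)"
  have mn: "real m < real n" using assms by simp
  have r_less: "?r y < ?r (Suc y)" for y using mn by (simp add: divide_strict_right_mono)
  show ?thesis
  proof (rule refinesI)
  show "\<exists>p' q'. (p', q') \<in> {(p, q)} \<and> subarc p' q' u v"
    if uv: "(u, v) \<in> (\<Union>y\<in>{m..<n}. {(c y, c (Suc y))})" for u v
  proof -
    obtain y where y: "m \<le> y" "y < n" "u = c y" "v = c (Suc y)" using uv by auto
    then have "0 \<le> ?r y" "?r (Suc y) \<le> 1" using mn by (auto simp: divide_simps)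
    then have "subarc p q u v" unfolding y(3,4) subarc_def c_def using r_less by blast
    then show ?thesis by blast
  qed
  show "polygon_support {(p, q)} \<subseteq> polygon_support (\<Union>y\<in>{m..<n}. {(c y, c (Suc y))})"
  proof
    fix w assume "w \<in> polygon_support {(p, q)}"
    then obtain x where x: "0 \<le> x" "x \<le> 1" "w = linepath p q x"
      unfolding polygon_support_def closed_segment_eq_linepath by auto
    \<comment> \<open>The height of the given point; its integer part selects the piece, except at
      the upper end n.\<close>
    define z where "z = real m + x * (real n - real m)"
    have z: "real m \<le> z" "z \<le> real n" "x = (z - real m) / (real n - real m)"
    proof -
      have "0 \<le> x * (real n - real m)" "x * (real n - real m) \<le> real n - real m"
        using x mn by (auto intro: mult_left_le_one_le)
      then show "real m \<le> z" "z \<le> real n" unfolding z_def by linarith+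
      show "x = (z - real m) / (real n - real m)" using mn by (simp add: z_def)
    qed
    have "\<exists>y\<in>{m..<n}. real y \<le> z \<and> z \<le> real (Suc y)"
    proof (cases "z = real n")
      case True
      then show ?thesis using assms by (intro bexI[of _ "n - 1"]) auto
    next
      case False
      then have "nat \<lfloor>z\<rfloor> < n" "m \<le> nat \<lfloor>z\<rfloor>" using z(1,2) by linarith+
      moreover have "real (nat \<lfloor>z\<rfloor>) \<le> z" "z \<le> real (Suc (nat \<lfloor>z\<rfloor>))" using z(1) by linarith+
      ultimately show ?thesis by auto
    qed
    then obtain y where y: "y \<in> {m..<n}" "real y \<le> z" "z \<le> real (Suc y)" by blast
    have "?r y \<le> x" "x \<le> ?r (Suc y)" unfolding z(3) using y mn by (intro divide_right_mono; simp)+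
    then have "w \<in> closed_segment (c y) (c (Suc y))" unfolding x(3) c_def by (rule linepath_between[OF r_less])
    then show "w \<in> polygon_support (\<Union>y\<in>{m..<n}. {(c y, c (Suc y))})"
      using y(1) unfolding polygon_support_def by blast
  qed
  qed
qed

definition oriented :: "bool \<Rightarrow> ('a \<times> 'a) set \<Rightarrow> ('a \<times> 'a) set" where
  "oriented s E = (if s then E else E\<inverse>)"

lemma oriented_single: "oriented s {(p, q)} = {arc_of_sign s p q}"
  by (auto simp: oriented_def arc_of_sign_def)

lemma oriented_UN: "oriented s (\<Union>x\<in>X. E x) = (\<Union>x\<in>X. oriented s (E x))"
  by (auto simp: oriented_def)

lemma refines_oriented: "refines E' E \<Longrightarrow> refines (oriented s E') (oriented s E)"
  by (simp add: oriented_def refines_converse)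

context partition_tree
begin

definition L :: "nat \<Rightarrow> nat \<Rightarrow> R3" where "L i y = (2 * real i, real y, 0)"

definition pieces :: "(R3 \<times> R3) set" where
  "pieces = (\<Union>i<N. \<Union>y<h i. oriented (\<sigma> i) {(A i y, B i y)}) \<union>
     (\<Union>i<N. \<Union>y<h i. oriented (\<not> \<sigma> i) {(L i y, L i (Suc y))}) \<union> {(B 0 N, L 0 (Suc N))}"

text \<open>\<open>tangle\<close> lists arcs by splits; regrouping by left ends attaches them to
  discs. Strand k carries the sign of the edge split at k, which is opposite to that of leaf k. The
  closing arcs supply the root edge and strand 0, leaving only the horizontal arc of the
  cap.\<close>

lemma closed_tangle_eq:
  "closed_tangle I = (\<Union>(i, j)\<in>T. oriented (\<sigma> i) {(lower_end I i j, upper_end i j)}) \<union>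
     (\<Union>i<N. oriented (\<not> \<sigma> i) {(L i 0, L i (h i))}) \<union> {(B 0 N, L 0 (Suc N))}" (is "_ = ?E \<union> ?V \<union> ?C")
proof -
  let ?t1 = "{arc_of_sign s (lower_end I i k) (over_point i k j) | i k j s. splits I i k j \<and> edge_sign I i k s}"
  let ?t2 = "{arc_of_sign s (lower_end I k j) (over_point i k j) | i k j s. splits I i k j \<and> edge_sign I k j s}"
  let ?t3 = "{arc_of_sign s (2 * real k, 0, 0) (lower_end I i j) | i k j s. splits I i k j \<and> edge_sign I i j s}"
  let ?root = "(lower_end I 0 N, upper_end 0 N)" and ?left = "(L 0 (h 0), L 0 0)"
  have "\<not> splits I 0 N (rt N)" using splitsD(3,4)[of 0 N "rt N"] by auto
  then have root: "upper_end 0 N = (fst (lower_end I 0 N), real (Suc N), 0)" by (simp add: upper_end_def)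
  have ct: "closed_tangle I = ?t1 \<union> ?t2 \<union> ?t3 \<union> {?root, (B 0 N, L 0 (Suc N)), ?left}"
    unfolding closed_tangle_def tangle_def Let_def root B_root by (simp add: L_def h_def add.commute)
  have up1: "over_point i k j = upper_end i k" if "splits I i k j" for i k j
    using par_rt[OF that] h_split[OF that] that by (simp add: over_point_def upper_end_def)
  have up2: "over_point i k j = upper_end k j" if "splits I i k j" for i k j
  proof -
    have "\<not> splits I k j (rt j)" using not_left_and_right that by blast
    then show ?thesis using h_split[OF that] splitsD(2)[OF that] by (simp add: over_point_def upper_end_def)
  qed
  have low: "lower_end I i j = L k (h k)" if "splits I i k j" for i k j
    using lower_end_split[OF that] h_split[OF that] by (simp add: L_def)
  have L0: "L k 0 = (2 * real k, 0, 0)" for k by (simp add: L_def)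
  have E: "?E = {arc_of_sign (\<sigma> i) (lower_end I i j) (upper_end i j) | i j. (i, j) \<in> T}"
    unfolding oriented_single by auto
  have V: "?V = {arc_of_sign (\<not> \<sigma> i) (L i 0) (L i (h i)) | i. i < N}"
    unfolding oriented_single by auto
  have r: "?root \<in> ?E" unfolding E using root_edge \<sigma>_0 by (force simp: arc_of_sign_def)
  have l: "?left \<in> ?V" unfolding V using N_pos \<sigma>_0 by (force simp: arc_of_sign_def)
  have 1: "?t1 \<subseteq> ?E" unfolding E using up1 splitsD(6) by (auto simp: edge_sign_iff) blast
  have 2: "?t2 \<subseteq> ?E" unfolding E using up2 splitsD(7) by (auto simp: edge_sign_iff) blast
  have 3: "?t3 \<subseteq> ?V"
  proof
    fix e assume "e \<in> ?t3"
    then obtain i k j s where e: "e = arc_of_sign s (2 * real k, 0, 0) (lower_end I i j)" "splits I i k j" "edge_sign I i j s"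
      by blast
    then have "s = (\<not> \<sigma> k)" "k < N" using \<sigma>_split[OF e(2)] splitsD[OF e(2)] by (auto simp: edge_sign_iff)
    then show "e \<in> ?V" unfolding V e(1) low[OF e(2)] L0[symmetric] by blast
  qed
  have 4: "?E \<subseteq> ?t1 \<union> ?t2 \<union> {?root}"
  proof
    fix e assume "e \<in> ?E"
    then obtain i j where e: "e = arc_of_sign (\<sigma> i) (lower_end I i j) (upper_end i j)" "(i, j) \<in> T" unfolding E by blast
    have s: "edge_sign I i j (\<sigma> i)" using e(2) by (simp add: edge_sign_iff)
    from e(2) show "e \<in> ?t1 \<union> ?t2 \<union> {?root}"
    proof (cases rule: edge_kind)
      case left
      have "e = arc_of_sign (\<sigma> i) (lower_end I i j) (over_point i j (rt j))" using e(1) up1[OF left(1)] by simp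
      then have "e \<in> ?t1" using left(1) s by blast
      then show ?thesis by blast
    next
      case root
      then show ?thesis using e(1) \<sigma>_0 by (simp add: arc_of_sign_def)
    next
      case right
      have "e = arc_of_sign (\<sigma> i) (lower_end I i j) (over_point (par i) i j)" using e(1) up2[OF right(3)] by simp
      then have "e \<in> ?t2" using right(3) s by blast
      then show ?thesis by blast
    qed
  qed
  have 5: "?V \<subseteq> ?t3 \<union> {?left}"
  proof
    fix e assume "e \<in> ?V"
    then obtain k where e: "e = arc_of_sign (\<not> \<sigma> k) (L k 0) (L k (h k))" "k < N" unfolding V by blast
    show "e \<in> ?t3 \<union> {?left}"
    proof (cases "k = 0")
      case True
      then show ?thesis using e(1) \<sigma>_0 by (simp add: arc_of_sign_def)
    next
      case False
      then have s: "splits I (par k) k (rt k)" using e(2) splits_par_rt by simp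
      have "edge_sign I (par k) (rt k) (\<not> \<sigma> k)" using splitsD(1)[OF s] \<sigma>_split[OF s] by (simp add: edge_sign_iff)
      moreover have "e = arc_of_sign (\<not> \<sigma> k) (2 * real k, 0, 0) (lower_end I (par k) (rt k))"
        unfolding e(1) low[OF s] L0 ..
      ultimately have "e \<in> ?t3" using s by blast
      then show ?thesis by blast
    qed
  qed
  have "t1 \<union> t2 \<union> t3 \<union> {r, c, l} = E \<union> V \<union> {c}"
    if "r \<in> E" "l \<in> V" "t1 \<subseteq> E" "t2 \<subseteq> E" "t3 \<subseteq> V" "E \<subseteq> t1 \<union> t2 \<union> {r}" "V \<subseteq> t3 \<union> {l}"
    for t1 t2 t3 E V :: "(R3 \<times> R3) set" and r c l using that by blast
  from this[OF r l 1 2 3 4 5] show ?thesis unfolding ct .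
qed

lemma pieces_refine: "refines pieces (closed_tangle I)"
proof -
  have 1: "refines (\<Union>y\<in>{bot i j..<top i j}. oriented (\<sigma> i) {(edge_point i j y, edge_point i j (Suc y))})
     (oriented (\<sigma> i) {(lower_end I i j, upper_end i j)})" if "(i, j) \<in> T" for i j
    unfolding oriented_UN[symmetric] edge_point_def by (intro refines_oriented refines_chain bot_less_top that)
  have "refines (\<Union>(i, j)\<in>T. \<Union>y\<in>{bot i j..<top i j}. oriented (\<sigma> i) {(edge_point i j y, edge_point i j (Suc y))})
     (\<Union>(i, j)\<in>T. oriented (\<sigma> i) {(lower_end I i j, upper_end i j)})"
    by (rule refines_UN) (use 1 in auto)
  \<comment> \<open>Regrouping by disc and height: for given i and y, \<open>ej i y\<close> is the
    only edge end j whose range contains y.\<close>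
  also have "(\<Union>(i, j)\<in>T. \<Union>y\<in>{bot i j..<top i j}. oriented (\<sigma> i) {(edge_point i j y, edge_point i j (Suc y))}) =
    (\<Union>i<N. \<Union>y<h i. oriented (\<sigma> i) {(A i y, B i y)})" (is "?l = ?r")
  proof
    show "?l \<subseteq> ?r"
    proof
      fix e assume "e \<in> ?l"
      then obtain i j y where e: "(i, j) \<in> T" "bot i j \<le> y" "y < top i j"
        "e \<in> oriented (\<sigma> i) {(edge_point i j y, edge_point i j (Suc y))}" by auto
      then have "ej i y = j" by (intro ej_eq) (simp add: edge_at_def)
      moreover have "i < N" "y < h i" using e top_le_h[OF e(1)] by (auto simp: edge_iff)
      ultimately show "e \<in> ?r" using e(4) unfolding A_def B_def by blast
    qed
    show "?r \<subseteq> ?l"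
    proof
      fix e assume "e \<in> ?r"
      then obtain i y where e: "i < N" "y < h i" "e \<in> oriented (\<sigma> i) {(A i y, B i y)}" by blast
      note d = edge_at_ejD[OF e(1,2)]
      then have "y \<in> {bot i (ej i y)..<top i (ej i y)}" by simp
      then show "e \<in> ?l" using e(3) d(1) unfolding A_def B_def by blast
    qed
  qed
  finally have E: "refines ?r (\<Union>(i, j)\<in>T. oriented (\<sigma> i) {(lower_end I i j, upper_end i j)})" .
  have V: "refines (\<Union>i<N. \<Union>y<h i. oriented (\<not> \<sigma> i) {(L i y, L i (Suc y))}) (\<Union>i<N. oriented (\<not> \<sigma> i) {(L i 0, L i (h i))})"
  proof (rule refines_UN)
    fix i assume "i \<in> {..<N}"
    then have h: "0 < h i" using h_pos by simp
    have c: "linepath (L i 0) (L i (h i)) ((real y - real 0) / (real (h i) - real 0)) = L i y" for y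
      using h by (simp add: L_def linepath_def field_simps)
    have "refines (\<Union>y\<in>{0..<h i}. {(L i y, L i (Suc y))}) {(L i 0, L i (h i))}"
      using refines_chain[OF h, of "L i 0" "L i (h i)"] unfolding c .
    then show "refines (\<Union>y<h i. oriented (\<not> \<sigma> i) {(L i y, L i (Suc y))}) (oriented (\<not> \<sigma> i) {(L i 0, L i (h i))})"
      unfolding oriented_UN[symmetric] lessThan_atLeast0 by (rule refines_oriented)
  qed
  show ?thesis
    unfolding pieces_def closed_tangle_eq by (intro refines_Un E V refines_refl)
qed

end

section \<open>Joining the two tangle profiles into a strip surface with the link as
  boundary\<close>

section \<open>The Seifert surface of a compatible pair\<close>

context partition_tree
begin

lemma right_piece: "i < N \<Longrightarrow> y < h i \<Longrightarrow> if \<sigma> i then (A i y, B i y) \<in> pieces else (B i y, A i y) \<in> pieces"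
  unfolding pieces_def oriented_def by (cases "\<sigma> i") auto

lemma left_piece: "i < N \<Longrightarrow> y < h i \<Longrightarrow> if \<sigma> i then (L i (Suc y), L i y) \<in> pieces else (L i y, L i (Suc y)) \<in> pieces"
  unfolding pieces_def oriented_def by (cases "\<sigma> i") auto

lemma cap_piece: "(B 0 N, L 0 (Suc N)) \<in> pieces"
  unfolding pieces_def by blast

lemma pieces_cases:
  assumes "(p, q) \<in> pieces"
  obtains (right) i y where "i < N" "y < h i" "if \<sigma> i then p = A i y \<and> q = B i y else p = B i y \<and> q = A i y"
    | (left) i y where "i < N" "y < h i" "if \<sigma> i then p = L i (Suc y) \<and> q = L i y else p = L i y \<and> q = L i (Suc y)"
    | (cap) "p = B 0 N" "q = L 0 (Suc N)"
proof -
  from assms consider i y where "i < N" "y < h i" "(p, q) \<in> oriented (\<sigma> i) {(A i y, B i y)}"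
    | i y where "i < N" "y < h i" "(p, q) \<in> oriented (\<not> \<sigma> i) {(L i y, L i (Suc y))}"
    | "p = B 0 N \<and> q = L 0 (Suc N)"
    unfolding pieces_def by blast
  then show ?thesis
  proof cases
    case (1 i y)
    then show ?thesis using right[of i y] by (simp add: oriented_def split: if_splits)
  next
    case (2 i y)
    then show ?thesis using left[of i y] by (simp add: oriented_def split: if_splits)
  next
    case 3
    then show ?thesis using cap by blast
  qed
qed

end

locale compatible_pair = up: partition_tree I + dn: partition_tree J for I J +
  assumes leaves_eq: "leaves J = leaves I"
    and signs_eq: "i < leaves I \<Longrightarrow> dn.\<sigma> i = up.\<sigma> i"
begin

text \<open>Slab \<open>- k - 1\<close> is the mirror image of slab \<open>k\<close> of the tangle of \<open>J\<close>.\<close>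

definition hi :: "nat \<Rightarrow> int" where "hi i = int (up.h i)"
definition lo :: "nat \<Rightarrow> int" where "lo i = - int (dn.h i)"
text \<open>Reflection exchanges the lower and the upper end of a piece, hence \<open>B\<close> for
  the lower end and, in \<open>pb\<close>, \<open>A\<close> for the upper one.\<close>

definition pa :: "nat \<Rightarrow> int \<Rightarrow> R3" where
  "pa i y = (if 0 \<le> y then up.A i (nat y) else reflect (dn.B i (nat (- y - 1))))"
definition pb :: "nat \<Rightarrow> int \<Rightarrow> R3" where
  "pb i y = (if 0 \<le> y then up.B i (nat y) else reflect (dn.A i (nat (- y - 1))))"

abbreviation ax :: "nat \<Rightarrow> int \<Rightarrow> real" where "ax i y \<equiv> fst (pa i y)"
abbreviation az :: "nat \<Rightarrow> int \<Rightarrow> real" where "az i y \<equiv> snd (snd (pa i y))"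
abbreviation bx :: "nat \<Rightarrow> int \<Rightarrow> real" where "bx i y \<equiv> fst (pb i y)"
abbreviation bz :: "nat \<Rightarrow> int \<Rightarrow> real" where "bz i y \<equiv> snd (snd (pb i y))"

lemma reflect_coords: "fst (reflect p) = fst p" "fst (snd (reflect p)) = - fst (snd p)" "snd (snd (reflect p)) = snd (snd p)"
  by (cases p; simp)+

lemma pa_up: "pa i (int y) = up.A i y" and pb_up: "pb i (int y) = up.B i y"
  and pa_dn: "pa i (- int y - 1) = reflect (dn.B i y)" and pb_dn: "pb i (- int y - 1) = reflect (dn.A i y)"
  by (simp_all add: pa_def pb_def)

lemma height_cases:
  fixes y :: int
  obtains (up) k where "y = int k" | (dn) k where "y = - int k - 1"
proof (cases y rule: int_cases)
  case (nonneg n)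
  then show ?thesis by (rule up)
next
  case (neg n)
  then show ?thesis by (intro dn[of n]) simp
qed

text \<open>Each condition follows from the profile of one tangle, except that the two profiles must
  meet at height 0 and must induce the same signs.\<close>

lemma strips: "strips (leaves I) lo hi up.par dn.par ax az bx bz up.\<sigma>"
proof
  let ?n = "leaves I"
  show "0 < ?n" by (rule up.N_pos)
  show "up.\<sigma> 0" by (rule up.\<sigma>_0)
  show "lo i < 0 \<and> 0 < hi i" if "i < ?n" for i
    using up.h_pos[OF that] dn.h_pos[of i] that leaves_eq by (simp add: lo_def hi_def)
  show "2 * real i < ax i y \<or> (0 < i \<and> y = lo i \<and> ax i y = 2 * real i \<and> az i y = 1)"
    if "i < ?n" "lo i \<le> y" "y < hi i" for i y
  proof (cases y rule: height_cases)
    case (up k)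
    then show ?thesis using up.A_left[of i k] that by (simp add: pa_up hi_def)
  next
    case (dn k)
    then have "k < dn.h i" using that by (simp add: lo_def)
    then show ?thesis using dn.B_left[of i k] that dn leaves_eq
      by (auto simp add: pa_dn lo_def reflect_coords)
  qed
  show "2 * real i < bx i y \<or> (0 < i \<and> y + 1 = hi i \<and> bx i y = 2 * real i \<and> bz i y = 1)"
    if "i < ?n" "lo i \<le> y" "y < hi i" for i y
  proof (cases y rule: height_cases)
    case (up k)
    then have "k < up.h i" using that by (simp add: hi_def)
    then show ?thesis using up.B_left[of i k] that up by (auto simp add: pb_up hi_def)
  next
    case (dn k)
    then have "k < dn.h i" using that by (simp add: lo_def)
    then show ?thesis using dn.A_left[of i k] that dn leaves_eq by (simp add: pb_dn reflect_coords)
  qed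
  show "ax i y < 2 * real k \<or> (y = lo k \<and> dn.par k = i \<and> ax i y = 2 * real k \<and> az i y = 1)"
    if "i < k" "k < ?n" "lo i \<le> y" "y < hi i" "lo k \<le> y" "y < hi k" for i k y
  proof (cases y rule: height_cases)
    case (up m)
    then show ?thesis using up.A_right[of i k m] that by (simp add: pa_up hi_def)
  next
    case (dn m)
    then have "m < dn.h i" "m < dn.h k" using that by (auto simp: lo_def)
    then show ?thesis using dn.B_right[of i k m] that dn leaves_eq
      by (auto simp add: pa_dn lo_def reflect_coords)
  qed
  show "bx i y < 2 * real k \<or> (y + 1 = hi k \<and> up.par k = i \<and> bx i y = 2 * real k \<and> bz i y = 1)"
    if "i < k" "k < ?n" "lo i \<le> y" "y < hi i" "lo k \<le> y" "y < hi k" for i k y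
  proof (cases y rule: height_cases)
    case (up m)
    then have "m < up.h i" "m < up.h k" using that by (auto simp: hi_def)
    then show ?thesis using up.B_right[of i k m] that up by (auto simp add: pb_up hi_def)
  next
    case (dn m)
    then have "m < dn.h i" "m < dn.h k" using that by (auto simp: lo_def)
    then show ?thesis using dn.A_right[of i k m] that dn leaves_eq by (simp add: pb_dn reflect_coords)
  qed
  show "(ax i y = bx i (y - 1) \<and> az i y = bz i (y - 1)) \<or>
      (\<exists>k. 0 < k \<and> k < ?n \<and> (up.par k = i \<and> y = hi k \<or> dn.par k = i \<and> y = lo k))"
    if "i < ?n" "lo i < y" "y < hi i" for i y
  proof (cases y rule: height_cases)
    case (up m)
    show ?thesis
    proof (cases m)
      \<comment> \<open>Here the two tangles are joined: both right sides end at the common endpoint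
        of leaf i.\<close>
      case 0
      then have "pa i y = (2 * real i + 1, 0, 0)" using up.A_base[OF that(1)] up pa_up[of i 0] by simp
      moreover have "pb i (y - 1) = (2 * real i + 1, 0, 0)"
        using dn.A_base[of i] that(1) leaves_eq pb_dn[of i 0] up 0 by simp
      ultimately show ?thesis by simp
    next
      case (Suc m')
      then have y: "y - 1 = int m'" using up by simp
      have "up.A i m = up.B i m' \<or> (\<exists>k. 0 < k \<and> k < ?n \<and> up.par k = i \<and> m = up.h k)"
        using up.A_eq_B_or_height[of i m] that up Suc by (simp add: hi_def)
      then show ?thesis
      proof
        assume "up.A i m = up.B i m'"
        then have "pa i y = pb i (y - 1)" unfolding y pb_up by (simp add: up pa_up)
        then show ?thesis by simp
      next
        assume "\<exists>k. 0 < k \<and> k < ?n \<and> up.par k = i \<and> m = up.h k"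
        then obtain k where "0 < k" "k < ?n" "up.par k = i" "m = up.h k" by blast
        then have "0 < k \<and> k < ?n \<and> up.par k = i \<and> y = hi k" using up by (simp add: hi_def)
        then show ?thesis by blast
      qed
    qed
  next
    case (dn m)
    then have y: "y - 1 = - int (Suc m) - 1" by simp
    have "dn.A i (Suc m) = dn.B i m \<or> (\<exists>k. 0 < k \<and> k < ?n \<and> dn.par k = i \<and> Suc m = dn.h k)"
      using dn.A_eq_B_or_height[of i "Suc m"] that dn leaves_eq by (simp add: lo_def)
    then show ?thesis
    proof
      assume "dn.A i (Suc m) = dn.B i m"
      then show ?thesis unfolding y unfolding dn pa_dn pb_dn by simp
    next
      assume "\<exists>k. 0 < k \<and> k < ?n \<and> dn.par k = i \<and> Suc m = dn.h k"
      then obtain k where "0 < k" "k < ?n" "dn.par k = i" "Suc m = dn.h k" by blast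
      then have "0 < k \<and> k < ?n \<and> dn.par k = i \<and> y = lo k" using dn by (simp add: lo_def)
      then show ?thesis by blast
    qed
  qed
  show "up.par k < k \<and> hi k < hi (up.par k) \<and> up.\<sigma> k \<noteq> up.\<sigma> (up.par k) \<and>
      bx k (hi k - 1) = 2 * real k \<and> bz k (hi k - 1) = 1 \<and>
      ax (up.par k) (hi k) = 2 * real k \<and> az (up.par k) (hi k) = 0 \<and>
      bx (up.par k) (hi k - 1) = 2 * real k \<and> bz (up.par k) (hi k - 1) = 1"
    if "0 < k" "k < ?n" for k
  proof -
    note p = up.height_less_parent[OF that] up.crossing_points[OF that] up.\<sigma>_par[OF that]
    have u: "hi k - 1 = int (up.h k - 1)" "hi k = int (up.h k)" using p(3) by (simp_all add: hi_def)
    have "pb k (hi k - 1) = up.B k (up.h k - 1)" "pb (up.par k) (hi k - 1) = up.B (up.par k) (up.h k - 1)"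
      unfolding u(1) pb_up by simp_all
    moreover have "pa (up.par k) (hi k) = up.A (up.par k) (up.h k)" unfolding u(2) pa_up ..
    moreover have "hi k < hi (up.par k)" using p(2) by (simp add: hi_def)
    ultimately show ?thesis using p by simp
  qed
  show "dn.par k < k \<and> lo (dn.par k) < lo k \<and> up.\<sigma> k \<noteq> up.\<sigma> (dn.par k) \<and>
      ax k (lo k) = 2 * real k \<and> az k (lo k) = 1 \<and>
      ax (dn.par k) (lo k) = 2 * real k \<and> az (dn.par k) (lo k) = 1 \<and>
      bx (dn.par k) (lo k - 1) = 2 * real k \<and> bz (dn.par k) (lo k - 1) = 0"
    if "0 < k" "k < ?n" for k
  proof -
    have k: "k < leaves J" using that leaves_eq by simp
    note p = dn.height_less_parent[OF that(1) k] dn.crossing_points[OF that(1) k] dn.\<sigma>_par[OF that(1) k]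
    have l: "lo k = - int (dn.h k - 1) - 1" "lo k - 1 = - int (dn.h k) - 1" using p(3) by (simp_all add: lo_def)
    \<comment> \<open>Compatibility enters: the signs come from the upper tree, but the gluing
      partner from the lower one.\<close>
    have "up.\<sigma> k \<noteq> up.\<sigma> (dn.par k)" using p(1,7) signs_eq[of k] signs_eq[of "dn.par k"] that by simp
    moreover have "pa k (lo k) = reflect (dn.B k (dn.h k - 1))" "pa (dn.par k) (lo k) = reflect (dn.B (dn.par k) (dn.h k - 1))"
      unfolding l(1) pa_dn by simp_all
    moreover have "pb (dn.par k) (lo k - 1) = reflect (dn.A (dn.par k) (dn.h k))" unfolding l(2) pb_dn ..
    moreover have "lo (dn.par k) < lo k" using p(2) by (simp add: lo_def)
    ultimately show ?thesis using p by simp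
  qed
qed

sublocale surf: strips "leaves I" lo hi up.par dn.par ax az bx bz up.\<sigma>
  by (rule strips)

lemma to_R4_eq: "to_R4 p = (fst p, fst (snd p), snd (snd p), 1)"
  by (cases p) simp

lemma a_up: "i < leaves I \<Longrightarrow> y < up.h i \<Longrightarrow> surf.a i (int y) = to_R4 (up.A i y)"
  and b_up: "i < leaves I \<Longrightarrow> y < up.h i \<Longrightarrow> surf.b i (int y) = to_R4 (up.B i y)"
  and l_up: "surf.l i (int y) = to_R4 (up.L i y)"
  using up.AB_height[of i y]
  by (simp_all add: surf.a_def surf.b_def surf.l_def to_R4_eq pa_up pb_up up.L_def)

lemma a_dn: "i < leaves I \<Longrightarrow> y < dn.h i \<Longrightarrow> surf.a i (- int y - 1) = to_R4 (reflect (dn.B i y))"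
  and b_dn: "i < leaves I \<Longrightarrow> y < dn.h i \<Longrightarrow> surf.b i (- int y - 1) = to_R4 (reflect (dn.A i y))"
  and l_dn: "surf.l i (- int y) = to_R4 (reflect (dn.L i y))"
  using dn.AB_height[of i y] leaves_eq
  by (simp_all add: surf.a_def surf.b_def surf.l_def to_R4_eq pa_dn pb_dn dn.L_def reflect_coords)

lemma slab_up: "surf.slab i (int y) \<longleftrightarrow> i < leaves I \<and> y < up.h i"
  and slab_dn: "surf.slab i (- int y - 1) \<longleftrightarrow> i < leaves I \<and> y < dn.h i"
  by (auto simp: surf.slab_def lo_def hi_def)

definition boundary_pieces :: "(R4 \<times> R4) set" where
  "boundary_pieces = map_prod to_R4 to_R4 ` (up.pieces \<union> map_prod reflect reflect ` (dn.pieces\<inverse>))"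

lemma up_piece: "(p, q) \<in> up.pieces \<Longrightarrow> (to_R4 p, to_R4 q) \<in> boundary_pieces"
  and dn_piece: "(p, q) \<in> dn.pieces \<Longrightarrow> (to_R4 (reflect q), to_R4 (reflect p)) \<in> boundary_pieces"
  unfolding boundary_pieces_def by force+

text \<open>The rim of an unreversed disc runs up on the right and down on the left. On a positive
  disc this agrees with its tree edges and with its strand of opposite sign. In the lower half,
  reflection and reversal together restore the vertical direction.\<close>

lemma outer_boundary_pieces:
  assumes "surf.outer i u v"
  shows "if up.\<sigma> i then (u, v) \<in> boundary_pieces else (v, u) \<in> boundary_pieces"
  using assms
proof cases
  case (right y)
  show ?thesis
  proof (cases y rule: height_cases)
    case (up k)
    then have i: "i < leaves I" "k < up.h i" using right(3) slab_up by auto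
    have "u = to_R4 (up.A i k)" "v = to_R4 (up.B i k)" using right up a_up[OF i] b_up[OF i] by auto
    then show ?thesis using up.right_piece[OF i] up_piece by (auto split: if_splits)
  next
    case (dn k)
    then have i: "i < leaves I" "k < dn.h i" using right(3) slab_dn by auto
    have "u = to_R4 (reflect (dn.B i k))" "v = to_R4 (reflect (dn.A i k))" using right dn a_dn[OF i] b_dn[OF i] by auto
    then show ?thesis using dn.right_piece[of i k] dn_piece i leaves_eq signs_eq[OF i(1)] by (auto split: if_splits)
  qed
next
  case (left y)
  show ?thesis
  proof (cases y rule: height_cases)
    case (up k)
    then have i: "i < leaves I" "k < up.h i" using left(3) slab_up by auto
    have "y + 1 = int (Suc k)" using up by simp
    then have "u = to_R4 (up.L i (Suc k))" "v = to_R4 (up.L i k)" using left up l_up by metis+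
    then show ?thesis using up.left_piece[OF i] up_piece by (auto split: if_splits)
  next
    case (dn k)
    then have i: "i < leaves I" "k < dn.h i" using left(3) slab_dn by auto
    have "y + 1 = - int k" "y = - int (Suc k)" using dn by simp_all
    then have "u = to_R4 (reflect (dn.L i k))" "v = to_R4 (reflect (dn.L i (Suc k)))" using left l_dn by metis+
    then show ?thesis using dn.left_piece[of i k] dn_piece i leaves_eq signs_eq[OF i(1)] by (auto split: if_splits)
  qed
next
  case cap
  have h: "up.h 0 = Suc (leaves I)" by (simp add: up.h_def)
  then have "hi 0 - 1 = int (leaves I)" "hi 0 = int (Suc (leaves I))" by (simp_all add: hi_def)
  then have "u = to_R4 (up.B 0 (leaves I))" "v = to_R4 (up.L 0 (Suc (leaves I)))"
    using cap b_up[of 0 "leaves I"] l_up up.N_pos h by (metis lessI)+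
  then show ?thesis using up_piece[OF up.cap_piece] up.\<sigma>_0 cap by simp
next
  case cup
  have h: "dn.h 0 = Suc (leaves I)" by (simp add: dn.h_def leaves_eq)
  then have "lo 0 = - int (leaves I) - 1" "lo 0 = - int (Suc (leaves I))" by (simp_all add: lo_def)
  then have "u = to_R4 (reflect (dn.L 0 (Suc (leaves I))))" "v = to_R4 (reflect (dn.B 0 (leaves I)))"
    using cup a_dn[of 0 "leaves I"] l_dn up.N_pos h by (metis lessI)+
  then show ?thesis using dn_piece[OF dn.cap_piece] up.\<sigma>_0 cup leaves_eq by simp
qed

lemma up_piece_outer:
  assumes "(p, q) \<in> up.pieces"
  shows "\<exists>i. if up.\<sigma> i then surf.outer i (to_R4 p) (to_R4 q) else surf.outer i (to_R4 q) (to_R4 p)"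
  using assms
proof (cases rule: up.pieces_cases)
  case (right i y)
  have "surf.outer i (to_R4 (up.A i y)) (to_R4 (up.B i y))"
    using surf.outer.right[of i "int y"] a_up b_up slab_up right(1,2) by simp
  then show ?thesis using right(3) by (intro exI[of _ i]) (auto split: if_splits)
next
  case (left i y)
  have "surf.l i (int y + 1) = to_R4 (up.L i (Suc y))" using l_up[of i "Suc y"] by (simp add: add.commute)
  then have "surf.outer i (to_R4 (up.L i (Suc y))) (to_R4 (up.L i y))"
    using surf.outer.left[of i "int y"] l_up[of i y] slab_up left(1,2) by simp
  then show ?thesis using left(3) by (intro exI[of _ i]) (auto split: if_splits)
next
  case cap
  have h: "up.h 0 = Suc (leaves I)" by (simp add: up.h_def)
  then have "hi 0 - 1 = int (leaves I)" "hi 0 = int (Suc (leaves I))" by (simp_all add: hi_def)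
  then have "surf.outer 0 (to_R4 p) (to_R4 q)"
    using surf.outer.cap[of 0] cap b_up[of 0 "leaves I"] l_up up.N_pos h by (metis lessI)
  then show ?thesis using up.\<sigma>_0 by (intro exI[of _ 0]) simp
qed

lemma dn_piece_outer:
  assumes "(p, q) \<in> dn.pieces"
  shows "\<exists>i. if up.\<sigma> i then surf.outer i (to_R4 (reflect q)) (to_R4 (reflect p))
    else surf.outer i (to_R4 (reflect p)) (to_R4 (reflect q))"
  using assms
proof (cases rule: dn.pieces_cases)
  case (right i y)
  then have i: "i < leaves I" using leaves_eq by simp
  have "surf.outer i (to_R4 (reflect (dn.B i y))) (to_R4 (reflect (dn.A i y)))"
    using surf.outer.right[of i "- int y - 1"] a_dn b_dn slab_dn i right(2) by simp
  then show ?thesis using right(3) signs_eq[OF i] by (intro exI[of _ i]) (auto split: if_splits)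
next
  case (left i y)
  then have i: "i < leaves I" using leaves_eq by simp
  have "- int y - 1 + 1 = - int y" "- int y - 1 = - int (Suc y)" by simp_all
  then have "surf.outer i (to_R4 (reflect (dn.L i y))) (to_R4 (reflect (dn.L i (Suc y))))"
    using surf.outer.left[of i "- int y - 1"] l_dn slab_dn i left(2) by metis
  then show ?thesis using left(3) signs_eq[OF i] by (intro exI[of _ i]) (auto split: if_splits)
next
  case cap
  have h: "dn.h 0 = Suc (leaves I)" by (simp add: dn.h_def leaves_eq)
  then have "lo 0 = - int (leaves I) - 1" "lo 0 = - int (Suc (leaves I))" by (simp_all add: lo_def)
  then have "surf.outer 0 (to_R4 (reflect q)) (to_R4 (reflect p))"
    using surf.outer.cup[of 0] cap a_dn[of 0 "leaves I"] l_dn up.N_pos h leaves_eq by (metis lessI)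
  then show ?thesis using up.\<sigma>_0 by (intro exI[of _ 0]) simp
qed

lemma oriented_boundary_eq: "oriented_boundary surf.S = boundary_pieces"
proof (intro subset_antisym subrelI)
  fix u v assume "(u, v) \<in> oriented_boundary surf.S"
  then obtain i where "if up.\<sigma> i then surf.outer i u v else surf.outer i v u"
    unfolding surf.oriented_boundary_S by blast
  then show "(u, v) \<in> boundary_pieces"
    using outer_boundary_pieces[of i u v] outer_boundary_pieces[of i v u] by (cases "up.\<sigma> i") simp_all
next
  fix u v assume "(u, v) \<in> boundary_pieces"
  then consider p q where "(p, q) \<in> up.pieces" "u = to_R4 p" "v = to_R4 q"
    | p q where "(p, q) \<in> dn.pieces" "u = to_R4 (reflect q)" "v = to_R4 (reflect p)"
    unfolding boundary_pieces_def by blast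
  then show "(u, v) \<in> oriented_boundary surf.S"
    unfolding surf.oriented_boundary_S using up_piece_outer dn_piece_outer by cases blast+
qed

lemma to_R4_linepath: "to_R4 (linepath p q t) = linepath (to_R4 p) (to_R4 q) t"
  and reflect_linepath: "reflect (linepath p q t) = linepath (reflect p) (reflect q) t"
  by (cases p; cases q; simp add: linepath_def algebra_simps)+

lemma boundary_refines: "refines (oriented_boundary surf.S) (link_of_pair I J)"
proof -
  have link: "link_of_pair I J = map_prod to_R4 to_R4 ` (closed_tangle I \<union> map_prod reflect reflect ` ((closed_tangle J)\<inverse>))"
    unfolding link_of_pair_def by (intro arg_cong2[of _ _ _ _ "(`)"] arg_cong2[of _ _ _ _ "(\<union>)"] refl) force
  show ?thesis
    unfolding link oriented_boundary_eq boundary_pieces_def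
    by (intro refines_image refines_Un refines_converse up.pieces_refine dn.pieces_refine to_R4_linepath reflect_linepath)
qed

lemma seifert_surface_S:
  assumes "isotopic (link_of_pair I J) K"
  shows "seifert_surface surf.S K"
  unfolding seifert_surface_def
  using surf.oriented_surface_S surf.connected_surface isotopic_if_refines[OF boundary_refines assms] by blast

end

section \<open>From surfaces to extremal invariants and the index\<close>

lemma oriented_thompson_seifert_surface:
  assumes "g \<in> oriented_thompson" "isotopic (thompson_link g) K"
  obtains S where "seifert_surface S K" "2 - int (leaf_number g) \<le> euler_characteristic S"
proof -
  obtain I J where IJ: "reduced_pair g = (I, J)" "represents I J g" "compatible I J"
    using compatible_reduced_pair[OF assms(1)] by blast
  then have trees: "partition_tree I" "partition_tree J" using represents_tree by blast+
  interpret compatible_pair I J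
    using IJ(3) trees unfolding compatible_iff[OF trees]
    by (simp add: compatible_pair_def compatible_pair_axioms_def)
  have "thompson_link g = link_of_pair I J" "leaf_number g = leaves I"
    using IJ(1) by (simp_all add: thompson_link_def leaf_number_def)
  then show ?thesis
    using seifert_surface_S[of K] assms(2) surf.euler_characteristic_S by (intro that[of surf.S]) simp_all
qed

lemma euler_characteristic_le_2:
  assumes "seifert_surface S K"
  shows "euler_characteristic S \<le> 2"
proof -
  interpret oriented_triangulated_surface S
    using assms unfolding seifert_surface_def oriented_surface_iff by blast
  have "connected (\<Union>((hull) convex ` triangles))"
    using assms hulls_Union_eq unfolding seifert_surface_def surface_support_def by simp
  then have "euler \<le> 2" by (rule euler_characteristic_le_2)
  then show ?thesis
    by (simp add: euler_def euler_characteristic_def vertices_def edges_def triangles_def)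
qed

lemma ex_Greatest_int_if_bounded:
  fixes P :: "int \<Rightarrow> bool"
  assumes "P x" and bound: "\<And>y. P y \<Longrightarrow> y \<le> c"
  shows "P (GREATEST x. P x) \<and> (\<forall>y. P y \<longrightarrow> y \<le> (GREATEST x. P x))"
proof -
  \<comment> \<open>Only values from the witness x upwards are kept, which makes the set finite
    without changing its maximum.\<close>
  let ?M = "{y. P y \<and> x \<le> y}"
  have fin: "finite ?M" by (rule finite_subset[of _ "{x..c}"]) (auto dest: bound)
  have ne: "?M \<noteq> {}" using assms(1) by auto
  have P: "P (Max ?M)" using Max_in[OF fin ne] by simp
  have le: "y \<le> Max ?M" if "P y" for y
  proof (cases "x \<le> y")
    case True
    then show ?thesis using that fin by simp
  next
    case False
    have "x \<le> Max ?M" using Max_in[OF fin ne] by simp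
    then show ?thesis using False by linarith
  qed
  have "(GREATEST x. P x) = Max ?M" using P le by (rule Greatest_equality)
  then show ?thesis using P le by simp
qed

lemma max_euler_characteristic:
  assumes "seifert_surface S K"
  shows "\<exists>S'. seifert_surface S' K \<and> max_euler_characteristic K = euler_characteristic S'"
    and "euler_characteristic S \<le> max_euler_characteristic K"
proof -
  let ?P = "\<lambda>x. \<exists>S. seifert_surface S K \<and> x = euler_characteristic S"
  have "?P (euler_characteristic S)" using assms by blast
  moreover have "y \<le> 2" if "?P y" for y using that euler_characteristic_le_2 by blast
  ultimately have *: "?P (max_euler_characteristic K) \<and> (\<forall>y. ?P y \<longrightarrow> y \<le> max_euler_characteristic K)"
    unfolding max_euler_characteristic_def by (rule ex_Greatest_int_if_bounded)
  then show "\<exists>S'. seifert_surface S' K \<and> max_euler_characteristic K = euler_characteristic S'"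
    "euler_characteristic S \<le> max_euler_characteristic K" using assms by blast+
qed

lemma boundary_subset_surface: "polygon_support (oriented_boundary S) \<subseteq> surface_support S"
proof
  fix x assume "x \<in> polygon_support (oriented_boundary S)"
  then obtain a b c where "(a, b, c) \<in> S" "x \<in> closed_segment a b"
    unfolding polygon_support_def oriented_boundary_def by blast
  moreover have "closed_segment a b \<subseteq> convex hull {a, b, c}"
    unfolding segment_convex_hull by (rule hull_mono) blast
  ultimately show "x \<in> surface_support S" unfolding surface_support_def by blast
qed

lemma continuous_on_sgn: "0 \<notin> X \<Longrightarrow> continuous_on X (sgn :: R4 \<Rightarrow> R4)"
  unfolding sgn_div_norm by (intro continuous_intros) auto

text \<open>The isotopy ends in a homeomorphism of the sphere, and \<open>sgn\<close> is a
  homeomorphism from the compact boundary polygon onto its image. Connectedness of the knot is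
  pulled back through both.\<close>

lemma knot_boundary_components:
  assumes S: "seifert_surface S K" and K: "knot K"
  shows "card (components (polygon_support (oriented_boundary S))) = 1"
proof -
  let ?X = "polygon_support (oriented_boundary S)" and ?Y = "polygon_support K"
  have os: "oriented_surface S" and iso: "isotopic (oriented_boundary S) K"
    using S unfolding seifert_surface_def by auto
  then interpret oriented_triangulated_surface S unfolding oriented_surface_iff by blast
  have "boundary = oriented_boundary S" by (simp add: boundary_def oriented_boundary_def)
  then have fin: "finite (oriented_boundary S)" using finite_boundary by simp
  have cpt: "compact ?X"
    unfolding polygon_support_def by (rule compact_UN[OF fin]) (auto intro: compact_segment)
  have rad: "0 \<notin> ?X" "inj_on sgn ?X"
    using os boundary_subset_surface unfolding oriented_surface_iff radial_def by (auto intro: inj_on_subset)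
  have "oriented_link K" "connected ?Y" using K unfolding knot_def by blast+
  then have Y: "0 \<notin> ?Y" "connected ?Y" and "K \<noteq> {}"
    unfolding oriented_link_def radial_def by blast+
  obtain p q where "(p, q) \<in> K" using \<open>K \<noteq> {}\<close> by (metis ex_in_conv surj_pair)
  then have "p \<in> ?Y" unfolding polygon_support_def using ends_in_segment(1) by blast
  then have Y_ne: "?Y \<noteq> {}" by blast
  obtain H where H: "ambient_isotopy H" "carries (H 1) (oriented_boundary S) K"
    using iso unfolding isotopic_def by blast
  have "\<forall>t\<in>{0..1}. \<exists>G. homeomorphism S3 S3 (H t) G" using H(1) unfolding ambient_isotopy_def by blast
  then obtain G where G: "homeomorphism S3 S3 (H 1) G" by (meson atLeastAtMost_iff order_refl zero_le_one)
  have img: "H 1 ` sgn ` ?X = sgn ` ?Y" by (rule carriesD(1)[OF H(2)])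
  have XS: "sgn ` ?X \<subseteq> S3" using rad(1) by (auto simp: S3_def norm_sgn)
  have YS: "sgn ` ?Y \<subseteq> S3" using Y(1) by (auto simp: S3_def norm_sgn)
  have "G (H 1 x) = x" if "x \<in> sgn ` ?X" for x
    using G XS that unfolding homeomorphism_def by blast
  then have "(\<lambda>x. G (H 1 x)) ` sgn ` ?X = (\<lambda>x. x) ` sgn ` ?X" by (rule image_cong[OF refl])
  then have "G ` H 1 ` sgn ` ?X = sgn ` ?X" unfolding image_ident by (simp only: image_image)
  then have GX: "G ` sgn ` ?Y = sgn ` ?X" unfolding img .
  have "connected (G ` sgn ` ?Y)"
  proof (rule connected_continuous_image)
    show "continuous_on (sgn ` ?Y) G" by (rule continuous_on_subset[OF homeomorphism_cont2[OF G] YS])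
    show "connected (sgn ` ?Y)" by (rule connected_continuous_image[OF continuous_on_sgn[OF Y(1)] Y(2)])
  qed
  then have con: "connected (sgn ` ?X)" unfolding GX .
  obtain g where g: "homeomorphism ?X (sgn ` ?X) sgn g"
    using homeomorphism_compact[OF cpt continuous_on_sgn[OF rad(1)] refl rad(2)] by blast
  have "connected (g ` sgn ` ?X)" by (rule connected_continuous_image[OF homeomorphism_cont2[OF g] con])
  then have "connected ?X" unfolding homeomorphism_image2[OF g] .
  moreover have "?X \<noteq> {}" using img Y_ne by auto
  ultimately have "components ?X = {?X}" by (simp add: components_eq_sing_iff)
  then show ?thesis by simp
qed

text \<open>With one boundary component the genus is (1 - \<chi>) / 2, which decreases in \<chi>, so
  the minimal genus belongs to the maximal \<chi>.\<close>

lemma seifert_genus_knot: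
  assumes S: "seifert_surface S K" and K: "knot K"
  shows "seifert_genus K = (1 - real_of_int (max_euler_characteristic K)) / 2"
proof -
  have genus: "surface_genus S = (1 - real_of_int (euler_characteristic S)) / 2" if "seifert_surface S K" for S
    using knot_boundary_components[OF that K] by (simp add: surface_genus_def)
  obtain S' where S': "seifert_surface S' K" "max_euler_characteristic K = euler_characteristic S'"
    using max_euler_characteristic(1)[OF S] by blast
  show ?thesis
    unfolding seifert_genus_def
  proof (rule Least_equality)
    show "\<exists>S. seifert_surface S K \<and> (1 - real_of_int (max_euler_characteristic K)) / 2 = surface_genus S"
      using S' genus by auto
    fix y assume "\<exists>S. seifert_surface S K \<and> y = surface_genus S"
    then obtain S'' where "seifert_surface S'' K" "y = surface_genus S''" by blast
    then show "(1 - real_of_int (max_euler_characteristic K)) / 2 \<le> y"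
      using genus max_euler_characteristic(2) by simp
  qed
qed

theorem theorem1p13:
  fixes L :: "(R4 \<times> R4) set"
  assumes "oriented_link L"
  shows "ereal (real_of_int (max_euler_characteristic L))
           \<ge> - ereal_of_enat (oriented_thompson_index L) + 2 \<and>
         (knot L \<longrightarrow>
           ereal (seifert_genus L) \<le> (ereal_of_enat (oriented_thompson_index L) - 1) / 2)"
proof -
  let ?K = "{enat (leaf_number g) | g. g \<in> oriented_thompson \<and> isotopic (thompson_link g) L}"
  show ?thesis
  proof (cases "?K = {}")
    \<comment> \<open>The index is infinite, and the two bounds become -\<infinity> and
      \<infinity>.\<close>
    case True
    then have "oriented_thompson_index L = \<infinity>"
      unfolding oriented_thompson_index_def by (simp add: Inf_enat_def)
    then show ?thesis by simp
  next
    case False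
    \<comment> \<open>\<open>enat\<close> is well-ordered, so the infimum of a nonempty set is
      attained.\<close>
    then have "Inf ?K \<in> ?K" by (metis (no_types, lifting) ex_in_conv wellorder_InfI)
    then obtain g where g: "g \<in> oriented_thompson" "isotopic (thompson_link g) L"
      and ind: "oriented_thompson_index L = enat (leaf_number g)"
      unfolding oriented_thompson_index_def by blast
    obtain S where S: "seifert_surface S L" "2 - int (leaf_number g) \<le> euler_characteristic S"
      using oriented_thompson_seifert_surface[OF g] by blast
    have "2 - int (leaf_number g) \<le> max_euler_characteristic L"
      using S max_euler_characteristic(2)[OF S(1)] by linarith
    then have m: "2 - real (leaf_number g) \<le> real_of_int (max_euler_characteristic L)" by linarith
    have "seifert_genus L \<le> (real (leaf_number g) - 1) / 2" if "knot L"
      using seifert_genus_knot[OF S(1) that] m by simp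
    moreover have "- ereal_of_enat (oriented_thompson_index L) + 2 = ereal (2 - real (leaf_number g))"
      unfolding ind by simp
    moreover have "(ereal_of_enat (oriented_thompson_index L) - 1) / 2 = ereal ((real (leaf_number g) - 1) / 2)"
      unfolding ind by (simp add: one_ereal_def)
    ultimately show ?thesis using m by simp
  qed
qed

end
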